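(* Let $X,Y$ be smooth manifolds and let $u=\mathrm{cl}[(u_\varepsilon)_\varepsilon]$, $v=\mathrm{cl}[(v_\varepsilon)_\varepsilon]\in\mathcal G[X,Y]$. Then $(u_\varepsilon)_\varepsilon\sim_0(v_\varepsilon)_\varepsilon$ if and only if $u(\tilde p)=v(\tilde p)$ in $\widetilde Y_c$ for all $\tilde p\in\widetilde X_c$.
   Context: Manifolds are smooth, paracompact, Hausdorff and finite-dimensional. $I=(0,1]$, $\mathbb N=\{1,2,\dots\}$, $\mathbb N_0=\mathbb N\cup\{0\}$; $O(\cdot)$ refers to $\varepsilon\to0$. $K\subset\subset X$ means that $K$ is a compact subset of $X$. A supremum over the empty set is $0$. $D^{(k)}$ is the total derivative of order $k$ ($D^{(0)}f=f$) and $\|\cdot\|$ is any norm on the respective space of multilinear maps. $d_h$ is the distance function induced by a Riemannian metric $h$, with $d_h(p,q)=\infty$ if $p,q$ lie in different connected components. $\mathcal E_M[X,Y]$ is the set of all nets $(u_\varepsilon)_\varepsilon\in C^\infty(X,Y)^I$ such that: (i) $\forall K\subset\subset X\ \exists\varepsilon_0>0\ \exists K'\subset\subset Y\ \forall\varepsilon<\varepsilon_0:\ u_\varepsilon(K)\subseteq K'$; (ii) for all $k\in\mathbb N$, each chart $(V,\varphi)$ in $X$, each chart $(W,\psi)$ in $Y$, each $L\subset\subset V$ and each $L'\subset\subset W$ there is $N\in\mathbb N$ with $\sup_{p\in L\cap u_\varepsilon^{-1}(L')}\|D^{(k)}(\psi\circ u_\varepsilon\circ\varphi^{-1})(\varphi(p))\|=O(\varepsilon^{-N})$.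 Two elements $(u_\varepsilon)_\varepsilon,(v_\varepsilon)_\varepsilon$ of $\mathcal E_M[X,Y]$ are equivalent, $(u_\varepsilon)_\varepsilon\sim(v_\varepsilon)_\varepsilon$, if: (i) for all $K\subset\subset X$, $\sup_{p\in K}d_h(u_\varepsilon(p),v_\varepsilon(p))\to0$ as $\varepsilon\to0$ for some (hence every) Riemannian metric $h$ on $Y$; (ii) for all $k\in\mathbb N_0$, $m\in\mathbb N$, charts $(V,\varphi)$ in $X$, $(W,\psi)$ in $Y$, $L\subset\subset V$, $L'\subset\subset W$: $\sup_{p\in L\cap u_\varepsilon^{-1}(L')\cap v_\varepsilon^{-1}(L')}\|D^{(k)}(\psi\circ u_\varepsilon\circ\varphi^{-1}-\psi\circ v_\varepsilon\circ\varphi^{-1})(\varphi(p))\|=O(\varepsilon^m)$. They are equivalent of order $0$, $(u_\varepsilon)_\varepsilon\sim_0(v_\varepsilon)_\varepsilon$, if they satisfy (i) and the condition (ii) for $k=0$ only. $\mathcal G[X,Y]:=\mathcal E_M[X,Y]/\!\sim$; the class of $(u_\varepsilon)_\varepsilon$ is written $\mathrm{cl}[(u_\varepsilon)_\varepsilon]$. A net $(p_\varepsilon)_\varepsilon\in X^I$ is compactly supported if there are $K\subset\subset X$ and $\varepsilon_0>0$ with $p_\varepsilon\in K$ for $\varepsilon<\varepsilon_0$. Compactly supported nets $(p_\varepsilon)_\varepsilon,(q_\varepsilon)_\varepsilon$ are equivalent if $d_h(p_\varepsilon,q_\varepsilon)=O(\varepsilon^m)$ for each $m>0$, for one (equivalently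 every) Riemannian metric $h$ on $X$. The quotient is $\widetilde X_c$, with elements $\tilde p=\mathrm{cl}[(p_\varepsilon)_\varepsilon]$; $\widetilde Y_c$ is defined likewise. For $u=\mathrm{cl}[(u_\varepsilon)_\varepsilon]\in\mathcal G[X,Y]$ and $\tilde p=\mathrm{cl}[(p_\varepsilon)_\varepsilon]\in\widetilde X_c$ the point value is $u(\tilde p):=\mathrm{cl}[(u_\varepsilon(p_\varepsilon))_\varepsilon]\in\widetilde Y_c$ (this is well defined). *)

theory Defs
  imports "HOL-Analysis.Analysis"
begin

section \<open>Model spaces, derivatives of higher order\<close>

text \<open>Finite-dimensional inner product spaces. In contrast to \<open>euclidean_space\<close>, whose basis
  is nonempty, dimension 0 is allowed.\<close>

class findim_inner = real_inner +
  assumes finite_dimensional: "\<exists>B. finite B \<and> (\<forall>x. \<exists>c. x = (\<Sum>b\<in>B. c b *\<^sub>R b))"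

instance euclidean_space \<subseteq> findim_inner
proof
  show "\<exists>B::'a set. finite B \<and> (\<forall>x. \<exists>c. x = (\<Sum>b\<in>B. c b *\<^sub>R b))"
    by (rule exI[of _ Basis]) (metis euclidean_representation finite_Basis)
qed

text \<open>\<open>iterated_deriv f [h\<^sub>1, \<dots>, h\<^sub>k] x\<close> is \<open>D\<^sup>(\<^sup>k\<^sup>)f(x)(h\<^sub>1, \<dots>, h\<^sub>k)\<close>. It is only meaningful at points
  near which \<open>f\<close> is sufficiently often differentiable.\<close>

primrec iterated_deriv ::
    "('e::real_normed_vector \<Rightarrow> 'f::real_normed_vector) \<Rightarrow> 'e list \<Rightarrow> 'e \<Rightarrow> 'f" where
  "iterated_deriv f [] = f"
| "iterated_deriv f (h # hs) = (\<lambda>x. frechet_derivative (iterated_deriv f hs) (at x) h)"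

text \<open>The operator norm of the multilinear map \<open>D\<^sup>(\<^sup>k\<^sup>)f(x)\<close>.\<close>

definition deriv_norm ::
    "nat \<Rightarrow> ('e::real_normed_vector \<Rightarrow> 'f::real_normed_vector) \<Rightarrow> 'e \<Rightarrow> ennreal" where
  "deriv_norm k f x =
     (SUP hs \<in> {hs. length hs = k \<and> (\<forall>h\<in>set hs. norm h \<le> 1)}. ennreal (norm (iterated_deriv f hs x)))"

text \<open>On a finite-dimensional domain, differentiability of \<open>D\<^sup>(\<^sup>k\<^sup>)f\<close> is the same as differentiability
  of \<open>x \<mapsto> D\<^sup>(\<^sup>k\<^sup>)f(x)(h\<^sub>1, \<dots>, h\<^sub>k)\<close> for all \<open>h\<^sub>1, \<dots>, h\<^sub>k\<close>.\<close>

definition smooth_on ::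
    "'e::findim_inner set \<Rightarrow> ('e \<Rightarrow> 'f::real_normed_vector) \<Rightarrow> bool" where
  "smooth_on S f \<longleftrightarrow> open S \<and> (\<forall>hs. \<forall>x\<in>S. iterated_deriv f hs differentiable (at x))"


section \<open>Smooth manifolds\<close>

text \<open>A chart is a pair of its domain \<open>V\<close> and its map, whose values outside \<open>V\<close> are irrelevant.\<close>

type_synonym ('a, 'e) chart = "'a set \<times> ('a \<Rightarrow> 'e)"

record ('a, 'e) mfd =
  mtop :: "'a topology"
  charts :: "('a, 'e) chart set"

abbreviation chart_inv :: "('a, 'e) chart \<Rightarrow> 'e \<Rightarrow> 'a" where
  "chart_inv c \<equiv> inv_into (fst c) (snd c)"

definition topological_chart :: "'a topology \<Rightarrow> ('a, 'e::findim_inner) chart \<Rightarrow> bool" where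
  "topological_chart T c \<longleftrightarrow>
     openin T (fst c) \<and> open (snd c ` fst c) \<and>
     homeomorphic_map (subtopology T (fst c)) (top_of_set (snd c ` fst c)) (snd c)"

definition compatible :: "('a, 'e::findim_inner) chart \<Rightarrow> ('a, 'e) chart \<Rightarrow> bool" where
  "compatible c d \<longleftrightarrow>
     smooth_on (snd c ` (fst c \<inter> fst d)) (snd d \<circ> chart_inv c) \<and>
     smooth_on (snd d ` (fst c \<inter> fst d)) (snd c \<circ> chart_inv d)"

definition paracompact :: "'a topology \<Rightarrow> bool" where
  "paracompact T \<longleftrightarrow>
     (\<forall>\<U>. (\<forall>U\<in>\<U>. openin T U) \<and> \<Union>\<U> = topspace T \<longrightarrow>
       (\<exists>\<V>. (\<forall>V\<in>\<V>. openin T V) \<and> \<Union>\<V> = topspace T \<and>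
            (\<forall>V\<in>\<V>. \<exists>U\<in>\<U>. V \<subseteq> U) \<and> locally_finite_in T \<V>))"

text \<open>The set of charts is a maximal smooth atlas.\<close>

definition smooth_manifold :: "('a, 'e::findim_inner) mfd \<Rightarrow> bool" where
  "smooth_manifold M \<longleftrightarrow>
     Hausdorff_space (mtop M) \<and> paracompact (mtop M) \<and>
     (\<forall>c\<in>charts M. topological_chart (mtop M) c) \<and>
     topspace (mtop M) = (\<Union>c\<in>charts M. fst c) \<and>
     (\<forall>c\<in>charts M. \<forall>d\<in>charts M. compatible c d) \<and>
     (\<forall>c. topological_chart (mtop M) c \<and> (\<forall>d\<in>charts M. compatible c d) \<longrightarrow> c \<in> charts M)"

definition smooth_maps ::
    "('a, 'e::findim_inner) mfd \<Rightarrow> ('b, 'f::findim_inner) mfd \<Rightarrow> ('a \<Rightarrow> 'b) set" where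
  "smooth_maps X Y =
     {f. continuous_map (mtop X) (mtop Y) f \<and>
         (\<forall>c\<in>charts X. \<forall>d\<in>charts Y.
            smooth_on (snd c ` (fst c \<inter> f -` fst d)) (snd d \<circ> f \<circ> chart_inv c))}"


section \<open>Riemannian metrics and their distance functions\<close>

text \<open>A Riemannian metric is given by its local representatives: \<open>h c p\<close> is the inner product on
  the tangent space at \<open>p\<close>, the latter being identified with the model space by means of the
  chart \<open>c\<close>. The last condition is the transformation law under a change of charts.\<close>

type_synonym ('a, 'e) metric_rep = "('a, 'e) chart \<Rightarrow> 'a \<Rightarrow> 'e \<Rightarrow> 'e \<Rightarrow> real"

definition riemannian_metric ::
    "('a, 'e::findim_inner) mfd \<Rightarrow> ('a, 'e) metric_rep \<Rightarrow> bool" where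
  "riemannian_metric M h \<longleftrightarrow>
     (\<forall>c\<in>charts M. \<forall>p\<in>fst c.
        bilinear (h c p) \<and> (\<forall>a b. h c p a b = h c p b a) \<and> (\<forall>a. a \<noteq> 0 \<longrightarrow> h c p a a > 0)) \<and>
     (\<forall>c\<in>charts M. \<forall>a b. smooth_on (snd c ` fst c) (\<lambda>x. h c (chart_inv c x) a b)) \<and>
     (\<forall>c\<in>charts M. \<forall>d\<in>charts M. \<forall>p\<in>fst c \<inter> fst d. \<forall>a b.
        let D = frechet_derivative (snd d \<circ> chart_inv c) (at (snd c p))
        in h c p a b = h d p (D a) (D b))"

definition C1_on_interval ::
    "('a, 'e::findim_inner) mfd \<Rightarrow> (real \<Rightarrow> 'a) \<Rightarrow> real \<Rightarrow> real \<Rightarrow> bool" where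
  "C1_on_interval M \<gamma> s t \<longleftrightarrow>
     (\<forall>c\<in>charts M. let J = {r \<in> {s..t}. \<gamma> r \<in> fst c} in
        (\<forall>r\<in>J. (snd c \<circ> \<gamma>) differentiable (at r within {s..t})) \<and>
        continuous_on J (\<lambda>r. vector_derivative (snd c \<circ> \<gamma>) (at r within {s..t})))"

text \<open>\<open>T\<close> is the set of break points; the one-sided derivatives at break points have to exist
  and to be the limits of the derivative.\<close>

definition piecewise_C1_curve ::
    "('a, 'e::findim_inner) mfd \<Rightarrow> (real \<Rightarrow> 'a) \<Rightarrow> bool" where
  "piecewise_C1_curve M \<gamma> \<longleftrightarrow>
     continuous_map (top_of_set {0..1}) (mtop M) \<gamma> \<and>
     (\<exists>T. finite T \<and>
       (\<forall>s t. 0 \<le> s \<and> s < t \<and> t \<le> 1 \<and> {s<..<t} \<inter> T = {} \<longrightarrow> C1_on_interval M \<gamma> s t))"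

text \<open>By the transformation law, the choice of the chart does not matter.\<close>

definition speed ::
    "('a, 'e::findim_inner) mfd \<Rightarrow> ('a, 'e) metric_rep \<Rightarrow> (real \<Rightarrow> 'a) \<Rightarrow> real \<Rightarrow> real" where
  "speed M h \<gamma> t =
     (let c = (SOME c. c \<in> charts M \<and> \<gamma> t \<in> fst c);
          w = vector_derivative (snd c \<circ> \<gamma>) (at t)
      in sqrt (h c (\<gamma> t) w w))"

definition curve_length ::
    "('a, 'e::findim_inner) mfd \<Rightarrow> ('a, 'e) metric_rep \<Rightarrow> (real \<Rightarrow> 'a) \<Rightarrow> ennreal" where
  "curve_length M h \<gamma> = (\<integral>\<^sup>+ t \<in> {0..1}. ennreal (speed M h \<gamma> t) \<partial>lborel)"

text \<open>The infimum is \<open>\<infinity>\<close> if there are no curves from \<open>p\<close> to \<open>q\<close>.\<close>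

definition rdist ::
    "('a, 'e::findim_inner) mfd \<Rightarrow> ('a, 'e) metric_rep \<Rightarrow> 'a \<Rightarrow> 'a \<Rightarrow> ennreal" where
  "rdist M h p q =
     (INF \<gamma> \<in> {\<gamma>. piecewise_C1_curve M \<gamma> \<and> \<gamma> 0 = p \<and> \<gamma> 1 = q}. curve_length M h \<gamma>)"


section \<open>Generalized functions valued in a manifold\<close>

text \<open>Nets are indexed by \<open>(0,1]\<close>; they are represented by functions on \<open>real\<close> whose values
  outside \<open>(0,1]\<close> are irrelevant.\<close>

abbreviation net_index :: "real set" where
  "net_index \<equiv> {0<..1}"

text \<open>\<open>f(\<epsilon>) = O(g(\<epsilon>))\<close> as \<open>\<epsilon> \<rightarrow> 0\<close>, for \<open>f\<close> with values in \<open>[0,\<infinity>]\<close>, in which the supremum of the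
  empty set is 0.\<close>

definition ebigo :: "(real \<Rightarrow> ennreal) \<Rightarrow> (real \<Rightarrow> real) \<Rightarrow> bool" where
  "ebigo f g \<longleftrightarrow> (\<exists>C::real. \<forall>\<^sub>F \<epsilon> in at_right 0. f \<epsilon> \<le> ennreal (C * \<bar>g \<epsilon>\<bar>))"

text \<open>The set \<open>\<E>\<^sub>M[X,Y]\<close>.\<close>

definition moderate_nets ::
    "('a, 'e::findim_inner) mfd \<Rightarrow> ('b, 'f::findim_inner) mfd \<Rightarrow> (real \<Rightarrow> 'a \<Rightarrow> 'b) set" where
  "moderate_nets X Y =
     {u. (\<forall>\<epsilon>\<in>net_index. u \<epsilon> \<in> smooth_maps X Y) \<and>
         (\<forall>K. compactin (mtop X) K \<longrightarrow>
            (\<exists>\<epsilon>\<^sub>0>0. \<exists>K'. compactin (mtop Y) K' \<and>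
               (\<forall>\<epsilon>\<in>net_index. \<epsilon> < \<epsilon>\<^sub>0 \<longrightarrow> u \<epsilon> ` K \<subseteq> K'))) \<and>
         (\<forall>k\<ge>1. \<forall>c\<in>charts X. \<forall>d\<in>charts Y. \<forall>L L'.
            compactin (mtop X) L \<and> L \<subseteq> fst c \<and> compactin (mtop Y) L' \<and> L' \<subseteq> fst d \<longrightarrow>
            (\<exists>N\<ge>1::nat.
               ebigo (\<lambda>\<epsilon>. SUP p \<in> L \<inter> u \<epsilon> -` L'.
                        deriv_norm k (snd d \<circ> u \<epsilon> \<circ> chart_inv c) (snd c p))
                     (\<lambda>\<epsilon>. 1 / \<epsilon> ^ N)))}"

definition uniformly_close ::
    "('a, 'e::findim_inner) mfd \<Rightarrow> ('b, 'f::findim_inner) mfd \<Rightarrow>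
     (real \<Rightarrow> 'a \<Rightarrow> 'b) \<Rightarrow> (real \<Rightarrow> 'a \<Rightarrow> 'b) \<Rightarrow> bool" where
  "uniformly_close X Y u v \<longleftrightarrow>
     (\<exists>h. riemannian_metric Y h \<and>
       (\<forall>K. compactin (mtop X) K \<longrightarrow>
          ((\<lambda>\<epsilon>. SUP p\<in>K. rdist Y h (u \<epsilon> p) (v \<epsilon> p)) \<longlongrightarrow> 0) (at_right 0)))"

definition negligible_difference ::
    "nat \<Rightarrow> ('a, 'e::findim_inner) mfd \<Rightarrow> ('b, 'f::findim_inner) mfd \<Rightarrow>
     (real \<Rightarrow> 'a \<Rightarrow> 'b) \<Rightarrow> (real \<Rightarrow> 'a \<Rightarrow> 'b) \<Rightarrow> bool" where
  "negligible_difference k X Y u v \<longleftrightarrow>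
     (\<forall>m\<ge>1::nat. \<forall>c\<in>charts X. \<forall>d\<in>charts Y. \<forall>L L'.
        compactin (mtop X) L \<and> L \<subseteq> fst c \<and> compactin (mtop Y) L' \<and> L' \<subseteq> fst d \<longrightarrow>
        ebigo (\<lambda>\<epsilon>. SUP p \<in> L \<inter> u \<epsilon> -` L' \<inter> v \<epsilon> -` L'.
                 deriv_norm k
                   (\<lambda>x. (snd d \<circ> u \<epsilon> \<circ> chart_inv c) x - (snd d \<circ> v \<epsilon> \<circ> chart_inv c) x)
                   (snd c p))
              (\<lambda>\<epsilon>. \<epsilon> ^ m))"

definition net_equiv ::
    "('a, 'e::findim_inner) mfd \<Rightarrow> ('b, 'f::findim_inner) mfd \<Rightarrow>
     (real \<Rightarrow> 'a \<Rightarrow> 'b) \<Rightarrow> (real \<Rightarrow> 'a \<Rightarrow> 'b) \<Rightarrow> bool" where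
  "net_equiv X Y u v \<longleftrightarrow> uniformly_close X Y u v \<and> (\<forall>k. negligible_difference k X Y u v)"

definition net_equiv0 ::
    "('a, 'e::findim_inner) mfd \<Rightarrow> ('b, 'f::findim_inner) mfd \<Rightarrow>
     (real \<Rightarrow> 'a \<Rightarrow> 'b) \<Rightarrow> (real \<Rightarrow> 'a \<Rightarrow> 'b) \<Rightarrow> bool" where
  "net_equiv0 X Y u v \<longleftrightarrow> uniformly_close X Y u v \<and> negligible_difference 0 X Y u v"

definition gen_fun_rel ::
    "('a, 'e::findim_inner) mfd \<Rightarrow> ('b, 'f::findim_inner) mfd \<Rightarrow> (real \<Rightarrow> 'a \<Rightarrow> 'b) rel" where
  "gen_fun_rel X Y =
     {(u, v). u \<in> moderate_nets X Y \<and> v \<in> moderate_nets X Y \<and> net_equiv X Y u v}"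

text \<open>The set \<open>\<G>[X,Y]\<close>.\<close>

definition gen_funs ::
    "('a, 'e::findim_inner) mfd \<Rightarrow> ('b, 'f::findim_inner) mfd \<Rightarrow> (real \<Rightarrow> 'a \<Rightarrow> 'b) set set" where
  "gen_funs X Y = moderate_nets X Y // gen_fun_rel X Y"

definition gen_fun_class ::
    "('a, 'e::findim_inner) mfd \<Rightarrow> ('b, 'f::findim_inner) mfd \<Rightarrow>
     (real \<Rightarrow> 'a \<Rightarrow> 'b) \<Rightarrow> (real \<Rightarrow> 'a \<Rightarrow> 'b) set" where
  "gen_fun_class X Y u = gen_fun_rel X Y `` {u}"


section \<open>Compactly supported generalized points and point values\<close>

definition cs_nets :: "('a, 'e::findim_inner) mfd \<Rightarrow> (real \<Rightarrow> 'a) set" where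
  "cs_nets X =
     {p. (\<forall>\<epsilon>\<in>net_index. p \<epsilon> \<in> topspace (mtop X)) \<and>
         (\<exists>K. \<exists>\<epsilon>\<^sub>0>0. compactin (mtop X) K \<and> (\<forall>\<epsilon>\<in>net_index. \<epsilon> < \<epsilon>\<^sub>0 \<longrightarrow> p \<epsilon> \<in> K))}"

definition gen_point_rel :: "('a, 'e::findim_inner) mfd \<Rightarrow> (real \<Rightarrow> 'a) rel" where
  "gen_point_rel X =
     {(p, q). p \<in> cs_nets X \<and> q \<in> cs_nets X \<and>
        (\<exists>h. riemannian_metric X h \<and>
          (\<forall>m>0::nat. ebigo (\<lambda>\<epsilon>. rdist X h (p \<epsilon>) (q \<epsilon>)) (\<lambda>\<epsilon>. \<epsilon> ^ m)))}"

definition gen_points :: "('a, 'e::findim_inner) mfd \<Rightarrow> (real \<Rightarrow> 'a) set set" where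
  "gen_points X = cs_nets X // gen_point_rel X"

definition gen_point_class ::
    "('a, 'e::findim_inner) mfd \<Rightarrow> (real \<Rightarrow> 'a) \<Rightarrow> (real \<Rightarrow> 'a) set" where
  "gen_point_class X p = gen_point_rel X `` {p}"

text \<open>The common class of \<open>\<epsilon> \<mapsto> u\<^sub>\<epsilon>(p\<^sub>\<epsilon>)\<close> for all representatives \<open>u\<close> of \<open>U\<close> and \<open>p\<close> of \<open>P\<close>.\<close>

definition point_value ::
    "('a, 'e::findim_inner) mfd \<Rightarrow> ('b, 'f::findim_inner) mfd \<Rightarrow>
     (real \<Rightarrow> 'a \<Rightarrow> 'b) set \<Rightarrow> (real \<Rightarrow> 'a) set \<Rightarrow> (real \<Rightarrow> 'b) set" where
  "point_value X Y U P =
     (THE Q. \<forall>u\<in>U. \<forall>p\<in>P. Q = gen_point_class Y (\<lambda>\<epsilon>. u \<epsilon> (p \<epsilon>)))"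

end

theory Submission
  imports Defs
begin

text \<open>
  Both sides of the equivalence are tested in charts. Call a net \<open>q\<close> of points rapidly close to a
  net \<open>p\<close> (\<open>rapidly_close\<close>) if, whenever \<open>p\<^sub>\<epsilon>\<close> lies in a compact part of the domain of a chart,
  \<open>q\<^sub>\<epsilon>\<close> lies in this domain and the coordinates of \<open>p\<^sub>\<epsilon>\<close> and \<open>q\<^sub>\<epsilon>\<close> differ by less than any given
  power of \<open>\<epsilon>\<close>, eventually. This notion does not mention a metric, and since transition maps are
  locally Lipschitz, it is symmetric on compactly supported nets. Near a compact part of a chart
  domain, every Riemannian distance is bounded by a multiple of the coordinate distance (straight
  segments are short: \<open>rdist_le_chart_dist\<close>) and conversely (a curve that leaves a coordinate ball is
  long: \<open>chart_dist_le_rdist\<close>). Hence equivalence of compactly supported nets of points is rapid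
  closeness (\<open>gen_point_rel_iff\<close>).

  A moderate net maps rapidly close nets to rapidly close nets, because first derivatives grow at most
  like a power of \<open>1/\<epsilon>\<close> (\<open>moderate_nets_rapidly_close\<close>). So point values do not depend on
  representatives (\<open>point_value_eq\<close>), and the theorem says that \<open>u\<close> and \<open>v\<close> are equivalent of order 0
  iff \<open>u\<^sub>\<epsilon>(p\<^sub>\<epsilon>)\<close> and \<open>v\<^sub>\<epsilon>(p\<^sub>\<epsilon>)\<close> are rapidly close for each compactly supported \<open>p\<close>. From left to right,
  cover a compact set that contains \<open>p\<close> by finitely many compact parts of chart domains
  (\<open>net_equiv0_imp_rapidly_close\<close>). From right to left, if one of the uniform estimates failed, a net of
  points at which it fails would contradict the hypothesis (\<open>net_equiv0I\<close>).

  The relations on nets ask for some Riemannian metric, so the argument depends on the existence of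
  metrics, also where there are no points to be compared: for empty \<open>X\<close>, equivalence of order 0 still
  asserts that \<open>Y\<close> has a metric. Metrics are glued from the Euclidean metrics of charts by means of a
  locally finite family of smooth bump functions (\<open>riemannian_metric_exists\<close>).
\<close>

section \<open>Finite-dimensional inner product spaces\<close>

text \<open>Gram-Schmidt process, applied to a finite spanning set. In dimension 0 the basis is empty.\<close>

lemma orthonormal_basis_exists:
  obtains E :: "'a::findim_inner set" where "finite E" "\<And>e. e \<in> E \<Longrightarrow> norm e = 1"
    "\<And>x. x = (\<Sum>e\<in>E. (x \<bullet> e) *\<^sub>R e)"
proof -
  obtain B :: "'a set" where B: "finite B" "\<forall>x. \<exists>c. x = (\<Sum>b\<in>B. c b *\<^sub>R b)"
    using finite_dimensional by blast
  have spanB: "span B = UNIV"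
  proof -
    have "x \<in> span B" for x
    proof -
      obtain c where "x = (\<Sum>b\<in>B. c b *\<^sub>R b)" using B(2) by blast
      then show ?thesis by (simp add: span_sum span_mul span_base)
    qed
    then show ?thesis by blast
  qed
  obtain C where C: "finite C" "span C = span B" "pairwise orthogonal C"
    using basis_orthogonal[OF B(1)] by blast
  define E where "E = (\<lambda>x. x /\<^sub>R norm x) ` (C - {0})"
  have fin: "finite E" using C by (simp add: E_def)
  have nrm: "norm e = 1" if e: "e \<in> E" for e
  proof -
    obtain x where "x \<in> C - {0}" "e = x /\<^sub>R norm x" using e unfolding E_def by blast
    then show ?thesis by simp
  qed
  have orth: "e \<bullet> e' = 0" if e: "e \<in> E" "e' \<in> E" "e \<noteq> e'" for e e'
  proof -
    obtain x y where xy: "x \<in> C" "y \<in> C" "e = x /\<^sub>R norm x" "e' = y /\<^sub>R norm y"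
      using e unfolding E_def by blast
    with e have "x \<noteq> y" by auto
    with xy C(3) have "x \<bullet> y = 0" by (auto simp: pairwise_def orthogonal_def)
    with xy show ?thesis by simp
  qed
  have "C \<subseteq> span E"
  proof
    fix x assume x: "x \<in> C"
    show "x \<in> span E"
    proof (cases "x = 0")
      case True then show ?thesis by (simp add: span_zero)
    next
      case False
      then have "x /\<^sub>R norm x \<in> E" using x by (auto simp: E_def)
      then have "norm x *\<^sub>R (x /\<^sub>R norm x) \<in> span E" by (intro span_mul span_base)
      with False show ?thesis by simp
    qed
  qed
  then have "span C \<subseteq> span E" by (simp add: span_minimal)
  then have spanE: "span E = UNIV" using C(2) spanB by auto
  have "x = (\<Sum>e\<in>E. (x \<bullet> e) *\<^sub>R e)" for x
  proof -
    have "x \<in> span E" by (simp add: spanE)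
    then obtain u where u: "x = (\<Sum>e\<in>E. u e *\<^sub>R e)" by (auto simp: span_finite[OF fin])
    have "x \<bullet> e' = u e'" if e': "e' \<in> E" for e'
    proof -
      have "x \<bullet> e' = (\<Sum>e\<in>E. u e * (e \<bullet> e'))"
        by (subst u) (simp add: inner_sum_left)
      also have "\<dots> = (\<Sum>e\<in>{e'}. u e * (e \<bullet> e'))"
        by (rule sum.mono_neutral_right) (use fin e' orth in auto)
      also have "\<dots> = u e'" using nrm[OF e'] by (simp add: dot_square_norm)
      finally show ?thesis .
    qed
    then show ?thesis using u by (simp cong: sum.cong)
  qed
  with fin nrm show thesis using that by blast
qed

lemma compact_cball_findim: "compact (cball (0::'a::findim_inner) r)"
proof -
  obtain E :: "'a set" where E: "finite E" "\<And>e. e \<in> E \<Longrightarrow> norm e = 1"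
    "\<And>x. x = (\<Sum>e\<in>E. (x \<bullet> e) *\<^sub>R e)"
    using orthonormal_basis_exists by blast
  have box: "compact {(\<Sum>e\<in>F. c e *\<^sub>R e) | c. \<forall>e\<in>F. \<bar>c e\<bar> \<le> r}" if "finite F" for F :: "'a set"
    using that
  proof (induction F)
    case empty
    then show ?case by simp
  next
    case (insert a F)
    let ?S = "\<lambda>F. {(\<Sum>e\<in>F. c e *\<^sub>R e) | c. \<forall>e\<in>F. \<bar>c e\<bar> \<le> r}"
    have "compact ((\<lambda>t. t *\<^sub>R a) ` {-r..r})"
      by (intro compact_continuous_image continuous_intros compact_Icc)
    then have "compact {x + y | x y. x \<in> (\<lambda>t. t *\<^sub>R a) ` {-r..r} \<and> y \<in> ?S F}"
      using insert.IH by (rule compact_sums)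
    also have "{x + y | x y. x \<in> (\<lambda>t. t *\<^sub>R a) ` {-r..r} \<and> y \<in> ?S F} = ?S (insert a F)"
    proof (intro set_eqI iffI)
      fix z assume "z \<in> {x + y | x y. x \<in> (\<lambda>t. t *\<^sub>R a) ` {-r..r} \<and> y \<in> ?S F}"
      then obtain t c where tc: "t \<in> {-r..r}" "\<forall>e\<in>F. \<bar>c e\<bar> \<le> r"
        "z = t *\<^sub>R a + (\<Sum>e\<in>F. c e *\<^sub>R e)" by auto
      have "(\<Sum>e\<in>F. c e *\<^sub>R e) = (\<Sum>e\<in>F. (c(a := t)) e *\<^sub>R e)"
        by (rule sum.cong) (use insert in auto)
      then have "z = (\<Sum>e\<in>insert a F. (c(a := t)) e *\<^sub>R e)"
        using tc insert by simp
      then show "z \<in> ?S (insert a F)"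
        using tc by (auto intro!: exI[of _ "c(a := t)"])
    next
      fix z assume "z \<in> ?S (insert a F)"
      then obtain c where c: "\<forall>e\<in>insert a F. \<bar>c e\<bar> \<le> r" "z = (\<Sum>e\<in>insert a F. c e *\<^sub>R e)"
        by auto
      then have "z = c a *\<^sub>R a + (\<Sum>e\<in>F. c e *\<^sub>R e)" "c a \<in> {-r..r}" using insert by auto
      with c(1) show "z \<in> {x + y | x y. x \<in> (\<lambda>t. t *\<^sub>R a) ` {-r..r} \<and> y \<in> ?S F}" by blast
    qed
    finally show ?case .
  qed
  have "cball 0 r \<subseteq> {(\<Sum>e\<in>E. c e *\<^sub>R e) | c. \<forall>e\<in>E. \<bar>c e\<bar> \<le> r}"
  proof
    fix x :: 'a assume x: "x \<in> cball 0 r"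
    have "\<bar>x \<bullet> e\<bar> \<le> r" if "e \<in> E" for e
      using Cauchy_Schwarz_ineq2[of x e] E(2)[OF that] x by simp
    then show "x \<in> {(\<Sum>e\<in>E. c e *\<^sub>R e) | c. \<forall>e\<in>E. \<bar>c e\<bar> \<le> r}"
      using E(3)[of x] by (auto intro!: exI[of _ "\<lambda>e. x \<bullet> e"])
  qed
  then have eq: "cball 0 r \<inter> {(\<Sum>e\<in>E. c e *\<^sub>R e) | c. \<forall>e\<in>E. \<bar>c e\<bar> \<le> r} = cball 0 r" by (rule Int_absorb2)
  show ?thesis using closed_Int_compact[OF closed_cball box[OF E(1)], of 0 r] unfolding eq .
qed

instance findim_inner \<subseteq> heine_borel
proof
  fix f :: "nat \<Rightarrow> 'a"
  assume "bounded (range f)"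
  then obtain r where "range f \<subseteq> cball 0 r"
    using bounded_subset_ballD[of "range f" 0] ball_subset_cball[of "0::'a"] by blast
  then have "\<forall>n. f n \<in> cball 0 r" by blast
  then show "\<exists>l r. strict_mono (r::nat\<Rightarrow>nat) \<and> ((f \<circ> r) \<longlongrightarrow> l) sequentially"
    using compact_cball_findim[of r, unfolded compact_eq_seq_compact_metric seq_compact_def] by blast
qed

section \<open>Calculus of smooth maps\<close>

text \<open>Smoothness unfolds derivatives from the outside: the last entry of the list of directions is
  differentiated first. Peeling off the innermost derivative instead turns the closure properties of
  smooth maps into inductions on the order.\<close>

primrec differentiable_order :: "nat \<Rightarrow> 'e::real_normed_vector set \<Rightarrow> ('e \<Rightarrow> 'f::real_normed_vector) \<Rightarrow> bool"
  where
    "differentiable_order 0 S f = True"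
  | "differentiable_order (Suc n) S f =
      ((\<forall>x\<in>S. f differentiable (at x)) \<and>
       (\<forall>h. differentiable_order n S (\<lambda>x. frechet_derivative f (at x) h)))"

lemma iterated_deriv_append:
  "iterated_deriv f (hs @ [h]) = iterated_deriv (\<lambda>x. frechet_derivative f (at x) h) hs"
  by (induction hs) auto

lemma differentiable_order_iff_iterated_deriv:
  "differentiable_order n S f \<longleftrightarrow>
    (\<forall>hs. length hs < n \<longrightarrow> (\<forall>x\<in>S. iterated_deriv f hs differentiable (at x)))"
proof (induction n arbitrary: f)
  case 0
  then show ?case by simp
next
  case (Suc n)
  show ?case
  proof
    assume L: "differentiable_order (Suc n) S f"
    show "\<forall>hs. length hs < Suc n \<longrightarrow> (\<forall>x\<in>S. iterated_deriv f hs differentiable (at x))"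
    proof (intro allI impI ballI)
      fix hs :: "'a list" and x assume hs: "length hs < Suc n" and x: "x \<in> S"
      show "iterated_deriv f hs differentiable (at x)"
      proof (cases hs rule: rev_cases)
        case Nil
        then show ?thesis using L x by simp
      next
        case (snoc ks k)
        then show ?thesis using L x hs Suc.IH by (auto simp: iterated_deriv_append)
      qed
    qed
  next
    assume R: "\<forall>hs. length hs < Suc n \<longrightarrow> (\<forall>x\<in>S. iterated_deriv f hs differentiable (at x))"
    have "f differentiable (at x)" if "x \<in> S" for x
      using R[rule_format, of "[]"] that by simp
    moreover have "differentiable_order n S (\<lambda>x. frechet_derivative f (at x) h)" for h
      unfolding Suc.IH
    proof (intro allI impI ballI)
      fix hs :: "'a list" and x assume "length hs < n" "x \<in> S"
      then show "iterated_deriv (\<lambda>x. frechet_derivative f (at x) h) hs differentiable at x"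
        using R[rule_format, of "hs @ [h]" x] by (simp add: iterated_deriv_append)
    qed
    ultimately show "differentiable_order (Suc n) S f" by simp
  qed
qed

lemma smooth_on_iff_differentiable_order:
  "smooth_on S f \<longleftrightarrow> open S \<and> (\<forall>n. differentiable_order n S f)"
  unfolding smooth_on_def differentiable_order_iff_iterated_deriv by blast

lemma differentiable_order_Suc_imp:
  "differentiable_order (Suc n) S f \<Longrightarrow> differentiable_order n S f"
  unfolding differentiable_order_iff_iterated_deriv by auto

lemma differentiable_order_local:
  "(\<And>x. x \<in> S \<Longrightarrow> \<exists>U. x \<in> U \<and> differentiable_order n U f) \<Longrightarrow> differentiable_order n S f"
  unfolding differentiable_order_iff_iterated_deriv by blast

lemma
  assumes "open S" "x \<in> S" "\<And>y. y \<in> S \<Longrightarrow> f y = g y"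
  shows differentiable_cong_open: "f differentiable (at x) \<longleftrightarrow> g differentiable (at x)"
    and frechet_derivative_cong_open: "frechet_derivative f (at x) = frechet_derivative g (at x)"
proof -
  have "(f has_derivative D) (at x) \<longleftrightarrow> (g has_derivative D) (at x)" for D
    using has_derivative_transform_within_open[of f D x UNIV S g]
      has_derivative_transform_within_open[of g D x UNIV S f] assms by auto
  then show "f differentiable (at x) \<longleftrightarrow> g differentiable (at x)"
    "frechet_derivative f (at x) = frechet_derivative g (at x)"
    by (simp_all add: differentiable_def frechet_derivative_def)
qed

lemma differentiable_order_cong:
  assumes "open S" "\<And>y. y \<in> S \<Longrightarrow> f y = g y" "differentiable_order n S f"
  shows "differentiable_order n S g"
  using assms(2,3)
proof (induction n arbitrary: f g)
  case 0
  then show ?case by simp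
next
  case (Suc n)
  have "g differentiable (at x)" if "x \<in> S" for x
    using Suc.prems differentiable_cong_open[OF assms(1) that, of f g] that by simp
  moreover have "differentiable_order n S (\<lambda>x. frechet_derivative g (at x) h)" for h
  proof (rule Suc.IH)
    show "differentiable_order n S (\<lambda>x. frechet_derivative f (at x) h)" using Suc.prems by simp
    show "frechet_derivative f (at y) h = frechet_derivative g (at y) h" if "y \<in> S" for y
      using frechet_derivative_cong_open[OF assms(1) that, of f g] Suc.prems by simp
  qed
  ultimately show ?case by simp
qed

lemma differentiable_order_const: "differentiable_order n S (\<lambda>x. c)"
  by (induction n arbitrary: c) auto

lemma frechet_derivative_eqI:
  "(f has_derivative f') (at x) \<Longrightarrow> frechet_derivative f (at x) = f'"
  using frechet_derivative_at by metis

lemma differentiable_order_add: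
  assumes "open S" "differentiable_order n S f" "differentiable_order n S g"
  shows "differentiable_order n S (\<lambda>x. f x + g x)"
  using assms(2,3)
proof (induction n arbitrary: f g)
  case 0
  then show ?case by simp
next
  case (Suc n)
  have D: "((\<lambda>x. f x + g x) has_derivative
      (\<lambda>h. frechet_derivative f (at x) h + frechet_derivative g (at x) h)) (at x)" if "x \<in> S" for x
    using Suc.prems that
    by (intro has_derivative_add) (auto simp: frechet_derivative_works[symmetric])
  have "differentiable_order n S (\<lambda>x. frechet_derivative (\<lambda>x. f x + g x) (at x) h)" for h
  proof (rule differentiable_order_cong[OF assms(1)])
    show "differentiable_order n S
      (\<lambda>x. frechet_derivative f (at x) h + frechet_derivative g (at x) h)"
      using Suc by simp
  qed (use frechet_derivative_eqI[OF D] in simp)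
  with D show ?case by (auto simp: differentiable_def)
qed

lemma differentiable_order_sum:
  assumes "open S" "finite A" "\<And>i. i \<in> A \<Longrightarrow> differentiable_order n S (f i)"
  shows "differentiable_order n S (\<lambda>x. \<Sum>i\<in>A. f i x)"
  using assms(2,3)
  by (induction A) (auto intro!: differentiable_order_const differentiable_order_add assms(1))

lemma (in bounded_bilinear) differentiable_order:
  assumes "open S" "differentiable_order n S f" "differentiable_order n S g"
  shows "differentiable_order n S (\<lambda>x. prod (f x) (g x))"
  using assms(2,3)
proof (induction n arbitrary: f g)
  case 0
  then show ?case by simp
next
  case (Suc n)
  have D: "((\<lambda>x. prod (f x) (g x)) has_derivative
      (\<lambda>h. prod (f x) (frechet_derivative g (at x) h) + prod (frechet_derivative f (at x) h) (g x))) (at x)"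
    if "x \<in> S" for x
    using Suc.prems that
    by (intro FDERIV) (auto simp: frechet_derivative_works[symmetric])
  have "differentiable_order n S (\<lambda>x. frechet_derivative (\<lambda>x. prod (f x) (g x)) (at x) h)" for h
  proof (rule differentiable_order_cong[OF assms(1)])
    show "differentiable_order n S (\<lambda>x. prod (f x) (frechet_derivative g (at x) h)
        + prod (frechet_derivative f (at x) h) (g x))"
      using Suc.prems Suc.prems[THEN differentiable_order_Suc_imp]
      by (intro differentiable_order_add assms(1) Suc.IH) simp_all
  qed (use frechet_derivative_eqI[OF D] in simp)
  with D show ?case by (auto simp: differentiable_def)
qed

lemma (in bounded_linear) differentiable_order: "differentiable_order n S f"
proof (cases n)
  case (Suc m)
  have "(f has_derivative f) (at x)" for x
    by (rule bounded_linear_imp_has_derivative) unfold_locales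
  then have "frechet_derivative f (at x) = f" "f differentiable (at x)" for x
    by (auto simp: differentiable_def dest: frechet_derivative_eqI)
  with Suc show ?thesis by (simp add: differentiable_order_const)
qed simp

text \<open>Expanding \<open>Df(x)h\<close> in a basis writes the derivative of \<open>g \<circ> f\<close> as a finite sum of products of
  derivatives of \<open>f\<close> with compositions of derivatives of \<open>g\<close> with \<open>f\<close>, so that the induction
  hypothesis and the product rule apply.\<close>

lemma differentiable_order_compose:
  fixes f :: "'a::real_normed_vector \<Rightarrow> 'b::findim_inner" and g :: "'b \<Rightarrow> 'c::real_normed_vector"
  assumes "open S" "f ` S \<subseteq> T" "differentiable_order n S f" "differentiable_order n T g"
  shows "differentiable_order n S (\<lambda>x. g (f x))"
  using assms(3,4)
proof (induction n arbitrary: g)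
  case 0
  then show ?case by simp
next
  case (Suc n)
  obtain E :: "'b set" where E: "finite E" "\<And>x. x = (\<Sum>e\<in>E. (x \<bullet> e) *\<^sub>R e)"
    using orthonormal_basis_exists by metis
  have D: "((\<lambda>x. g (f x)) has_derivative
      (\<lambda>h. frechet_derivative g (at (f x)) (frechet_derivative f (at x) h))) (at x)"
    if "x \<in> S" for x
  proof -
    have "(f has_derivative frechet_derivative f (at x)) (at x)"
      using Suc.prems that by (simp add: frechet_derivative_works[symmetric])
    moreover have "(g has_derivative frechet_derivative g (at (f x))) (at (f x))"
      using Suc.prems that assms(2) by (auto simp: frechet_derivative_works[symmetric])
    ultimately show ?thesis using diff_chain_at by (auto simp: o_def)
  qed
  have "differentiable_order n S (\<lambda>x. frechet_derivative (\<lambda>x. g (f x)) (at x) h)" for h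
  proof (rule differentiable_order_cong[OF assms(1)])
    have "differentiable_order n S (\<lambda>x. (frechet_derivative f (at x) h \<bullet> e))" for e
      using Suc.prems differentiable_order_const
      by (intro bounded_bilinear.differentiable_order[OF bounded_bilinear_inner assms(1)]) auto
    moreover have "differentiable_order n S (\<lambda>x. frechet_derivative g (at (f x)) e)" for e
      using Suc.prems Suc.prems(1)[THEN differentiable_order_Suc_imp] by (intro Suc.IH) simp_all
    ultimately show "differentiable_order n S (\<lambda>x. \<Sum>e\<in>E. (frechet_derivative f (at x) h \<bullet> e) *\<^sub>R
        frechet_derivative g (at (f x)) e)"
      by (intro differentiable_order_sum assms(1) E(1)
          bounded_bilinear.differentiable_order[OF bounded_bilinear_scaleR])
    fix x assume x: "x \<in> S"
    have lin: "linear (frechet_derivative g (at (f x)))"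
      using Suc.prems x assms(2) by (auto intro!: linear_frechet_derivative)
    show "(\<Sum>e\<in>E. (frechet_derivative f (at x) h \<bullet> e) *\<^sub>R frechet_derivative g (at (f x)) e)
      = frechet_derivative (\<lambda>x. g (f x)) (at x) h"
      unfolding frechet_derivative_eqI[OF D[OF x]]
      by (subst (2) E(2)) (simp add: linear_sum[OF lin] linear_cmul[OF lin])
  qed
  with D show ?case by (auto simp: differentiable_def)
qed

lemma smooth_on_open: "smooth_on S f \<Longrightarrow> open S"
  by (simp add: smooth_on_def)

lemma smooth_on_subset: "smooth_on S f \<Longrightarrow> open T \<Longrightarrow> T \<subseteq> S \<Longrightarrow> smooth_on T f"
  unfolding smooth_on_def by blast

lemma smooth_on_differentiable: "smooth_on S f \<Longrightarrow> x \<in> S \<Longrightarrow> f differentiable (at x)"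
  unfolding smooth_on_def by (metis iterated_deriv.simps(1))

lemma smooth_on_has_derivative:
  "smooth_on S f \<Longrightarrow> x \<in> S \<Longrightarrow> (f has_derivative frechet_derivative f (at x)) (at x)"
  by (simp add: smooth_on_differentiable frechet_derivative_works[symmetric])

lemma smooth_on_continuous: "smooth_on S f \<Longrightarrow> continuous_on S f"
  by (meson continuous_at_imp_continuous_on differentiable_imp_continuous_within
      smooth_on_differentiable)

lemma smooth_on_frechet_derivative:
  "smooth_on S f \<Longrightarrow> smooth_on S (\<lambda>x. frechet_derivative f (at x) h)"
  unfolding smooth_on_def by (metis iterated_deriv_append)

lemma smooth_on_cong:
  "smooth_on S f \<Longrightarrow> (\<And>x. x \<in> S \<Longrightarrow> f x = g x) \<Longrightarrow> smooth_on S g"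
  unfolding smooth_on_iff_differentiable_order by (blast intro: differentiable_order_cong)

lemma smooth_on_local:
  assumes "\<And>x. x \<in> S \<Longrightarrow> \<exists>U. x \<in> U \<and> U \<subseteq> S \<and> smooth_on U f"
  shows "smooth_on S f"
proof -
  have "open S" using assms by (subst open_subopen) (meson smooth_on_open)
  moreover have "differentiable_order n S f" for n
    using assms unfolding smooth_on_iff_differentiable_order
    by (intro differentiable_order_local) blast
  ultimately show ?thesis by (simp add: smooth_on_iff_differentiable_order)
qed

lemma smooth_on_const: "open S \<Longrightarrow> smooth_on S (\<lambda>x. c)"
  by (simp add: smooth_on_iff_differentiable_order differentiable_order_const)

lemma smooth_on_sum:
  "open S \<Longrightarrow> finite A \<Longrightarrow> (\<And>i. i \<in> A \<Longrightarrow> smooth_on S (f i)) \<Longrightarrow> smooth_on S (\<lambda>x. \<Sum>i\<in>A. f i x)"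
  by (simp add: smooth_on_iff_differentiable_order differentiable_order_sum)

lemma smooth_on_bilinear:
  "bounded_bilinear b \<Longrightarrow> smooth_on S f \<Longrightarrow> smooth_on S g \<Longrightarrow> smooth_on S (\<lambda>x. b (f x) (g x))"
  by (simp add: smooth_on_iff_differentiable_order bounded_bilinear.differentiable_order)

lemma smooth_on_compose:
  fixes f :: "'a::findim_inner \<Rightarrow> 'b::findim_inner"
  shows "smooth_on S f \<Longrightarrow> smooth_on T g \<Longrightarrow> f ` S \<subseteq> T \<Longrightarrow> smooth_on S (\<lambda>x. g (f x))"
  unfolding smooth_on_iff_differentiable_order by (blast intro: differentiable_order_compose)

text \<open>Continuity of the partial derivatives along an orthonormal basis bounds the operator norm of the
  derivative on a ball, on which the mean value inequality applies.\<close>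

lemma smooth_on_Lipschitz_at:
  fixes f :: "'a::findim_inner \<Rightarrow> 'b::real_normed_vector"
  assumes "smooth_on S f" "x \<in> S"
  obtains r C where "r > 0" "ball x r \<subseteq> S" "C \<ge> 0"
    "\<And>y z. y \<in> ball x r \<Longrightarrow> z \<in> ball x r \<Longrightarrow> norm (f y - f z) \<le> C * norm (y - z)"
proof -
  obtain E :: "'a set" where E: "finite E" "\<And>e. e \<in> E \<Longrightarrow> norm e = 1"
    "\<And>x. x = (\<Sum>e\<in>E. (x \<bullet> e) *\<^sub>R e)"
    using orthonormal_basis_exists by metis
  define D where "D = (\<lambda>x h. frechet_derivative f (at x) h)"
  define M where "M = (\<lambda>y. \<Sum>e\<in>E. norm (D y e))"
  have contM: "continuous_on S M"
    unfolding M_def D_def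
    using smooth_on_continuous[OF smooth_on_frechet_derivative[OF assms(1)]]
    by (intro continuous_intros) auto
  then have "isCont M x"
    using assms smooth_on_open continuous_on_eq_continuous_at by blast
  then obtain d where d: "d > 0" "\<forall>y. dist y x < d \<longrightarrow> dist (M y) (M x) < 1"
    unfolding continuous_at_eps_delta by (metis zero_less_one)
  obtain r0 where r0: "r0 > 0" "ball x r0 \<subseteq> S"
    using assms smooth_on_open open_contains_ball by metis
  let ?r = "min d r0"
  have bound: "norm (D y h) \<le> M y * norm h" if "y \<in> S" for y h
  proof -
    have lin: "linear (D y)"
      unfolding D_def by (intro linear_frechet_derivative smooth_on_differentiable[OF assms(1) that])
    have "D y h = (\<Sum>e\<in>E. (h \<bullet> e) *\<^sub>R D y e)"
      by (subst E(3)) (simp add: linear_sum[OF lin] linear_cmul[OF lin])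
    also have "norm \<dots> \<le> (\<Sum>e\<in>E. norm ((h \<bullet> e) *\<^sub>R D y e))" by (rule norm_sum)
    also have "\<dots> \<le> (\<Sum>e\<in>E. norm h * norm (D y e))"
    proof (rule sum_mono)
      fix e assume "e \<in> E"
      then have "\<bar>h \<bullet> e\<bar> \<le> norm h" using Cauchy_Schwarz_ineq2[of h e] E(2) by simp
      then show "norm ((h \<bullet> e) *\<^sub>R D y e) \<le> norm h * norm (D y e)"
        by (simp add: mult_right_mono)
    qed
    also have "\<dots> = M y * norm h" by (simp add: M_def sum_distrib_left mult.commute)
    finally show ?thesis .
  qed
  have M0: "M y \<ge> 0" for y by (simp add: M_def sum_nonneg)
  have "norm (f y - f z) \<le> (M x + 1) * norm (y - z)" if "y \<in> ball x ?r" "z \<in> ball x ?r" for y z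
  proof (rule differentiable_bound[of "ball x ?r" f "\<lambda>y. D y"])
    fix w assume w: "w \<in> ball x ?r"
    then have wS: "w \<in> S" using r0 by auto
    show "(f has_derivative D w) (at w within ball x ?r)"
      unfolding D_def using smooth_on_has_derivative[OF assms(1) wS] has_derivative_at_withinI
      by blast
    have "dist (M w) (M x) < 1" using d(2) w by (simp add: dist_commute)
    then have "M w \<le> M x + 1" by (simp add: dist_real_def)
    show "onorm (D w) \<le> M x + 1"
    proof (rule onorm_bound)
      show "0 \<le> M x + 1" using M0[of x] by simp
      fix h
      have "norm (D w h) \<le> M w * norm h" using bound[OF wS] .
      also have "\<dots> \<le> (M x + 1) * norm h" using \<open>M w \<le> M x + 1\<close> by (simp add: mult_right_mono)
      finally show "norm (D w h) \<le> (M x + 1) * norm h" .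
    qed
  qed (use that in auto)
  moreover have "?r > 0" "ball x ?r \<subseteq> S" using d r0 by auto
  ultimately show thesis using that M0[of x] by (metis add_nonneg_nonneg zero_le_one)
qed

text \<open>Finitely many balls of half the radius of the previous lemma cover \<open>K\<close>; half of the smallest of
  these radii serves as a Lebesgue number.\<close>

lemma smooth_on_Lipschitz_near_compact:
  fixes f :: "'a::findim_inner \<Rightarrow> 'b::real_normed_vector"
  assumes f: "smooth_on S f" and K: "compact K" "K \<subseteq> S"
  obtains \<delta> C where "\<delta> > 0" "C \<ge> 0"
    "\<And>x y. x \<in> K \<Longrightarrow> dist y x < \<delta> \<Longrightarrow> y \<in> S \<and> dist (f y) (f x) \<le> C * dist y x"
proof -
  define P where "P = (\<lambda>x r C. r > 0 \<and> ball x r \<subseteq> S \<and> C \<ge> 0 \<and>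
    (\<forall>y\<in>ball x r. \<forall>z\<in>ball x r. norm (f y - f z) \<le> C * norm (y - z)))"
  have "\<forall>x\<in>K. \<exists>r C. P x r C"
  proof
    fix x assume "x \<in> K"
    then have "x \<in> S" using K by auto
    from smooth_on_Lipschitz_at[OF f this] show "\<exists>r C. P x r C"
      unfolding P_def by metis
  qed
  then obtain r C where rC: "\<And>x. x \<in> K \<Longrightarrow> P x (r x) (C x)" by metis
  have "K \<subseteq> (\<Union>x\<in>K. ball x (r x / 2))" using rC by (force simp: P_def)
  then obtain F where F: "F \<subseteq> K" "finite F" "K \<subseteq> (\<Union>x\<in>F. ball x (r x / 2))"
    using compactE_image[OF K(1), of K "\<lambda>x. ball x (r x / 2)"] by auto
  define \<delta> where "\<delta> = Min (insert 1 ((\<lambda>x. r x / 2) ` F))"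
  define C' where "C' = (\<Sum>x\<in>F. C x)"
  have "\<delta> > 0" using F rC by (auto simp: \<delta>_def P_def)
  moreover have C0: "C x \<ge> 0" if "x \<in> F" for x using rC F that by (auto simp: P_def)
  then have "C' \<ge> 0" by (simp add: C'_def sum_nonneg)
  moreover have "y \<in> S \<and> dist (f y) (f x) \<le> C' * dist y x" if x: "x \<in> K" and y: "dist y x < \<delta>" for x y
  proof -
    obtain z where z: "z \<in> F" "x \<in> ball z (r z / 2)" using F x by blast
    have "\<delta> \<le> r z / 2" unfolding \<delta>_def using z F by (intro Min_le) auto
    then have yz: "y \<in> ball z (r z)" "x \<in> ball z (r z)"
      using y z dist_triangle[of z y x] zero_le_dist[of x z]
      by (simp_all add: dist_commute del: zero_le_dist)
    have rz: "P z (r z) (C z)" using rC z F by auto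
    then have "norm (f y - f x) \<le> C z * norm (y - x)" "y \<in> S"
      using yz unfolding P_def by blast+
    moreover have "C z \<le> C'" unfolding C'_def using z F C0 by (intro member_le_sum) auto
    ultimately show ?thesis
      by (metis dist_norm mult_right_mono norm_ge_zero order_trans)
  qed
  ultimately show thesis using that by blast
qed

section \<open>Bump functions\<close>

lemma power_times_exp_inverse_tendsto_0:
  "((\<lambda>t::real. inverse t ^ k * exp (- inverse t)) \<longlongrightarrow> 0) (at_right 0)"
proof -
  have "((\<lambda>x::real. x ^ k / exp x) \<longlongrightarrow> 0) at_top" by (rule tendsto_power_div_exp_0)
  then have "((\<lambda>t::real. inverse t ^ k / exp (inverse t)) \<longlongrightarrow> 0) (at_right 0)"
    by (rule filterlim_compose) (rule filterlim_inverse_at_top_right)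
  then show ?thesis by (simp add: exp_minus field_simps)
qed

text \<open>The functions \<open>t\<^sup>-\<^sup>k exp(-1/t)\<close>, extended by 0 to the left half-line. The family is used because
  the derivative of each member is a linear combination of two others, which gives smoothness of all
  members by induction.\<close>

definition flat_exp :: "nat \<Rightarrow> real \<Rightarrow> real" where
  "flat_exp k t = (if t \<le> 0 then 0 else inverse t ^ k * exp (- inverse t))"

lemma flat_exp_has_derivative:
  "(flat_exp k has_real_derivative (flat_exp (k + 2) t - real k * flat_exp (k + 1) t)) (at t)"
proof -
  consider "t < 0" | "t > 0" | "t = 0" by linarith
  then show ?thesis
  proof cases
    case 1
    have "((\<lambda>t. 0) has_real_derivative 0) (at t)" by simp
    then have "(flat_exp k has_real_derivative 0) (at t)"
      by (rule has_field_derivative_transform_within_open[of _ _ _ "{..<0}"])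
        (use 1 in \<open>auto simp: flat_exp_def\<close>)
    with 1 show ?thesis by (simp add: flat_exp_def)
  next
    case 2
    have "inverse t ^ k * inverse t ^ 2 = inverse t ^ (k + 2)"
      by (rule power_add[symmetric])
    moreover have "real k * inverse t ^ (k - Suc 0) * inverse t ^ 2 = real k * inverse t ^ (k + 1)"
      by (cases k) (auto simp: power2_eq_square)
    ultimately have "((\<lambda>t. inverse t ^ k * exp (- inverse t)) has_real_derivative
        (flat_exp (k + 2) t - real k * flat_exp (k + 1) t)) (at t)"
      using 2
      by (auto intro!: derivative_eq_intros simp: flat_exp_def algebra_simps)
    then show ?thesis
      by (rule has_field_derivative_transform_within_open[of _ _ _ "{0<..}"])
        (use 2 in \<open>auto simp: flat_exp_def\<close>)
  next
    case 3
    have "((\<lambda>h. (flat_exp k (0 + h) - flat_exp k 0) / h) \<longlongrightarrow> 0) (at 0)"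
    proof (rule filterlim_split_at)
      show "((\<lambda>h. (flat_exp k (0 + h) - flat_exp k 0) / h) \<longlongrightarrow> 0) (at_left 0)"
        by (rule tendsto_eventually)
          (auto simp: eventually_at_left_field flat_exp_def intro!: exI[of _ "-1"])
      have "eventually (\<lambda>h::real. inverse h ^ Suc k * exp (- inverse h) =
          (flat_exp k (0 + h) - flat_exp k 0) / h) (at_right 0)"
        unfolding eventually_at_right_field
        by (intro exI[of _ 1]) (auto simp: flat_exp_def field_simps)
      from Lim_transform_eventually[OF power_times_exp_inverse_tendsto_0 this]
      show "((\<lambda>h. (flat_exp k (0 + h) - flat_exp k 0) / h) \<longlongrightarrow> 0) (at_right 0)" .
    qed
    with 3 show ?thesis by (simp add: DERIV_def flat_exp_def)
  qed
qed

lemma differentiable_order_flat_exp: "differentiable_order n UNIV (flat_exp k)"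
proof (induction n arbitrary: k)
  case 0
  then show ?case by simp
next
  case (Suc n)
  have D: "(flat_exp k has_derivative (\<lambda>h. (flat_exp (k + 2) t - real k * flat_exp (k + 1) t) * h)) (at t)"
    for t using flat_exp_has_derivative by (simp add: has_field_derivative_def)
  have "differentiable_order n UNIV (\<lambda>t. (flat_exp (k + 2) t + (- real k) * flat_exp (k + 1) t) * h)" for h
    by (intro bounded_bilinear.differentiable_order[OF bounded_bilinear_mult]
        differentiable_order_add Suc.IH differentiable_order_const) auto
  moreover have "frechet_derivative (flat_exp k) (at t) h =
      (flat_exp (k + 2) t + (- real k) * flat_exp (k + 1) t) * h" for t h
    by (simp add: frechet_derivative_eqI[OF D])
  moreover have "flat_exp k differentiable (at t)" for t
    unfolding differentiable_def using D by blast
  ultimately show ?case by simp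
qed

text \<open>The composition of \<open>flat_exp 0\<close> with \<open>x \<mapsto> r\<^sup>2 - \<bar>x - x0\<bar>\<^sup>2\<close>, which is a polynomial in the
  coordinates of \<open>x\<close>.\<close>

lemma bump_function_exists:
  fixes x0 :: "'e::findim_inner"
  assumes "r > 0"
  obtains b :: "'e \<Rightarrow> real" where "smooth_on UNIV b" "\<And>x. b x \<ge> 0"
    "\<And>x. b x > 0 \<longleftrightarrow> x \<in> ball x0 r"
proof -
  define b where "b = (\<lambda>x. flat_exp 0 (r\<^sup>2 + (- ((x - x0) \<bullet> (x - x0)))))"
  have "differentiable_order n UNIV (\<lambda>x::'e. x + (- x0))" for n
    by (intro differentiable_order_add differentiable_order_const open_UNIV
        bounded_linear.differentiable_order bounded_linear_ident)
  then have sub: "differentiable_order n UNIV (\<lambda>x::'e. x - x0)" for n by simp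
  have "differentiable_order n UNIV (\<lambda>x::'e. r\<^sup>2 + (-1) * ((x - x0) \<bullet> (x - x0)))" for n
    by (intro differentiable_order_add differentiable_order_const open_UNIV sub
        bounded_bilinear.differentiable_order[OF bounded_bilinear_mult]
        bounded_bilinear.differentiable_order[OF bounded_bilinear_inner])
  then have "differentiable_order n UNIV b" for n
    unfolding b_def
    by (intro differentiable_order_compose[OF open_UNIV subset_UNIV _ differentiable_order_flat_exp]) simp
  then have "smooth_on UNIV b" by (simp add: smooth_on_iff_differentiable_order)
  moreover have "b x \<ge> 0" for x by (simp add: b_def flat_exp_def)
  moreover have "b x > 0 \<longleftrightarrow> x \<in> ball x0 r" for x
  proof -
    have "b x > 0 \<longleftrightarrow> (norm (x - x0))\<^sup>2 < r\<^sup>2"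
      by (simp add: b_def flat_exp_def dot_square_norm)
    also have "\<dots> \<longleftrightarrow> norm (x - x0) < r"
      using assms by (auto intro: power2_less_imp_less power_strict_mono)
    finally show ?thesis by (simp add: dist_norm norm_minus_commute)
  qed
  ultimately show thesis by (rule that)
qed

section \<open>Charts\<close>

locale smooth_mfd =
  fixes M :: "('a, 'e::findim_inner) mfd"
  assumes smooth_manifold: "smooth_manifold M"
begin

lemma Hausdorff: "Hausdorff_space (mtop M)"
  and paracompact: "paracompact (mtop M)"
  and topspace_eq: "topspace (mtop M) = (\<Union>c\<in>charts M. fst c)"
  using smooth_manifold by (simp_all add: smooth_manifold_def)

lemma transition_smooth:
  "c \<in> charts M \<Longrightarrow> d \<in> charts M \<Longrightarrow> smooth_on (snd c ` (fst c \<inter> fst d)) (snd d \<circ> chart_inv c)"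
  using smooth_manifold by (simp add: smooth_manifold_def compatible_def)

lemma compactin_closedin: "compactin (mtop M) K \<Longrightarrow> closedin (mtop M) K"
  using Hausdorff compactin_imp_closedin by blast

context
  fixes c assumes c: "c \<in> charts M"
begin

lemma chart_topological: "topological_chart (mtop M) c"
  using smooth_manifold c by (simp add: smooth_manifold_def)

lemma chart_openin: "openin (mtop M) (fst c)"
  and chart_open_image: "open (snd c ` fst c)"
  and chart_homeo: "homeomorphic_map (subtopology (mtop M) (fst c)) (top_of_set (snd c ` fst c)) (snd c)"
  using chart_topological by (simp_all add: topological_chart_def)

lemma chart_subset: "fst c \<subseteq> topspace (mtop M)"
  using chart_openin openin_subset by blast

lemma chart_inj: "inj_on (snd c) (fst c)"
  using homeomorphic_imp_injective_map[OF chart_homeo] chart_subset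
  by (simp add: Int_absorb1)

lemma chart_inv_left: "p \<in> fst c \<Longrightarrow> chart_inv c (snd c p) = p"
  using chart_inj by (rule inv_into_f_f)

lemma chart_inv_right: "x \<in> snd c ` fst c \<Longrightarrow> snd c (chart_inv c x) = x"
  by (rule f_inv_into_f)

lemma chart_inv_in: "x \<in> snd c ` fst c \<Longrightarrow> chart_inv c x \<in> fst c"
  by (rule inv_into_into)

lemma chart_continuous: "continuous_map (subtopology (mtop M) (fst c)) euclidean (snd c)"
  using homeomorphic_imp_continuous_map[OF chart_homeo] by (simp add: continuous_map_in_subtopology)

lemma chart_openin_preimage:
  assumes "open A" shows "openin (mtop M) {p \<in> fst c. snd c p \<in> A}"
proof -
  have "openin (subtopology (mtop M) (fst c)) {p \<in> topspace (subtopology (mtop M) (fst c)). snd c p \<in> A}"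
    using openin_continuous_map_preimage[OF chart_continuous] assms by simp
  then show ?thesis
    using chart_subset openin_trans_full[OF _ chart_openin] by (simp add: Int_absorb1)
qed

lemma chart_open_image_of_openin:
  assumes "openin (mtop M) W" shows "open (snd c ` (W \<inter> fst c))"
proof -
  have "openin (subtopology (mtop M) (fst c)) (W \<inter> fst c)"
    using assms openin_subtopology by blast
  then have "openin (top_of_set (snd c ` fst c)) (snd c ` (W \<inter> fst c))"
    using homeomorphic_imp_open_map[OF chart_homeo] unfolding open_map_def by blast
  then show ?thesis using chart_open_image openin_open_eq by blast
qed

lemma chart_inv_continuous: "continuous_map (top_of_set (snd c ` fst c)) (mtop M) (chart_inv c)"
  unfolding continuous_map_def
proof (intro conjI allI impI)
  show "chart_inv c \<in> topspace (top_of_set (snd c ` fst c)) \<rightarrow> topspace (mtop M)"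
    using chart_inv_in chart_subset by auto
  fix W assume W: "openin (mtop M) W"
  have "{x \<in> topspace (top_of_set (snd c ` fst c)). chart_inv c x \<in> W} = snd c ` (W \<inter> fst c)"
    using chart_inv_in chart_inv_right by (force simp: chart_inv_left)
  then show "openin (top_of_set (snd c ` fst c)) {x \<in> topspace (top_of_set (snd c ` fst c)). chart_inv c x \<in> W}"
    using chart_open_image_of_openin[OF W] by (auto simp: openin_open_eq[OF chart_open_image])
qed

lemma chart_compact_image:
  assumes "compactin (mtop M) L" "L \<subseteq> fst c" shows "compact (snd c ` L)"
  using image_compactin[OF _ chart_continuous, of L] assms by (simp add: compactin_subtopology)

lemma chart_inv_compactin:
  assumes "compact K" "K \<subseteq> snd c ` fst c" shows "compactin (mtop M) (chart_inv c ` K)"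
  using image_compactin[OF _ chart_inv_continuous, of K] assms by (simp add: compactin_subtopology)

text \<open>The closed \<open>\<delta>\<close>-neighbourhood of a compact set of coordinate vectors is compact, since the model
  space is finite-dimensional. It is pulled back to the manifold as \<open>L'\<close>, the room for points and
  segments that start in \<open>L\<close>.\<close>

lemma chart_thickening:
  assumes "compactin (mtop M) L" "L \<subseteq> fst c"
  obtains \<delta> L' where "\<delta> > 0" "compactin (mtop M) L'" "L' \<subseteq> fst c" "L \<subseteq> L'"
    "\<And>p x. p \<in> L \<Longrightarrow> dist x (snd c p) \<le> \<delta> \<Longrightarrow> x \<in> snd c ` L'"
    "\<And>p q. p \<in> L \<Longrightarrow> q \<in> fst c \<Longrightarrow> dist (snd c q) (snd c p) \<le> \<delta> \<Longrightarrow> q \<in> L'"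
proof -
  let ?K = "snd c ` L"
  have K: "compact ?K" "?K \<subseteq> snd c ` fst c" using chart_compact_image assms by auto
  obtain \<delta> where \<delta>: "\<delta> > 0" "(\<Union>x\<in>?K. cball x \<delta>) \<subseteq> snd c ` fst c"
    using compact_subset_open_imp_cball_epsilon_subset[OF K(1) chart_open_image K(2)] .
  define N where "N = (\<Union>x\<in>?K. cball x \<delta>)"
  have "N = {x + y | x y. x \<in> ?K \<and> y \<in> cball 0 \<delta>}"
  proof (intro set_eqI iffI)
    fix z assume "z \<in> N"
    then obtain x where x: "x \<in> ?K" "dist x z \<le> \<delta>" by (auto simp: N_def)
    then have "z = x + (z - x)" "z - x \<in> cball 0 \<delta>" by (auto simp: dist_norm norm_minus_commute)
    with x show "z \<in> {x + y | x y. x \<in> ?K \<and> y \<in> cball 0 \<delta>}" by blast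
  next
    fix z assume "z \<in> {x + y | x y. x \<in> ?K \<and> y \<in> cball 0 \<delta>}"
    then obtain x y where "x \<in> ?K" "norm y \<le> \<delta>" "z = x + y" by auto
    then have "x \<in> ?K" "z \<in> cball x \<delta>" by (auto simp: dist_norm)
    then show "z \<in> N" unfolding N_def by blast
  qed
  then have compN: "compact N" by (simp only: compact_sums[OF K(1) compact_cball])
  define L' where "L' = chart_inv c ` N"
  have N: "N \<subseteq> snd c ` fst c" using \<delta> by (simp add: N_def)
  have im: "snd c ` L' = N"
    unfolding L'_def image_image using N chart_inv_right by (force simp: subset_iff)
  have sub: "L' \<subseteq> fst c" unfolding L'_def using N chart_inv_in by auto
  have close: "x \<in> snd c ` L'" if "p \<in> L" "dist x (snd c p) \<le> \<delta>" for p x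
    unfolding im N_def using that by (auto simp: dist_commute)
  have close': "q \<in> L'" if "p \<in> L" "q \<in> fst c" "dist (snd c q) (snd c p) \<le> \<delta>" for p q
    using close[OF that(1,3)] sub that(2) inj_onD[OF chart_inj] by blast
  have "L \<subseteq> L'"
  proof
    fix p assume "p \<in> L"
    then show "p \<in> L'" using close'[of p p] assms(2) \<delta>(1) by auto
  qed
  moreover have "compactin (mtop M) L'" unfolding L'_def by (rule chart_inv_compactin[OF compN N])
  ultimately show thesis using \<delta>(1) sub close close' by (intro that)
qed

end

text \<open>Only the point \<open>q\<close> has to lie in both domains: closeness in the chart \<open>c\<close> forces \<open>p\<close> into the
  domain of \<open>d\<close>. This makes rapid closeness symmetric.\<close>

lemma transition_Lipschitz:
  assumes c: "c \<in> charts M" and d: "d \<in> charts M"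
    and L: "compactin (mtop M) L" "L \<subseteq> fst c" "L \<subseteq> fst d"
  obtains \<delta> C where "\<delta> > 0" "C \<ge> 0"
    "\<And>q p. q \<in> L \<Longrightarrow> p \<in> fst c \<Longrightarrow> dist (snd c p) (snd c q) < \<delta> \<Longrightarrow>
      p \<in> fst d \<and> dist (snd d p) (snd d q) \<le> C * dist (snd c p) (snd c q)"
proof -
  have K: "compact (snd c ` L)" "snd c ` L \<subseteq> snd c ` (fst c \<inter> fst d)"
    using chart_compact_image[OF c] L by auto
  obtain \<delta> C where dC: "\<delta> > 0" "C \<ge> 0"
    "\<And>x y. x \<in> snd c ` L \<Longrightarrow> dist y x < \<delta> \<Longrightarrow> y \<in> snd c ` (fst c \<inter> fst d) \<and>
      dist ((snd d \<circ> chart_inv c) y) ((snd d \<circ> chart_inv c) x) \<le> C * dist y x"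
    using smooth_on_Lipschitz_near_compact[OF transition_smooth[OF c d] K] by metis
  have "p \<in> fst d \<and> dist (snd d p) (snd d q) \<le> C * dist (snd c p) (snd c q)"
    if "q \<in> L" "p \<in> fst c" "dist (snd c p) (snd c q) < \<delta>" for p q
  proof -
    have "snd c p \<in> snd c ` (fst c \<inter> fst d)" and
      *: "dist ((snd d \<circ> chart_inv c) (snd c p)) ((snd d \<circ> chart_inv c) (snd c q)) \<le> C * dist (snd c p) (snd c q)"
      using dC(3)[of "snd c q" "snd c p"] that by auto
    then have "p \<in> fst d" using that(2) inj_onD[OF chart_inj[OF c]] by blast
    with * show ?thesis using chart_inv_left[OF c] that L by auto
  qed
  then show thesis by (rule that[OF dC(1,2)])
qed

lemma compact_chart_cover:
  assumes K: "compactin (mtop M) K"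
  obtains F where "finite F" "\<And>c L. (c, L) \<in> F \<Longrightarrow> c \<in> charts M \<and> compactin (mtop M) L \<and> L \<subseteq> fst c"
    "K \<subseteq> (\<Union>(c, L)\<in>F. L)"
proof -
  have "\<exists>c L U. c \<in> charts M \<and> compactin (mtop M) L \<and> L \<subseteq> fst c \<and> openin (mtop M) U \<and> p \<in> U \<and> U \<subseteq> L"
    if p: "p \<in> K" for p
  proof -
    have "p \<in> topspace (mtop M)" using p K compactin_subset_topspace by blast
    then obtain c where c: "c \<in> charts M" "p \<in> fst c" using topspace_eq by auto
    have "compactin (mtop M) {p}" using \<open>p \<in> topspace (mtop M)\<close> by simp
    then obtain \<delta> L' where L': "\<delta> > 0" "compactin (mtop M) L'" "L' \<subseteq> fst c"
      "\<And>q. q \<in> fst c \<Longrightarrow> dist (snd c q) (snd c p) \<le> \<delta> \<Longrightarrow> q \<in> L'"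
      using chart_thickening[OF c(1), of "{p}"] c(2) by (metis empty_subsetI insert_subset singletonI)
    let ?U = "{q \<in> fst c. snd c q \<in> ball (snd c p) \<delta>}"
    have "openin (mtop M) ?U" by (rule chart_openin_preimage[OF c(1) open_ball])
    moreover have "p \<in> ?U" "?U \<subseteq> L'" using c(2) L' by (auto simp: dist_commute)
    ultimately have "openin (mtop M) ?U" "p \<in> ?U" "?U \<subseteq> L'" by auto
    with c L' show ?thesis by blast
  qed
  then obtain C L U where CLU: "\<And>p. p \<in> K \<Longrightarrow> C p \<in> charts M \<and> compactin (mtop M) (L p) \<and>
      L p \<subseteq> fst (C p) \<and> openin (mtop M) (U p) \<and> p \<in> U p \<and> U p \<subseteq> L p"
    by metis
  have "\<exists>\<F>. finite \<F> \<and> \<F> \<subseteq> U ` K \<and> K \<subseteq> \<Union>\<F>"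
    using K CLU unfolding compactin_def by (metis (no_types, lifting) UN_I imageE subsetI)
  then obtain G where G: "finite G" "G \<subseteq> K" "K \<subseteq> \<Union>(U ` G)"
    by (metis finite_subset_image)
  show thesis
  proof (rule that[of "(\<lambda>p. (C p, L p)) ` G"])
    show "finite ((\<lambda>p. (C p, L p)) ` G)" using G by simp
    show "\<And>c M'. (c, M') \<in> (\<lambda>p. (C p, L p)) ` G \<Longrightarrow> c \<in> charts M \<and> compactin (mtop M) M' \<and> M' \<subseteq> fst c"
      using G(2) CLU by blast
    show "K \<subseteq> (\<Union>(c, L)\<in>(\<lambda>p. (C p, L p)) ` G. L)"
    proof
      fix x assume "x \<in> K"
      then obtain p where "p \<in> G" "x \<in> U p" using G by blast
      then show "x \<in> (\<Union>(c, L)\<in>(\<lambda>p. (C p, L p)) ` G. L)" using CLU[of p] G(2) by auto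
    qed
  qed
qed

end

text \<open>If the curve left \<open>A\<close>, there would be a first parameter with value outside \<open>A\<close>. All earlier values
  lie in \<open>B\<close>, so this value does as well, \<open>B\<close> being closed; but \<open>B \<subseteq> A\<close>.\<close>

lemma curve_trapped:
  fixes \<gamma> :: "real \<Rightarrow> 'a"
  assumes \<gamma>: "continuous_map (top_of_set {0..1}) T \<gamma>"
    and A: "openin T A" and B: "closedin T B" and BA: "B \<subseteq> A" and start: "\<gamma> 0 \<in> B"
    and step: "\<And>t. t \<in> {0..1} \<Longrightarrow> (\<And>s. s \<in> {0..t} \<Longrightarrow> \<gamma> s \<in> A) \<Longrightarrow> \<gamma> t \<in> B"
    and t: "t \<in> {0..1}"
  shows "\<gamma> t \<in> B"
proof -
  define G where "G = {s \<in> {0..1}. \<gamma> s \<notin> A}"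
  have preA: "openin (top_of_set {0..1}) {s \<in> {0..1}. \<gamma> s \<in> A}"
    using openin_continuous_map_preimage[OF \<gamma> A] by simp
  have preB: "closedin (top_of_set {0..1}) {s \<in> {0..1}. \<gamma> s \<in> B}"
    using closedin_continuous_map_preimage[OF \<gamma> B] by simp
  have "G = {0..1} - {s \<in> {0..1}. \<gamma> s \<in> A}" by (auto simp: G_def)
  then have "closedin (top_of_set {0..1}) G"
    using closedin_diff[OF closedin_topspace preA] by simp
  then have clG: "compact G" by (metis closedin_compact compact_Icc)
  have "G = {}"
  proof (rule ccontr)
    assume "G \<noteq> {}"
    then obtain m where m: "m \<in> G" "\<And>s. s \<in> G \<Longrightarrow> m \<le> s"
      using compact_attains_inf[OF clG] by blast
    have m0: "0 < m" "m \<le> 1" using m(1) start BA by (auto simp: G_def less_le)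
    have before: "\<gamma> s \<in> B" if "s \<in> {0..<m}" for s
      using step[of s] m(2) m0 that by (force simp: G_def)
    have "closed {s \<in> {0..1}. \<gamma> s \<in> B}" using preB closedin_closed_trans[of "{0..1::real}"] by simp
    moreover have "{0..<m} \<subseteq> {s \<in> {0..1}. \<gamma> s \<in> B}" using before m0 by auto
    ultimately have "closure {0..<m} \<subseteq> {s \<in> {0..1}. \<gamma> s \<in> B}" by (rule closure_minimal[rotated])
    moreover have "m \<in> closure {0..<m}" using m0 by simp
    ultimately have "\<gamma> m \<in> B" by blast
    with m(1) BA show False by (auto simp: G_def)
  qed
  then have "\<gamma> s \<in> A" if "s \<in> {0..1}" for s using that by (auto simp: G_def)
  then show ?thesis using step[OF t] t by auto
qed

section \<open>Nets of points that approach each other rapidly\<close>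

lemma eventually_power_le_power:
  "\<forall>\<^sub>F \<epsilon> in at_right (0::real). C * \<epsilon> ^ Suc m \<le> \<epsilon> ^ m"
proof -
  have "\<forall>\<^sub>F \<epsilon> in at_right (0::real). \<epsilon> \<in> {0<..<1 / (\<bar>C\<bar> + 1)}"
    by (rule eventually_at_right_real) (simp add: add_nonneg_pos)
  then show ?thesis
  proof eventually_elim
    case (elim \<epsilon>)
    then have "\<epsilon> * (\<bar>C\<bar> + 1) \<le> 1" by (simp add: field_simps add_nonneg_pos)
    moreover have "C * \<epsilon> \<le> \<epsilon> * (\<bar>C\<bar> + 1)" using elim
      by (metis abs_ge_self add_increasing2 greaterThanLessThan_iff less_imp_le mult.commute mult_left_mono zero_le_one)
    ultimately have "C * \<epsilon> \<le> 1" by simp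
    then have "(C * \<epsilon>) * \<epsilon> ^ m \<le> 1 * \<epsilon> ^ m" using elim by (intro mult_right_mono) auto
    then show ?case by (simp add: mult_ac)
  qed
qed

lemma eventually_power_less:
  assumes "\<delta> > 0" shows "\<forall>\<^sub>F \<epsilon> in at_right (0::real). C * \<epsilon> ^ Suc m < \<delta>"
proof -
  have "((\<lambda>\<epsilon>::real. C * \<epsilon> ^ Suc m) \<longlongrightarrow> C * 0 ^ Suc m) (at_right 0)"
    by (intro tendsto_intros)
  then show ?thesis using assms by (intro order_tendstoD(2)) auto
qed

lemma eventually_net_index: "\<forall>\<^sub>F \<epsilon> in at_right (0::real). \<epsilon> \<in> net_index \<and> \<epsilon> < 1"
  by (rule eventually_mono[OF eventually_at_right_real[OF zero_less_one]]) auto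

context smooth_mfd
begin

text \<open>Membership of \<open>q \<epsilon>\<close> in the domain of \<open>c\<close> is part of the conclusion because \<open>snd c\<close> has arbitrary
  values elsewhere; this is what makes the relation transitive.\<close>

definition rapidly_close :: "(real \<Rightarrow> 'a) \<Rightarrow> (real \<Rightarrow> 'a) \<Rightarrow> bool" where
  "rapidly_close p q \<longleftrightarrow>
    (\<forall>c\<in>charts M. \<forall>L m. compactin (mtop M) L \<and> L \<subseteq> fst c \<longrightarrow>
      (\<forall>\<^sub>F \<epsilon> in at_right 0. p \<epsilon> \<in> L \<longrightarrow>
        q \<epsilon> \<in> fst c \<and> dist (snd c (q \<epsilon>)) (snd c (p \<epsilon>)) \<le> \<epsilon> ^ m))"

lemma rapidly_closeD:
  "rapidly_close p q \<Longrightarrow> c \<in> charts M \<Longrightarrow> compactin (mtop M) L \<Longrightarrow> L \<subseteq> fst c \<Longrightarrow>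
    \<forall>\<^sub>F \<epsilon> in at_right 0. p \<epsilon> \<in> L \<longrightarrow>
        q \<epsilon> \<in> fst c \<and> dist (snd c (q \<epsilon>)) (snd c (p \<epsilon>)) \<le> \<epsilon> ^ m"
  unfolding rapidly_close_def by blast

lemma rapidly_close_refl: "rapidly_close p p"
  unfolding rapidly_close_def
proof (intro ballI allI impI)
  fix c :: "('a, 'e) chart" and L and m :: nat
  assume "c \<in> charts M" "compactin (mtop M) L \<and> L \<subseteq> fst c"
  then show "\<forall>\<^sub>F \<epsilon> in at_right 0. p \<epsilon> \<in> L \<longrightarrow>
        p \<epsilon> \<in> fst c \<and> dist (snd c (p \<epsilon>)) (snd c (p \<epsilon>)) \<le> \<epsilon> ^ m"
    using eventually_net_index by (auto elim!: eventually_mono)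
qed

lemma rapidly_close_trans:
  assumes pq: "rapidly_close p q" and qr: "rapidly_close q r"
  shows "rapidly_close p r"
  unfolding rapidly_close_def
proof (intro ballI allI impI)
  fix c :: "('a, 'e) chart" and L and m :: nat
  assume c: "c \<in> charts M" and L: "compactin (mtop M) L \<and> L \<subseteq> fst c"
  obtain \<delta> L' where L': "\<delta> > 0" "compactin (mtop M) L'" "L' \<subseteq> fst c"
    "\<And>p q. p \<in> L \<Longrightarrow> q \<in> fst c \<Longrightarrow> dist (snd c q) (snd c p) \<le> \<delta> \<Longrightarrow> q \<in> L'"
    using chart_thickening[OF c, of L] L by metis
  show "\<forall>\<^sub>F \<epsilon> in at_right 0. p \<epsilon> \<in> L \<longrightarrow>
        r \<epsilon> \<in> fst c \<and> dist (snd c (r \<epsilon>)) (snd c (p \<epsilon>)) \<le> \<epsilon> ^ m"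
    \<comment> \<open>One power of \<open>\<epsilon>\<close> is spent on the factor 2 of the triangle inequality.\<close>
    using rapidly_closeD[OF pq c conjunct1[OF L] conjunct2[OF L], of "Suc m"]
      rapidly_closeD[OF qr c L'(2,3), of "Suc m"]
      eventually_power_le_power[of 2 m] eventually_power_less[OF L'(1), of 1 m]
  proof eventually_elim
    case (elim \<epsilon>)
    show ?case
    proof
      assume "p \<epsilon> \<in> L"
      with elim L'(4)[of "p \<epsilon>" "q \<epsilon>"] have "r \<epsilon> \<in> fst c"
        "dist (snd c (q \<epsilon>)) (snd c (p \<epsilon>)) \<le> \<epsilon> ^ Suc m"
        "dist (snd c (r \<epsilon>)) (snd c (q \<epsilon>)) \<le> \<epsilon> ^ Suc m" by auto
      moreover have "dist (snd c (r \<epsilon>)) (snd c (p \<epsilon>)) \<le>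
          dist (snd c (r \<epsilon>)) (snd c (q \<epsilon>)) + dist (snd c (q \<epsilon>)) (snd c (p \<epsilon>))"
        by (rule dist_triangle)
      ultimately show "r \<epsilon> \<in> fst c \<and> dist (snd c (r \<epsilon>)) (snd c (p \<epsilon>)) \<le> \<epsilon> ^ m"
        using elim(3) by linarith
    qed
  qed
qed

text \<open>If \<open>q\<^sub>\<epsilon>\<close> lies in a compact part of the domain of \<open>c\<close>, then rapid closeness can be used only in a
  chart \<open>d\<close> around \<open>p\<^sub>\<epsilon>\<close>. Compactness restricts \<open>d\<close> to finitely many charts, and the Lipschitz
  property of the transition from \<open>d\<close> to \<open>c\<close> near \<open>q\<^sub>\<epsilon>\<close> carries the estimate over.\<close>

lemma rapidly_close_sym:
  assumes pq: "rapidly_close p q"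
    and K: "compactin (mtop M) K" "\<forall>\<^sub>F \<epsilon> in at_right 0. p \<epsilon> \<in> K"
  shows "rapidly_close q p"
  unfolding rapidly_close_def
proof (intro ballI allI impI)
  fix c :: "('a, 'e) chart" and L and m :: nat
  assume c: "c \<in> charts M" and L: "compactin (mtop M) L \<and> L \<subseteq> fst c"
  obtain F where F: "finite F"
    "\<And>d N. (d, N) \<in> F \<Longrightarrow> d \<in> charts M \<and> compactin (mtop M) N \<and> N \<subseteq> fst d"
    "K \<subseteq> (\<Union>(d, N)\<in>F. N)"
    using compact_chart_cover[OF K(1)] by blast
  have "\<forall>\<^sub>F \<epsilon> in at_right 0. p \<epsilon> \<in> N \<longrightarrow> q \<epsilon> \<in> L \<longrightarrow>
      p \<epsilon> \<in> fst c \<and> dist (snd c (p \<epsilon>)) (snd c (q \<epsilon>)) \<le> \<epsilon> ^ m"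
    if dN: "(d, N) \<in> F" for d N
  proof -
    have d: "d \<in> charts M" and N: "compactin (mtop M) N" "N \<subseteq> fst d"
      using F(2)[OF dN] by auto
    obtain \<delta> N' where N': "\<delta> > 0" "compactin (mtop M) N'" "N' \<subseteq> fst d"
      "\<And>p q. p \<in> N \<Longrightarrow> q \<in> fst d \<Longrightarrow> dist (snd d q) (snd d p) \<le> \<delta> \<Longrightarrow> q \<in> N'"
      using chart_thickening[OF d N] by metis
    have "compactin (mtop M) (N' \<inter> L)"
      using N'(2) L compactin_closedin compact_Int_closedin by blast
    then obtain \<eta> C where C: "\<eta> > 0" "C \<ge> 0"
      "\<And>q p. q \<in> N' \<inter> L \<Longrightarrow> p \<in> fst d \<Longrightarrow> dist (snd d p) (snd d q) < \<eta> \<Longrightarrow>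
        p \<in> fst c \<and> dist (snd c p) (snd c q) \<le> C * dist (snd d p) (snd d q)"
      using transition_Lipschitz[OF d c, of "N' \<inter> L"] N'(3) L by (metis le_infI1 le_infI2)
    show ?thesis
      using rapidly_closeD[OF pq d N, of "Suc m"] eventually_power_le_power[of C m]
        eventually_power_less[OF N'(1), of 1 m] eventually_power_less[OF C(1), of 1 m]
    proof eventually_elim
      case (elim \<epsilon>)
      show ?case
      proof (intro impI)
        assume p: "p \<epsilon> \<in> N" and q: "q \<epsilon> \<in> L"
        then have qd: "q \<epsilon> \<in> fst d" "dist (snd d (q \<epsilon>)) (snd d (p \<epsilon>)) \<le> \<epsilon> ^ Suc m"
          using elim by auto
        then have "q \<epsilon> \<in> N' \<inter> L" using N'(4)[OF p, of "q \<epsilon>"] q elim by auto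
        moreover have "dist (snd d (p \<epsilon>)) (snd d (q \<epsilon>)) < \<eta>"
          using qd elim by (simp add: dist_commute)
        ultimately have *: "p \<epsilon> \<in> fst c"
          "dist (snd c (p \<epsilon>)) (snd c (q \<epsilon>)) \<le> C * dist (snd d (p \<epsilon>)) (snd d (q \<epsilon>))"
          using C(3)[of "q \<epsilon>" "p \<epsilon>"] p N by auto
        moreover have "C * dist (snd d (p \<epsilon>)) (snd d (q \<epsilon>)) \<le> C * \<epsilon> ^ Suc m"
          using qd C(2) by (intro mult_left_mono) (auto simp: dist_commute)
        ultimately show "p \<epsilon> \<in> fst c \<and> dist (snd c (p \<epsilon>)) (snd c (q \<epsilon>)) \<le> \<epsilon> ^ m"
          using elim(2) by linarith
      qed
    qed
  qed
  then have "\<forall>\<^sub>F \<epsilon> in at_right 0. \<forall>(d, N)\<in>F. p \<epsilon> \<in> N \<longrightarrow> q \<epsilon> \<in> L \<longrightarrow>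
      p \<epsilon> \<in> fst c \<and> dist (snd c (p \<epsilon>)) (snd c (q \<epsilon>)) \<le> \<epsilon> ^ m"
    using F(1) by (intro eventually_ball_finite) auto
  then show "\<forall>\<^sub>F \<epsilon> in at_right 0. q \<epsilon> \<in> L \<longrightarrow>
      p \<epsilon> \<in> fst c \<and> dist (snd c (p \<epsilon>)) (snd c (q \<epsilon>)) \<le> \<epsilon> ^ m"
    using K(2)
  proof eventually_elim
    case (elim \<epsilon>)
    then show ?case using F(3) by fastforce
  qed
qed

lemma cs_nets_eventually_compact:
  assumes "p \<in> cs_nets M"
  obtains K where "compactin (mtop M) K" "\<forall>\<^sub>F \<epsilon> in at_right 0. p \<epsilon> \<in> K"
proof -
  obtain K e where K: "compactin (mtop M) K" "e > 0" "\<forall>\<epsilon>\<in>net_index. \<epsilon> < e \<longrightarrow> p \<epsilon> \<in> K"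
    using assms by (auto simp: cs_nets_def)
  have "\<forall>\<^sub>F \<epsilon> in at_right 0. p \<epsilon> \<in> K"
    using eventually_net_index eventually_at_right_real[OF K(2)]
    by eventually_elim (use K in auto)
  with K(1) show thesis by (rule that)
qed

end

section \<open>Riemannian distance in charts\<close>

text \<open>The right-hand side is an \<open>nn_integral\<close>, which is monotone for arbitrary functions, so that it can be
  compared with the integral of the speed of a curve. Negative values of \<open>\<phi>'\<close> count as 0 there.\<close>

lemma FTC_le_nn_integral:
  fixes \<phi> \<phi>' :: "real \<Rightarrow> real"
  assumes ab: "a \<le> b" and T: "finite T" and cont: "continuous_on {a..b} \<phi>"
    and deriv: "\<And>x. x \<in> {a<..<b} - T \<Longrightarrow> (\<phi> has_real_derivative \<phi>' x) (at x)"
    and cont': "continuous_on ({a<..<b} - T) \<phi>'"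
  shows "ennreal (\<phi> b - \<phi> a) \<le> (\<integral>\<^sup>+ x \<in> {a<..<b} - T. ennreal (\<phi>' x) \<partial>lborel)"
proof -
  let ?O = "{a<..<b} - T"
  have O: "open ?O" using T by (intro open_Diff finite_imp_closed) auto
  define g where "g = (\<lambda>x. max 0 (indicator ?O x *\<^sub>R \<phi>' x))"
  have meas: "g \<in> borel_measurable lborel"
  proof -
    have "(\<lambda>x. indicator ?O x *\<^sub>R \<phi>' x) \<in> borel_measurable borel"
      using O cont' by (intro borel_measurable_continuous_on_indicator) auto
    then show ?thesis unfolding g_def by measurable
  qed
  have eq: "(\<integral>\<^sup>+ x \<in> ?O. ennreal (\<phi>' x) \<partial>lborel) = (\<integral>\<^sup>+ x. ennreal (g x) \<partial>lborel)"
    by (intro nn_integral_cong) (auto simp: g_def indicator_def max_def ennreal_neg)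
  show ?thesis
  proof (cases "(\<integral>\<^sup>+ x. ennreal (g x) \<partial>lborel) = \<infinity>")
    case True
    then show ?thesis unfolding eq by simp
  next
    case False
    have g0: "g x \<ge> 0" for x by (simp add: g_def)
    then have int: "integrable lborel g"
      using False meas by (intro integrableI_nonneg) (auto simp: less_top[symmetric])
    have "(g has_integral (integral\<^sup>L lborel g)) UNIV" using has_integral_integral_lborel[OF int] .
    moreover have "g x = 0" if "x \<notin> {a..b}" for x using that by (auto simp: g_def indicator_def)
    then have "(\<lambda>x. if x \<in> {a..b} then g x else 0) = g" by auto
    ultimately have 1: "(g has_integral (integral\<^sup>L lborel g)) {a..b}"
      using has_integral_restrict_UNIV[of "{a..b}" g] by metis
    have 2: "((\<lambda>x. indicator ?O x *\<^sub>R \<phi>' x) has_integral (\<phi> b - \<phi> a)) {a..b}"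
      by (rule fundamental_theorem_of_calculus_interior_strong[OF T ab])
        (use deriv cont in \<open>auto simp: has_real_derivative_iff_has_vector_derivative\<close>)
    have "\<phi> b - \<phi> a \<le> integral\<^sup>L lborel g"
      by (rule has_integral_le[OF 2 1]) (simp add: g_def)
    moreover have "(\<integral>\<^sup>+ x. ennreal (g x) \<partial>lborel) = ennreal (integral\<^sup>L lborel g)"
      using int g0 by (intro nn_integral_eq_integral) auto
    ultimately show ?thesis unfolding eq by (simp add: ennreal_leI)
  qed
qed

context smooth_mfd
begin

text \<open>The quadratic form of the metric is continuous and positive on the compact product of \<open>L\<close> with
  the unit sphere, so it is bounded from above and away from 0 there.\<close>

lemma metric_bounds:
  assumes h: "riemannian_metric M h" and c: "c \<in> charts M"
    and L: "compactin (mtop M) L" "L \<subseteq> fst c"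
  obtains C where "C > 0" "\<And>p a. p \<in> L \<Longrightarrow> norm a \<le> C * sqrt (h c p a a)"
    "\<And>p a. p \<in> L \<Longrightarrow> sqrt (h c p a a) \<le> C * norm a"
proof -
  have bil: "bilinear (h c p)" and pos: "\<And>a. a \<noteq> 0 \<Longrightarrow> h c p a a > 0" if "p \<in> L" for p
    using h c L that unfolding riemannian_metric_def by blast+
  have zero: "h c p 0 0 = 0" if "p \<in> L" for p using bil[OF that] by (simp add: bilinear_lzero)
  have scale: "h c p (r *\<^sub>R a) (r *\<^sub>R a) = r\<^sup>2 * h c p a a" if "p \<in> L" for p r a
    using bil[OF that] by (simp add: bilinear_lmul bilinear_rmul power2_eq_square)
  obtain E :: "'e set" where E: "finite E" "\<And>x. x = (\<Sum>e\<in>E. (x \<bullet> e) *\<^sub>R e)"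
    using orthonormal_basis_exists by metis
  define Q where "Q = (\<lambda>(x, a). \<Sum>e\<in>E. \<Sum>f\<in>E. (a \<bullet> e) * (a \<bullet> f) * h c (chart_inv c x) e f)"
  have Q: "Q (snd c p, a) = h c p a a" if "p \<in> L" for p a
  proof -
    have "h c p a a = h c p (\<Sum>e\<in>E. (a \<bullet> e) *\<^sub>R e) (\<Sum>f\<in>E. (a \<bullet> f) *\<^sub>R f)" using E(2)[of a] by simp
    also have "\<dots> = (\<Sum>e\<in>E. \<Sum>f\<in>E. (a \<bullet> e) * (a \<bullet> f) * h c p e f)"
      using bilinear_sum[OF bil[OF that], of "\<lambda>e. (a \<bullet> e) *\<^sub>R e" E "\<lambda>e. (a \<bullet> e) *\<^sub>R e" E] bil[OF that]
      by (simp add: sum.cartesian_product bilinear_lmul bilinear_rmul mult_ac)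
    finally show ?thesis using chart_inv_left[OF c] that L by (simp add: Q_def subset_iff)
  qed
  define K where "K = snd c ` L \<times> sphere (0::'e) 1"
  have "sphere (0::'e) 1 = cball 0 1 \<inter> {a. norm a = 1}" by auto
  moreover have "closed {a::'e. norm a = 1}" by (intro closed_Collect_eq continuous_intros)
  ultimately have "compact (sphere (0::'e) 1)" by (simp only: compact_Int_closed[OF compact_cball])
  then have compK: "compact K" unfolding K_def
    by (intro compact_Times chart_compact_image[OF c L])
  have contK: "continuous_on K Q"
  proof -
    have "smooth_on (snd c ` fst c) (\<lambda>x. h c (chart_inv c x) e f)" for e f
      using h c unfolding riemannian_metric_def by blast
    then have cont: "continuous_on (snd c ` fst c) (\<lambda>x. h c (chart_inv c x) e f)" for e f
      by (rule smooth_on_continuous)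
    have "continuous_on K (\<lambda>z. h c (chart_inv c (fst z)) e f)" for e f
      by (rule continuous_on_compose2[OF cont]) (use L in \<open>auto simp: K_def intro!: continuous_intros\<close>)
    then show ?thesis unfolding Q_def case_prod_unfold by (intro continuous_intros) auto
  qed
  show thesis
  proof (cases "K = {}")
    case True
    then have "L = {} \<or> sphere (0::'e) 1 = {}" by (auto simp: K_def)
    then have a0: "a = 0" if "p \<in> L" for p and a :: 'e
    proof
      assume s: "sphere (0::'e) 1 = {}"
      show "a = 0"
      proof (rule ccontr)
        assume "a \<noteq> 0"
        then have "a /\<^sub>R norm a \<in> sphere 0 1" by simp
        with s show False by blast
      qed
    qed (use that in auto)
    have "norm a \<le> 1 * sqrt (h c p a a) \<and> sqrt (h c p a a) \<le> 1 * norm a" if "p \<in> L" for p a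
      unfolding a0[OF that, of a] using zero[OF that] by simp
    then show thesis by (intro that[of 1]) auto
  next
    case False
    obtain z1 where z1: "z1 \<in> K" "\<And>z. z \<in> K \<Longrightarrow> Q z1 \<le> Q z"
      using continuous_attains_inf[OF compK False contK] by blast
    obtain z2 where z2: "z2 \<in> K" "\<And>z. z \<in> K \<Longrightarrow> Q z \<le> Q z2"
      using continuous_attains_sup[OF compK False contK] by blast
    have Qpos: "Q z > 0" if z: "z \<in> K" for z
    proof -
      obtain p a where "p \<in> L" "norm a = 1" "z = (snd c p, a)" using z by (auto simp: K_def)
      moreover from this have "a \<noteq> 0" by auto
      ultimately show ?thesis using pos Q by simp
    qed
    define C where "C = max (1 / sqrt (Q z1)) (sqrt (Q z2))"
    have m: "sqrt (Q z1) > 0" using Qpos[OF z1(1)] by simp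
    have "C > 0" using Qpos[OF z2(1)] by (simp add: C_def less_max_iff_disj)
    have unit: "sqrt (Q z1) \<le> sqrt (h c p u u)" "sqrt (h c p u u) \<le> sqrt (Q z2)"
      if "p \<in> L" "norm u = 1" for p u
    proof -
      have "(snd c p, u) \<in> K" using that by (auto simp: K_def)
      then show "sqrt (Q z1) \<le> sqrt (h c p u u)" "sqrt (h c p u u) \<le> sqrt (Q z2)"
        using z1(2) z2(2) Q[OF that(1)] by (metis real_sqrt_le_iff)+
    qed
    have general: "norm a \<le> C * sqrt (h c p a a) \<and> sqrt (h c p a a) \<le> C * norm a" if p: "p \<in> L" for p a
    proof (cases "a = 0")
      case True
      then show ?thesis using zero[OF p] by simp
    next
      case False
      define u where "u = a /\<^sub>R norm a"
      have u: "norm u = 1" "a = norm a *\<^sub>R u" using False by (auto simp: u_def)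
      have "u \<noteq> 0" using u(1) by auto
      then have upos: "h c p u u > 0" by (rule pos[OF p])
      have eq: "sqrt (h c p a a) = norm a * sqrt (h c p u u)"
        by (subst u(2), subst (2) u(2), subst scale[OF p]) (simp add: real_sqrt_mult)
      have "1 \<le> (1 / sqrt (Q z1)) * sqrt (h c p u u)"
        using unit(1)[OF p u(1)] m by (simp add: field_simps)
      also have "\<dots> \<le> C * sqrt (h c p u u)"
        by (intro mult_right_mono) (use upos in \<open>auto simp: C_def\<close>)
      finally have "norm a * 1 \<le> norm a * (C * sqrt (h c p u u))"
        by (rule mult_left_mono) simp
      moreover have "norm a * sqrt (h c p u u) \<le> norm a * C"
      proof (rule mult_left_mono)
        show "sqrt (h c p u u) \<le> C" unfolding C_def using unit(2)[OF p u(1)] by (rule max.coboundedI2)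
      qed simp
      ultimately show ?thesis unfolding eq by (simp add: mult_ac)
    qed
    show thesis by (rule that[of C]) (use \<open>C > 0\<close> general in auto)
  qed
qed

lemma transition_has_vector_derivative:
  assumes c: "c \<in> charts M" and d: "d \<in> charts M" and J: "open J" "\<gamma> ` J \<subseteq> fst c" "t \<in> J"
    and w: "((snd c \<circ> \<gamma>) has_vector_derivative w) (at t)" and td: "\<gamma> t \<in> fst d"
  shows "((snd d \<circ> \<gamma>) has_vector_derivative
    frechet_derivative (snd d \<circ> chart_inv c) (at (snd c (\<gamma> t))) w) (at t)"
proof -
  let ?D = "frechet_derivative (snd d \<circ> chart_inv c) (at (snd c (\<gamma> t)))"
  have tc: "\<gamma> t \<in> fst c" using J by auto
  have D: "((snd d \<circ> chart_inv c) has_derivative ?D) (at ((snd c \<circ> \<gamma>) t))"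
    using smooth_on_has_derivative[OF transition_smooth[OF c d], of "snd c (\<gamma> t)"] tc td by simp
  have "((snd c \<circ> \<gamma>) has_derivative (\<lambda>s. s *\<^sub>R w)) (at t)"
    using w by (simp add: has_vector_derivative_def)
  from diff_chain_at[OF this D]
  have "(((snd d \<circ> chart_inv c) \<circ> (snd c \<circ> \<gamma>)) has_derivative (?D \<circ> (\<lambda>s. s *\<^sub>R w))) (at t)" .
  moreover have "?D \<circ> (\<lambda>s. s *\<^sub>R w) = (\<lambda>s. s *\<^sub>R ?D w)"
    using linear_cmul[OF has_derivative_linear[OF D]] by (auto simp: o_def)
  ultimately have "(((snd d \<circ> chart_inv c) \<circ> (snd c \<circ> \<gamma>)) has_vector_derivative ?D w) (at t)"
    by (simp add: has_vector_derivative_def)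
  then show ?thesis
    by (rule has_vector_derivative_transform_within_open[OF _ J(1,3)])
      (use J chart_inv_left[OF c] in auto)
qed

text \<open>By the transformation law, the speed can be computed in any chart around the point instead of the
  one chosen in the definition.\<close>

lemma speed_chart:
  assumes h: "riemannian_metric M h" and c: "c \<in> charts M"
    and J: "open J" "\<gamma> ` J \<subseteq> fst c" "t \<in> J"
    and w: "((snd c \<circ> \<gamma>) has_vector_derivative w) (at t)"
  shows "speed M h \<gamma> t = sqrt (h c (\<gamma> t) w w)"
proof -
  define d where "d = (SOME c. c \<in> charts M \<and> \<gamma> t \<in> fst c)"
  have tc: "\<gamma> t \<in> fst c" using J by auto
  then have "\<exists>c. c \<in> charts M \<and> \<gamma> t \<in> fst c" using c by blast
  then have d: "d \<in> charts M \<and> \<gamma> t \<in> fst d" unfolding d_def by (rule someI_ex)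
  let ?D = "frechet_derivative (snd d \<circ> chart_inv c) (at (snd c (\<gamma> t)))"
  have "vector_derivative (snd d \<circ> \<gamma>) (at t) = ?D w"
    by (rule vector_derivative_at[OF transition_has_vector_derivative[OF c conjunct1[OF d] J w conjunct2[OF d]]])
  moreover have "h c (\<gamma> t) w w = h d (\<gamma> t) (?D w) (?D w)"
    using h c d tc unfolding riemannian_metric_def Let_def by blast
  ultimately show ?thesis by (simp add: speed_def d_def[symmetric] Let_def)
qed

text \<open>The straight segment in coordinates is a curve whose speed is bounded by a multiple of the
  distance of its end points.\<close>

lemma rdist_le_chart_dist:
  assumes h: "riemannian_metric M h" and c: "c \<in> charts M"
    and L: "compactin (mtop M) L" "L \<subseteq> fst c"
  obtains \<delta> C where "\<delta> > 0" "C \<ge> 0"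
    "\<And>p q. p \<in> L \<Longrightarrow> q \<in> fst c \<Longrightarrow> dist (snd c q) (snd c p) < \<delta> \<Longrightarrow>
      rdist M h p q \<le> ennreal (C * dist (snd c q) (snd c p))"
proof -
  obtain \<delta> L' where L': "\<delta> > 0" "compactin (mtop M) L'" "L' \<subseteq> fst c"
    "\<And>p x. p \<in> L \<Longrightarrow> dist x (snd c p) \<le> \<delta> \<Longrightarrow> x \<in> snd c ` L'"
    using chart_thickening[OF c L] by metis
  obtain C where C: "C > 0" "\<And>p a. p \<in> L' \<Longrightarrow> sqrt (h c p a a) \<le> C * norm a"
    using metric_bounds[OF h c L'(2,3)] by metis
  have "rdist M h p q \<le> ennreal (C * dist (snd c q) (snd c p))"
    if p: "p \<in> L" and q: "q \<in> fst c" and near: "dist (snd c q) (snd c p) < \<delta>" for p q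
  proof -
    define v where "v = snd c q - snd c p"
    define l where "l = (\<lambda>t::real. snd c p + t *\<^sub>R v)"
    define \<gamma> where "\<gamma> = chart_inv c \<circ> l"
    \<comment> \<open>An open set of parameters around \<open>{0..1}\<close>, so that two-sided derivatives exist at 0 and 1.\<close>
    define J where "J = l -` ball (snd c p) \<delta>"
    have contl: "continuous_on A l" for A unfolding l_def by (intro continuous_intros)
    have J: "open J" unfolding J_def by (rule open_vimage[OF open_ball contl])
    have vd: "norm v < \<delta>" using near by (simp add: v_def dist_norm)
    have "t \<in> J" if "t \<in> {0..1}" for t
    proof -
      have "\<bar>t\<bar> * norm v \<le> 1 * norm v" using that by (intro mult_right_mono) auto
      then show ?thesis using vd by (simp add: J_def l_def dist_norm)
    qed
    then have J01: "{0..1} \<subseteq> J" by blast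
    have lJ: "l t \<in> snd c ` L'" if "t \<in> J" for t
      using L'(4)[OF p, of "l t"] that by (auto simp: J_def dist_commute)
    have l_im: "l t \<in> snd c ` fst c" if "t \<in> J" for t using lJ[OF that] L'(3) by blast
    have c\<gamma>: "snd c (\<gamma> t) = l t" if "t \<in> J" for t
      using chart_inv_right[OF c l_im[OF that]] by (simp add: \<gamma>_def)
    have \<gamma>L': "\<gamma> t \<in> L'" if "t \<in> J" for t
      using lJ[OF that] chart_inv_left[OF c] L'(3) by (auto simp: \<gamma>_def subset_iff)
    have \<gamma>J: "\<gamma> ` J \<subseteq> fst c" using \<gamma>L' L'(3) by blast
    have vec: "((snd c \<circ> \<gamma>) has_vector_derivative v) (at t)" if "t \<in> J" for t
    proof -
      have "(l has_vector_derivative v) (at t)"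
        unfolding l_def by (auto intro!: derivative_eq_intros)
      then show ?thesis
        by (rule has_vector_derivative_transform_within_open[OF _ J that]) (simp add: c\<gamma>)
    qed
    have ends: "\<gamma> 0 = p" "\<gamma> 1 = q"
      using p q L chart_inv_left[OF c] by (auto simp: \<gamma>_def l_def v_def)
    have pw: "piecewise_C1_curve M \<gamma>"
      unfolding piecewise_C1_curve_def
    proof (intro conjI exI[of _ "{}"] allI impI)
      have "continuous_map (top_of_set {0..1}) (top_of_set (snd c ` fst c)) l"
        using contl l_im J01 by (auto simp: continuous_map_in_subtopology)
      then show "continuous_map (top_of_set {0..1}) (mtop M) \<gamma>"
        unfolding \<gamma>_def by (rule continuous_map_compose[OF _ chart_inv_continuous[OF c]])
    next
      fix s t :: real assume st: "0 \<le> s \<and> s < t \<and> t \<le> 1 \<and> {s<..<t} \<inter> {} = {}"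
      show "C1_on_interval M \<gamma> s t"
        unfolding C1_on_interval_def Let_def
      proof (intro ballI conjI)
        fix d assume d: "d \<in> charts M"
        define g where "g = (\<lambda>r. frechet_derivative (snd d \<circ> chart_inv c) (at (l r)) v)"
        have der: "((snd d \<circ> \<gamma>) has_vector_derivative g r) (at r)" if "r \<in> J" "\<gamma> r \<in> fst d" for r
          using transition_has_vector_derivative[OF c d J \<gamma>J that(1) vec[OF that(1)] that(2)]
          by (simp add: g_def c\<gamma>[OF that(1)])
        have within: "vector_derivative (snd d \<circ> \<gamma>) (at r within {s..t}) = g r"
          "(snd d \<circ> \<gamma>) differentiable (at r within {s..t})"
          if "r \<in> {r \<in> {s..t}. \<gamma> r \<in> fst d}" for r
        proof -
          have "r \<in> J" using that st J01 by auto
          then have v: "((snd d \<circ> \<gamma>) has_vector_derivative g r) (at r within {s..t})"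
            using der that by (blast intro: has_vector_derivative_at_within)
          show "vector_derivative (snd d \<circ> \<gamma>) (at r within {s..t}) = g r"
            by (rule vector_derivative_within_cbox[of s t r, unfolded box_real, OF _ _ v]) (use st that in auto)
          show "(snd d \<circ> \<gamma>) differentiable (at r within {s..t})"
            by (rule differentiableI_vector[OF v])
        qed
        then show "\<And>r. r \<in> {r \<in> {s..t}. \<gamma> r \<in> fst d} \<Longrightarrow>
            (snd d \<circ> \<gamma>) differentiable (at r within {s..t})" by blast
        have "continuous_on (snd c ` (fst c \<inter> fst d)) (\<lambda>x. frechet_derivative (snd d \<circ> chart_inv c) (at x) v)"
          by (intro smooth_on_continuous smooth_on_frechet_derivative transition_smooth c d)
        then have "continuous_on {r \<in> {s..t}. \<gamma> r \<in> fst d} g"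
          unfolding g_def
        proof (rule continuous_on_compose2[OF _ contl])
          show "l ` {r \<in> {s..t}. \<gamma> r \<in> fst d} \<subseteq> snd c ` (fst c \<inter> fst d)"
          proof
            fix x assume "x \<in> l ` {r \<in> {s..t}. \<gamma> r \<in> fst d}"
            then obtain r where r: "x = l r" "r \<in> {s..t}" "\<gamma> r \<in> fst d" by blast
            then have "r \<in> J" using st J01 by auto
            then have "x = snd c (\<gamma> r)" "\<gamma> r \<in> fst c" using r c\<gamma> \<gamma>J by auto
            with r show "x \<in> snd c ` (fst c \<inter> fst d)" by blast
          qed
        qed
        then show "continuous_on {r \<in> {s..t}. \<gamma> r \<in> fst d}
            (\<lambda>r. vector_derivative (snd d \<circ> \<gamma>) (at r within {s..t}))"
          using within(1) by (simp cong: continuous_on_cong_simp)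
      qed
    qed simp
    have speed: "speed M h \<gamma> t \<le> C * norm v" if "t \<in> {0..1}" for t
    proof -
      have t: "t \<in> J" using that J01 by blast
      have "speed M h \<gamma> t = sqrt (h c (\<gamma> t) v v)"
        by (rule speed_chart[OF h c J \<gamma>J t vec[OF t]])
      also have "\<dots> \<le> C * norm v" by (rule C(2)[OF \<gamma>L'[OF t]])
      finally show ?thesis .
    qed
    have "curve_length M h \<gamma> \<le> (\<integral>\<^sup>+ t \<in> {0..1::real}. ennreal (C * norm v) \<partial>lborel)"
      unfolding curve_length_def
      by (intro nn_integral_mono) (auto simp: indicator_def intro!: ennreal_leI speed)
    also have "\<dots> = ennreal (C * norm v)" by (simp add: nn_integral_cmult_indicator)
    finally have "curve_length M h \<gamma> \<le> ennreal (C * dist (snd c q) (snd c p))"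
      by (simp add: v_def dist_norm)
    moreover have "rdist M h p q \<le> curve_length M h \<gamma>"
      unfolding rdist_def by (intro INF_lower) (use pw ends in simp)
    ultimately show ?thesis by (rule order_trans[rotated])
  qed
  then show thesis by (rule that[OF L'(1) less_imp_le[OF C(1)]])
qed

text \<open>For a curve that starts at \<open>p\<close>, it suffices to bound its distance from \<open>p\<close> in coordinates by \<open>r\<close> as
  long as it has not left the larger coordinate ball of radius \<open>\<rho>\<close>.\<close>

lemma curve_trapped_in_chart_ball:
  fixes \<gamma> :: "real \<Rightarrow> 'a"
  assumes c: "c \<in> charts M" and p: "p \<in> fst c" and r: "0 \<le> r" "r < \<rho>"
    and im: "cball (snd c p) r \<subseteq> snd c ` fst c"
    and \<gamma>: "continuous_map (top_of_set {0..1}) (mtop M) \<gamma>" "\<gamma> 0 = p"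
    and step: "\<And>t. t \<in> {0..1} \<Longrightarrow>
      (\<And>s. s \<in> {0..t} \<Longrightarrow> \<gamma> s \<in> fst c \<and> dist (snd c (\<gamma> s)) (snd c p) < \<rho>) \<Longrightarrow>
      dist (snd c (\<gamma> t)) (snd c p) \<le> r"
  shows "\<gamma> 1 \<in> fst c \<and> dist (snd c (\<gamma> 1)) (snd c p) \<le> r"
proof -
  define A where "A = {x \<in> fst c. snd c x \<in> ball (snd c p) \<rho>}"
  define B where "B = chart_inv c ` cball (snd c p) r"
  have A: "openin (mtop M) A" unfolding A_def by (rule chart_openin_preimage[OF c open_ball])
  have B: "closedin (mtop M) B"
    unfolding B_def by (intro compactin_closedin chart_inv_compactin[OF c compact_cball im])
  have A_iff: "x \<in> A \<longleftrightarrow> x \<in> fst c \<and> dist (snd c x) (snd c p) < \<rho>" for x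
    by (simp add: A_def dist_commute)
  have B_iff: "x \<in> B \<longleftrightarrow> x \<in> fst c \<and> dist (snd c x) (snd c p) \<le> r" for x
  proof
    assume "x \<in> B"
    then obtain y where y: "y \<in> cball (snd c p) r" "x = chart_inv c y" by (auto simp: B_def)
    then have "y \<in> snd c ` fst c" using im by blast
    from chart_inv_in[OF c this] chart_inv_right[OF c this] y
    show "x \<in> fst c \<and> dist (snd c x) (snd c p) \<le> r" by (simp add: dist_commute)
  next
    assume x: "x \<in> fst c \<and> dist (snd c x) (snd c p) \<le> r"
    then have "snd c x \<in> cball (snd c p) r" "x = chart_inv c (snd c x)"
      using chart_inv_left[OF c] by (auto simp: dist_commute)
    then show "x \<in> B" unfolding B_def by blast
  qed
  have "B \<subseteq> A" using B_iff A_iff r by fastforce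
  moreover have "\<gamma> 0 \<in> B" using B_iff \<gamma>(2) p r(1) by simp
  moreover have "\<gamma> t \<in> B" if t: "t \<in> {0..1}" and inA: "\<And>s. s \<in> {0..t} \<Longrightarrow> \<gamma> s \<in> A" for t
  proof -
    have "dist (snd c (\<gamma> t)) (snd c p) \<le> r" using step[OF t] inA unfolding A_iff by blast
    moreover have "\<gamma> t \<in> fst c" using inA[of t] t unfolding A_iff by simp
    ultimately show ?thesis using B_iff by blast
  qed
  moreover have "(1::real) \<in> {0..1}" by simp
  ultimately have "\<gamma> 1 \<in> B" using curve_trapped[OF \<gamma>(1) A B] by blast
  then show ?thesis unfolding B_iff .
qed

text \<open>As long as a curve from \<open>p\<close> stays near \<open>p\<close> in coordinates, its length bounds the coordinate distance
  from \<open>p\<close> up to a factor \<open>C\<close>; so a curve of length less than \<open>\<rho> / (2 * C)\<close> cannot get away from \<open>p\<close>.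
  Stating the bound in terms of \<open>r > rdist M h p q\<close> avoids passing to the infimum over curves.\<close>

lemma chart_dist_le_rdist:
  assumes h: "riemannian_metric M h" and c: "c \<in> charts M"
    and L: "compactin (mtop M) L" "L \<subseteq> fst c"
  obtains \<delta> C where "\<delta> > 0" "C > 0"
    "\<And>p q r. p \<in> L \<Longrightarrow> rdist M h p q < ennreal r \<Longrightarrow> r \<le> \<delta> \<Longrightarrow>
      q \<in> fst c \<and> dist (snd c q) (snd c p) \<le> C * r"
proof -
  obtain \<rho> L' where L': "\<rho> > 0" "compactin (mtop M) L'" "L' \<subseteq> fst c"
    "\<And>p x. p \<in> L \<Longrightarrow> dist x (snd c p) \<le> \<rho> \<Longrightarrow> x \<in> snd c ` L'"
    "\<And>p q. p \<in> L \<Longrightarrow> q \<in> fst c \<Longrightarrow> dist (snd c q) (snd c p) \<le> \<rho> \<Longrightarrow> q \<in> L'"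
    using chart_thickening[OF c L] by metis
  obtain C where C: "C > 0" "\<And>p a. p \<in> L' \<Longrightarrow> norm a \<le> C * sqrt (h c p a a)"
    using metric_bounds[OF h c L'(2,3)] by metis
  have main: "q \<in> fst c \<and> dist (snd c q) (snd c p) \<le> C * r"
    if p: "p \<in> L" and dist: "rdist M h p q < ennreal r" and r\<rho>: "r \<le> \<rho> / (2 * C)" for p q r
  proof -
    obtain \<gamma> where \<gamma>: "piecewise_C1_curve M \<gamma>" "\<gamma> 0 = p" "\<gamma> 1 = q" and len: "curve_length M h \<gamma> < ennreal r"
      using dist unfolding rdist_def INF_less_iff by blast
    have r0: "r > 0" using len by (metis ennreal_neg not_less not_less_zero less_eq_real_def linorder_not_le zero_less_iff_neq_zero)
    have Cr: "C * r < \<rho>" "C * r > 0"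
    proof -
      have "C * r \<le> C * (\<rho> / (2 * C))" using r\<rho> C(1) by (intro mult_left_mono) auto
      also have "\<dots> < \<rho>" using C(1) L'(1) by simp
      finally show "C * r < \<rho>" .
      show "C * r > 0" using C(1) r0 by simp
    qed
    have cont: "continuous_map (top_of_set {0..1}) (mtop M) \<gamma>"
      using \<gamma>(1) by (simp add: piecewise_C1_curve_def)
    obtain T where T: "finite T"
      "\<And>s t. 0 \<le> s \<Longrightarrow> s < t \<Longrightarrow> t \<le> 1 \<Longrightarrow> {s<..<t} \<inter> T = {} \<Longrightarrow> C1_on_interval M \<gamma> s t"
      using \<gamma>(1) unfolding piecewise_C1_curve_def by blast
    have im: "cball (snd c p) (C * r) \<subseteq> snd c ` fst c"
      using L'(3) L'(4)[OF p] Cr by (force simp: dist_commute)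
    have pc: "p \<in> fst c" using p L by blast
    have bound: "dist (snd c (\<gamma> t)) (snd c p) \<le> C * r"
      if t: "t \<in> {0..1}" and inA: "\<And>s. s \<in> {0..t} \<Longrightarrow> \<gamma> s \<in> fst c \<and> dist (snd c (\<gamma> s)) (snd c p) < \<rho>" for t
    proof -
      have inc: "\<gamma> s \<in> fst c" and inL': "\<gamma> s \<in> L'" if "s \<in> {0..t}" for s
        using inA[OF that] L'(5)[OF p, of "\<gamma> s"] by auto
      define O' where "O' = {0<..<t} - T"
      have O': "open O'" unfolding O'_def using T(1) by (intro open_Diff finite_imp_closed) auto
      define w where "w = (\<lambda>s. vector_derivative (snd c \<circ> \<gamma>) (at s))"
      have reg: "((snd c \<circ> \<gamma>) has_vector_derivative w s) (at s) \<and> isCont w s" if s: "s \<in> O'" for s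
      proof -
        obtain e where e: "e > 0" "ball s e \<subseteq> O'" using O' s open_contains_ball by blast
        define a b where "a = s - e / 2" and "b = s + e / 2"
        have ab: "a < s" "s < b" using e by (auto simp: a_def b_def)
        have abO: "{a..b} \<subseteq> O'" using e by (force simp: a_def b_def dist_real_def)
        have "a \<in> O'" "b \<in> O'" using abO ab by auto
        then have "0 \<le> a" "b \<le> 1" "{a<..<b} \<inter> T = {}"
          using abO t by (auto simp: O'_def subset_iff)
        then have C1: "C1_on_interval M \<gamma> a b" using T(2)[of a b] ab by auto
        have all: "{r \<in> {a..b}. \<gamma> r \<in> fst c} = {a..b}" using abO inc by (auto simp: O'_def)
        let ?w = "\<lambda>r. vector_derivative (snd c \<circ> \<gamma>) (at r within {a..b})"
        have diff: "\<And>r. r \<in> {a..b} \<Longrightarrow> (snd c \<circ> \<gamma>) differentiable (at r within {a..b})"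
          and cont_w: "continuous_on {a..b} ?w"
          using bspec[OF C1[unfolded C1_on_interval_def Let_def] c] unfolding all by blast+
        have inner: "((snd c \<circ> \<gamma>) has_vector_derivative ?w r) (at r)" if "r \<in> {a<..<b}" for r
        proof -
          have "((snd c \<circ> \<gamma>) has_vector_derivative ?w r) (at r within {a..b})"
            using diff[of r] that by (auto simp: vector_derivative_works)
          moreover have "at r within {a..b} = at r" using that by (intro at_within_Icc_at) auto
          ultimately show ?thesis by simp
        qed
        have eq: "w r = ?w r" if "r \<in> {a<..<b}" for r
          unfolding w_def by (rule vector_derivative_at[OF inner[OF that]])
        have "continuous_on {a<..<b} ?w" by (rule continuous_on_subset[OF cont_w]) auto
        then have "continuous_on {a<..<b} w" using eq by (simp cong: continuous_on_cong_simp)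
        then have "isCont w s" using ab by (auto simp: continuous_on_eq_continuous_at)
        with inner[of s] eq[of s] ab show ?thesis by simp
      qed
      define z where "z = snd c (\<gamma> t) - snd c p"
      have "norm z \<le> C * r"
      proof (cases "z = 0")
        case True
        then show ?thesis using Cr by simp
      next
        case False
        \<comment> \<open>Scaled such that the component of \<open>snd c \<circ> \<gamma>\<close> along \<open>e\<close> grows at most at the speed of \<open>\<gamma>\<close>.
          Scaling the integral of the speed instead would require measurability.\<close>
        define e where "e = z /\<^sub>R (C * norm z)"
        define \<phi> where "\<phi> = (\<lambda>s. e \<bullet> snd c (\<gamma> s))"
        have tval: "\<phi> t - \<phi> 0 = norm z / C"
        proof -
          have "\<phi> t - \<phi> 0 = e \<bullet> z" by (simp add: \<phi>_def z_def \<gamma>(2) inner_diff_right)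
          also have "\<dots> = norm z / C"
            using False C(1) by (simp add: e_def dot_square_norm power2_eq_square field_simps)
          finally show ?thesis .
        qed
        have nrm_e: "norm e = 1 / C" using False C(1) by (simp add: e_def field_simps)
        have "continuous_map (top_of_set {0..t}) (subtopology (mtop M) (fst c)) \<gamma>"
          using continuous_map_from_subtopology_mono[OF cont, of "{0..t}"] t inc
          by (auto simp: continuous_map_in_subtopology)
        then have "continuous_map (top_of_set {0..t}) euclidean (snd c \<circ> \<gamma>)"
          by (rule continuous_map_compose[OF _ chart_continuous[OF c]])
        then have "continuous_on {0..t} (\<lambda>s. snd c (\<gamma> s))" by (simp add: o_def)
        then have cont\<phi>: "continuous_on {0..t} \<phi>" unfolding \<phi>_def by (intro continuous_intros)
        have d\<phi>: "(\<phi> has_real_derivative e \<bullet> w s) (at s)" if "s \<in> {0<..<t} - T" for s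
        proof -
          have "((\<lambda>s. snd c (\<gamma> s)) has_derivative (\<lambda>x. x *\<^sub>R w s)) (at s)"
            using reg[of s] that by (simp add: O'_def has_vector_derivative_def o_def)
          then have "(\<phi> has_derivative (\<lambda>x. e \<bullet> (x *\<^sub>R w s))) (at s)"
            unfolding \<phi>_def by (rule has_derivative_inner_right)
          moreover have "(\<lambda>x. e \<bullet> (x *\<^sub>R w s)) = (*) (e \<bullet> w s)" by (auto simp: mult.commute)
          ultimately show ?thesis by (simp add: has_field_derivative_def)
        qed
        have contw: "continuous_on ({0<..<t} - T) (\<lambda>s. e \<bullet> w s)"
          using reg by (intro continuous_intros continuous_at_imp_continuous_on) (auto simp: O'_def)
        have "ennreal (\<phi> t - \<phi> 0) \<le> (\<integral>\<^sup>+ s \<in> {0<..<t} - T. ennreal (e \<bullet> w s) \<partial>lborel)"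
          by (rule FTC_le_nn_integral) (use t T(1) cont\<phi> d\<phi> contw in auto)
        also have "\<dots> \<le> curve_length M h \<gamma>"
          unfolding curve_length_def
        proof (intro nn_integral_mono)
          fix s :: real
          show "ennreal (e \<bullet> w s) * indicator ({0<..<t} - T) s \<le> ennreal (speed M h \<gamma> s) * indicator {0..1} s"
          proof (cases "s \<in> O'")
            case True
            have sub: "\<gamma> ` O' \<subseteq> fst c" using inc by (auto simp: O'_def)
            have "speed M h \<gamma> s = sqrt (h c (\<gamma> s) (w s) (w s))"
              by (rule speed_chart[OF h c O' sub True]) (use reg[OF True] in blast)
            moreover have "\<gamma> s \<in> L'" using inL'[of s] True by (auto simp: O'_def)
            ultimately have "norm (w s) / C \<le> speed M h \<gamma> s"
              using C by (simp add: divide_le_eq mult.commute)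
            moreover have "e \<bullet> w s \<le> norm (w s) / C"
              using norm_cauchy_schwarz[of e "w s"] by (simp add: nrm_e)
            ultimately have "e \<bullet> w s \<le> speed M h \<gamma> s" by linarith
            then show ?thesis using True t by (auto simp: O'_def indicator_def intro!: ennreal_leI)
          qed (simp add: O'_def[symmetric])
        qed
        finally have "ennreal (norm z / C) < ennreal r" using len unfolding tval by simp
        then have "norm z / C < r" using r0 by (simp add: ennreal_less_iff C(1) less_imp_le)
        then show ?thesis using C(1) by (simp add: field_simps)
      qed
      then show ?thesis by (simp add: z_def dist_norm)
    qed
    from curve_trapped_in_chart_ball[OF c pc less_imp_le[OF Cr(2)] Cr(1) im cont \<gamma>(2) bound]
    show ?thesis unfolding \<gamma>(3) .
  qed
  have "\<rho> / (2 * C) > 0" using L'(1) C(1) by simp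
  then show thesis using C(1) main by (rule that)
qed

text \<open>The right-hand side does not depend on \<open>h\<close>: this replaces the comparison of two Riemannian metrics.\<close>

lemma rdist_negligible_iff_rapidly_close:
  assumes h: "riemannian_metric M h" and p: "p \<in> cs_nets M"
  shows "(\<forall>m>0::nat. ebigo (\<lambda>\<epsilon>. rdist M h (p \<epsilon>) (q \<epsilon>)) (\<lambda>\<epsilon>. \<epsilon> ^ m)) \<longleftrightarrow> rapidly_close p q"
proof
  assume R: "\<forall>m>0::nat. ebigo (\<lambda>\<epsilon>. rdist M h (p \<epsilon>) (q \<epsilon>)) (\<lambda>\<epsilon>. \<epsilon> ^ m)"
  show "rapidly_close p q"
    unfolding rapidly_close_def
  proof (intro ballI allI impI)
    fix c :: "('a, 'e) chart" and L and m :: nat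
    assume c: "c \<in> charts M" and L: "compactin (mtop M) L \<and> L \<subseteq> fst c"
    obtain \<delta> C where dC: "\<delta> > 0" "C > 0"
      "\<And>p q r. p \<in> L \<Longrightarrow> rdist M h p q < ennreal r \<Longrightarrow> r \<le> \<delta> \<Longrightarrow>
        q \<in> fst c \<and> dist (snd c q) (snd c p) \<le> C * r"
      using chart_dist_le_rdist[OF h c conjunct1[OF L] conjunct2[OF L]] by blast
    obtain B where B: "\<forall>\<^sub>F \<epsilon> in at_right 0. rdist M h (p \<epsilon>) (q \<epsilon>) \<le> ennreal (B * \<bar>\<epsilon> ^ Suc m\<bar>)"
      using R[rule_format, of "Suc m"] by (auto simp: ebigo_def)
    let ?B = "\<bar>B\<bar> + 1"
    show "\<forall>\<^sub>F \<epsilon> in at_right 0. p \<epsilon> \<in> L \<longrightarrow>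
        q \<epsilon> \<in> fst c \<and> dist (snd c (q \<epsilon>)) (snd c (p \<epsilon>)) \<le> \<epsilon> ^ m"
      using B eventually_net_index eventually_power_less[OF dC(1), of ?B m]
        eventually_power_le_power[of "C * ?B" m]
    proof eventually_elim
      case (elim \<epsilon>)
      have "B * \<bar>\<epsilon> ^ Suc m\<bar> < ?B * \<epsilon> ^ Suc m"
        using elim(2) by (simp del: power_Suc add: mult_strict_right_mono)
      moreover have "?B * \<epsilon> ^ Suc m > 0" using elim(2) by (simp add: add_nonneg_pos)
      ultimately have "ennreal (B * \<bar>\<epsilon> ^ Suc m\<bar>) < ennreal (?B * \<epsilon> ^ Suc m)"
        by (rule ennreal_lessI[rotated])
      then have lt: "rdist M h (p \<epsilon>) (q \<epsilon>) < ennreal (?B * \<epsilon> ^ Suc m)"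
        using elim(1) by (rule le_less_trans[rotated])
      show ?case
      proof
        assume "p \<epsilon> \<in> L"
        from dC(3)[OF this lt less_imp_le[OF elim(3)]]
        show "q \<epsilon> \<in> fst c \<and> dist (snd c (q \<epsilon>)) (snd c (p \<epsilon>)) \<le> \<epsilon> ^ m"
          using elim(4) by (simp add: mult.assoc)
      qed
    qed
  qed
next
  assume R: "rapidly_close p q"
  obtain K where K: "compactin (mtop M) K" "\<forall>\<^sub>F \<epsilon> in at_right 0. p \<epsilon> \<in> K"
    using cs_nets_eventually_compact[OF p] .
  obtain F where F: "finite F"
    "\<And>d N. (d, N) \<in> F \<Longrightarrow> d \<in> charts M \<and> compactin (mtop M) N \<and> N \<subseteq> fst d"
    "K \<subseteq> (\<Union>(d, N)\<in>F. N)"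
    using compact_chart_cover[OF K(1)] by blast
  have "\<exists>B\<ge>0. \<forall>m::nat. \<forall>\<^sub>F \<epsilon> in at_right 0. p \<epsilon> \<in> snd z \<longrightarrow> rdist M h (p \<epsilon>) (q \<epsilon>) \<le> ennreal (B * \<epsilon> ^ m)"
    if z: "z \<in> F" for z
  proof -
    obtain d N where dN: "z = (d, N)" by fastforce
    have d: "d \<in> charts M" and N: "compactin (mtop M) N" "N \<subseteq> fst d"
      using F(2) z dN by auto
    obtain \<delta> C where dC: "\<delta> > 0" "C \<ge> 0"
      "\<And>p q. p \<in> N \<Longrightarrow> q \<in> fst d \<Longrightarrow> dist (snd d q) (snd d p) < \<delta> \<Longrightarrow>
        rdist M h p q \<le> ennreal (C * dist (snd d q) (snd d p))"
      using rdist_le_chart_dist[OF h d N] by blast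
    have "\<forall>\<^sub>F \<epsilon> in at_right 0. p \<epsilon> \<in> snd z \<longrightarrow> rdist M h (p \<epsilon>) (q \<epsilon>) \<le> ennreal (C * \<epsilon> ^ m)" for m
      using rapidly_closeD[OF R d N, of m] rapidly_closeD[OF R d N, of 1]
        eventually_power_less[OF dC(1), of 1 0]
    proof eventually_elim
      case (elim \<epsilon>)
      show ?case
      proof
        assume "p \<epsilon> \<in> snd z"
        then have pN: "p \<epsilon> \<in> N" by (simp add: dN)
        then have "rdist M h (p \<epsilon>) (q \<epsilon>) \<le> ennreal (C * dist (snd d (q \<epsilon>)) (snd d (p \<epsilon>)))"
          using elim by (intro dC(3)) auto
        also have "\<dots> \<le> ennreal (C * \<epsilon> ^ m)"
          using elim pN dC(2) by (intro ennreal_leI mult_left_mono) auto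
        finally show "rdist M h (p \<epsilon>) (q \<epsilon>) \<le> ennreal (C * \<epsilon> ^ m)" .
      qed
    qed
    with dC(2) show ?thesis by blast
  qed
  then have "\<forall>z\<in>F. \<exists>B\<ge>0. \<forall>m::nat. \<forall>\<^sub>F \<epsilon> in at_right 0. p \<epsilon> \<in> snd z \<longrightarrow>
      rdist M h (p \<epsilon>) (q \<epsilon>) \<le> ennreal (B * \<epsilon> ^ m)"
    by blast
  from bchoice[OF this] obtain B where B: "\<And>z. z \<in> F \<Longrightarrow> B z \<ge> 0"
    "\<And>z m. z \<in> F \<Longrightarrow> \<forall>\<^sub>F \<epsilon> in at_right 0. p \<epsilon> \<in> snd z \<longrightarrow> rdist M h (p \<epsilon>) (q \<epsilon>) \<le> ennreal (B z * \<epsilon> ^ m)"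
    by blast
  show "\<forall>m>0::nat. ebigo (\<lambda>\<epsilon>. rdist M h (p \<epsilon>) (q \<epsilon>)) (\<lambda>\<epsilon>. \<epsilon> ^ m)"
  proof (intro allI impI)
    fix m :: nat
    have "\<forall>\<^sub>F \<epsilon> in at_right 0. \<forall>z\<in>F. p \<epsilon> \<in> snd z \<longrightarrow> rdist M h (p \<epsilon>) (q \<epsilon>) \<le> ennreal (B z * \<epsilon> ^ m)"
      using F(1) B(2) by (intro eventually_ball_finite) auto
    then have "\<forall>\<^sub>F \<epsilon> in at_right 0. rdist M h (p \<epsilon>) (q \<epsilon>) \<le> ennreal ((\<Sum>z\<in>F. B z) * \<bar>\<epsilon> ^ m\<bar>)"
      using K(2) eventually_net_index
    proof eventually_elim
      case (elim \<epsilon>)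
      from elim(2) F(3) obtain d N where "(d, N) \<in> F" "p \<epsilon> \<in> N" by blast
      then obtain z where z: "z \<in> F" "p \<epsilon> \<in> snd z" by (metis snd_conv)
      then have "rdist M h (p \<epsilon>) (q \<epsilon>) \<le> ennreal (B z * \<epsilon> ^ m)" using elim by blast
      also have "\<dots> \<le> ennreal ((\<Sum>z\<in>F. B z) * \<bar>\<epsilon> ^ m\<bar>)"
      proof (rule ennreal_leI)
        have "B z \<le> (\<Sum>z\<in>F. B z)" by (rule member_le_sum[OF z(1) _ F(1)]) (use B(1) in blast)
        then show "B z * \<epsilon> ^ m \<le> (\<Sum>z\<in>F. B z) * \<bar>\<epsilon> ^ m\<bar>"
          using elim(3) by (simp add: mult_right_mono)
      qed
      finally show ?case .
    qed
    then show "ebigo (\<lambda>\<epsilon>. rdist M h (p \<epsilon>) (q \<epsilon>)) (\<lambda>\<epsilon>. \<epsilon> ^ m)" unfolding ebigo_def by blast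
  qed
qed

end

section \<open>Existence of Riemannian metrics\<close>

lemma locally_finite_in_compactin:
  assumes W: "locally_finite_in T \<W>" and K: "compactin T K"
  shows "finite {W \<in> \<W>. W \<inter> K \<noteq> {}}"
proof -
  have "\<forall>x\<in>K. \<exists>V. openin T V \<and> x \<in> V \<and> finite {U \<in> \<W>. U \<inter> V \<noteq> {}}"
    using W compactin_subset_topspace[OF K] unfolding locally_finite_in_def by blast
  from bchoice[OF this] obtain V where V: "\<And>x. x \<in> K \<Longrightarrow> openin T (V x)" "\<And>x. x \<in> K \<Longrightarrow> x \<in> V x"
    "\<And>x. x \<in> K \<Longrightarrow> finite {U \<in> \<W>. U \<inter> V x \<noteq> {}}"
    by blast
  have "\<exists>\<F>. finite \<F> \<and> \<F> \<subseteq> V ` K \<and> K \<subseteq> \<Union>\<F>"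
    using compactinD[OF K, of "V ` K"] V(1,2) by blast
  then obtain F where F: "finite F" "F \<subseteq> K" "K \<subseteq> \<Union>(V ` F)"
    by (metis finite_subset_image)
  have "{W \<in> \<W>. W \<inter> K \<noteq> {}} \<subseteq> (\<Union>x\<in>F. {U \<in> \<W>. U \<inter> V x \<noteq> {}})"
    using F(3) by blast
  moreover have "finite (\<Union>x\<in>F. {U \<in> \<W>. U \<inter> V x \<noteq> {}})"
    using F V(3) by blast
  ultimately show ?thesis by (rule finite_subset)
qed

context smooth_mfd
begin

text \<open>A function together with a chart that is used to build its support. Smoothness is required in this
  chart only, which is enough for the bump metrics below to be smooth in all charts. The set \<open>V\<close>
  controls the supports when bumps are chosen.\<close>

definition bump_in :: "'a set \<Rightarrow> ('a, 'e) chart \<times> ('a \<Rightarrow> real) \<Rightarrow> bool" where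
  "bump_in V i \<longleftrightarrow> fst i \<in> charts M \<and> (\<forall>q. snd i q \<ge> 0) \<and>
     smooth_on (snd (fst i) ` fst (fst i)) (snd i \<circ> chart_inv (fst i)) \<and>
     openin (mtop M) {q. snd i q > 0} \<and>
     (\<exists>K. compactin (mtop M) K \<and> K \<subseteq> V \<and> K \<subseteq> fst (fst i) \<and> {q. snd i q > 0} \<subseteq> K)"

lemma bump_exists:
  assumes V: "openin (mtop M) V" and p: "p \<in> V"
  obtains i where "bump_in V i" "snd i p > 0"
proof -
  have "p \<in> topspace (mtop M)" using V p openin_subset by blast
  then obtain c where c: "c \<in> charts M" "p \<in> fst c" using topspace_eq by auto
  have "open (snd c ` (V \<inter> fst c))" using chart_open_image_of_openin[OF c(1) V] .
  moreover have "snd c p \<in> snd c ` (V \<inter> fst c)" using p c by blast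
  ultimately obtain r where r: "r > 0" "cball (snd c p) r \<subseteq> snd c ` (V \<inter> fst c)"
    using open_contains_cball by blast
  obtain \<beta> where \<beta>: "smooth_on UNIV \<beta>" "\<And>x. \<beta> x \<ge> (0::real)" "\<And>x. \<beta> x > 0 \<longleftrightarrow> x \<in> ball (snd c p) r"
    using bump_function_exists[OF r(1), of "snd c p"] by metis
  define b where "b = (\<lambda>q. if q \<in> fst c then \<beta> (snd c q) else 0)"
  let ?K = "chart_inv c ` cball (snd c p) r"
  have sub: "cball (snd c p) r \<subseteq> snd c ` fst c" using r(2) by blast
  have K: "compactin (mtop M) ?K" by (rule chart_inv_compactin[OF c(1) compact_cball sub])
  have KV: "?K \<subseteq> V \<inter> fst c"
  proof
    fix q assume "q \<in> ?K"
    then obtain q' where "q' \<in> V \<inter> fst c" "q = chart_inv c (snd c q')" using r(2) by blast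
    then show "q \<in> V \<inter> fst c" using chart_inv_left[OF c(1)] by simp
  qed
  have pos: "{q. b q > 0} = {q \<in> fst c. snd c q \<in> ball (snd c p) r}"
    using \<beta>(3) by (auto simp: b_def)
  have "{q. b q > 0} \<subseteq> ?K"
  proof
    fix q assume "q \<in> {q. b q > 0}"
    then have "q \<in> fst c" "snd c q \<in> cball (snd c p) r" unfolding pos by auto
    then show "q \<in> ?K" using chart_inv_left[OF c(1), of q] by (metis imageI)
  qed
  moreover have "openin (mtop M) {q. b q > 0}"
    unfolding pos by (rule chart_openin_preimage[OF c(1) open_ball])
  moreover have "smooth_on (snd c ` fst c) (b \<circ> chart_inv c)"
  proof (rule smooth_on_cong)
    show "smooth_on (snd c ` fst c) \<beta>"
      by (rule smooth_on_subset[OF \<beta>(1) chart_open_image[OF c(1)] subset_UNIV])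
    show "\<beta> x = (b \<circ> chart_inv c) x" if "x \<in> snd c ` fst c" for x
      using chart_inv_in[OF c(1) that] chart_inv_right[OF c(1) that] by (simp add: b_def)
  qed
  moreover have "\<forall>q. b q \<ge> 0" using \<beta>(2) by (simp add: b_def)
  ultimately have "bump_in V (c, b)"
    unfolding bump_in_def using c(1) K KV by auto
  moreover have "b p > 0" using \<beta>(3) c(2) r(1) by (simp add: b_def)
  ultimately show thesis by (intro that[of "(c, b)"]) auto
qed

lemma bump_in_mono:
  assumes i: "bump_in V i" and V: "V \<subseteq> V'"
  shows "bump_in V' i"
proof -
  obtain K where K: "compactin (mtop M) K" "K \<subseteq> V" "K \<subseteq> fst (fst i)" "{q. snd i q > 0} \<subseteq> K"
    using i unfolding bump_in_def by blast
  then have "K \<subseteq> V'" using V by blast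
  with K i show ?thesis unfolding bump_in_def by blast
qed

lemma bump_compact_cover:
  assumes V: "openin (mtop M) V" and K: "compactin (mtop M) K" "K \<subseteq> V"
  obtains B where "finite B" "\<And>i. i \<in> B \<Longrightarrow> bump_in V i" "\<And>p. p \<in> K \<Longrightarrow> \<exists>i\<in>B. snd i p > 0"
proof -
  have "\<forall>p\<in>K. \<exists>i. bump_in V i \<and> snd i p > 0"
    using bump_exists[OF V] K(2) by (metis subsetD)
  from bchoice[OF this] obtain f where f: "\<And>p. p \<in> K \<Longrightarrow> bump_in V (f p)" "\<And>p. p \<in> K \<Longrightarrow> snd (f p) p > 0"
    by blast
  let ?U = "\<lambda>p. {q. snd (f p) q > 0}"
  have op: "openin (mtop M) (?U p)" if "p \<in> K" for p using f(1)[OF that] by (simp add: bump_in_def)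
  have "\<exists>\<F>. finite \<F> \<and> \<F> \<subseteq> ?U ` K \<and> K \<subseteq> \<Union>\<F>"
  proof (rule compactinD[OF K(1)])
    show "openin (mtop M) U" if "U \<in> ?U ` K" for U using that op by blast
    show "K \<subseteq> \<Union>(?U ` K)" using f(2) by blast
  qed
  then obtain \<F> where \<F>: "finite \<F>" "\<F> \<subseteq> ?U ` K" "K \<subseteq> \<Union>\<F>" by blast
  obtain F where F': "F \<subseteq> K" "finite F" "\<F> = ?U ` F"
    using finite_subset_image[OF \<F>(1,2)] by blast
  have cov: "K \<subseteq> \<Union>(?U ` F)" using \<F>(3) unfolding F'(3) .
  note F = F'(2) F'(1) cov
  show thesis
  proof (rule that[of "f ` F"])
    show "finite (f ` F)" using F(1) by (rule finite_imageI)
    show "bump_in V i" if "i \<in> f ` F" for i using that F(2) f(1) by blast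
    show "\<exists>i\<in>f ` F. snd i p > 0" if "p \<in> K" for p using that F(3) by blast
  qed
qed

lemma paracompact_refinement:
  assumes "\<And>U. U \<in> \<U> \<Longrightarrow> openin (mtop M) U" "\<Union>\<U> = topspace (mtop M)"
  obtains \<V> where "\<And>V. V \<in> \<V> \<Longrightarrow> openin (mtop M) V" "\<Union>\<V> = topspace (mtop M)"
    "\<And>V. V \<in> \<V> \<Longrightarrow> \<exists>U\<in>\<U>. V \<subseteq> U" "locally_finite_in (mtop M) \<V>"
proof -
  have "(\<forall>U\<in>\<U>. openin (mtop M) U) \<and> \<Union>\<U> = topspace (mtop M)" using assms by blast
  from mp[OF spec[OF paracompact[unfolded paracompact_def]] this]
  obtain \<V> where "(\<forall>V\<in>\<V>. openin (mtop M) V) \<and> \<Union>\<V> = topspace (mtop M) \<and>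
      (\<forall>V\<in>\<V>. \<exists>U\<in>\<U>. V \<subseteq> U) \<and> locally_finite_in (mtop M) \<V>" ..
  then show thesis by (intro that[of \<V>]) simp_all
qed

text \<open>Two locally finite refinements are needed. The members of the first one, \<open>\<V>\<close>, are relatively
  compact; the members of the second one have compact neighbourhoods inside members of \<open>\<V>\<close>, on
  which finitely many bumps suffice, so that supports inherit local finiteness from \<open>\<V>\<close>.\<close>

lemma locally_finite_bumps:
  obtains I where "\<And>i. i \<in> I \<Longrightarrow> bump_in (topspace (mtop M)) i"
    "\<And>p. p \<in> topspace (mtop M) \<Longrightarrow> \<exists>i\<in>I. snd i p > 0"
    "\<And>p. p \<in> topspace (mtop M) \<Longrightarrow>
      \<exists>N. openin (mtop M) N \<and> p \<in> N \<and> finite {i \<in> I. \<exists>q\<in>N. snd i q > 0}"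
proof -
  let ?T = "mtop M"
  have nbhd: "\<exists>W K. openin ?T W \<and> p \<in> W \<and> compactin ?T K \<and> W \<subseteq> K \<and> K \<subseteq> V"
    if "openin ?T V" "p \<in> V" for V p
    using bump_exists[OF that] unfolding bump_in_def by (metis mem_Collect_eq)
  define \<U>1 where "\<U>1 = {U. openin ?T U \<and> (\<exists>K. compactin ?T K \<and> U \<subseteq> K)}"
  have "\<Union>\<U>1 = topspace ?T"
  proof
    show "\<Union>\<U>1 \<subseteq> topspace ?T" using openin_subset by (auto simp: \<U>1_def)
    show "topspace ?T \<subseteq> \<Union>\<U>1" using nbhd[OF openin_topspace] by (fastforce simp: \<U>1_def)
  qed
  moreover have "\<And>U. U \<in> \<U>1 \<Longrightarrow> openin ?T U" by (simp add: \<U>1_def)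
  ultimately obtain \<V> where V: "\<And>V. V \<in> \<V> \<Longrightarrow> openin ?T V" "\<Union>\<V> = topspace ?T"
    "\<And>V. V \<in> \<V> \<Longrightarrow> \<exists>U\<in>\<U>1. V \<subseteq> U" "locally_finite_in ?T \<V>"
    using paracompact_refinement[of \<U>1] by metis
  have Vcomp: "\<exists>K. compactin ?T K \<and> V \<subseteq> K" if "V \<in> \<V>" for V
    using V(3)[OF that] unfolding \<U>1_def by blast
  define \<U>2 where "\<U>2 = {W. openin ?T W \<and> (\<exists>V\<in>\<V>. \<exists>K. compactin ?T K \<and> W \<subseteq> K \<and> K \<subseteq> V)}"
  have "\<Union>\<U>2 = topspace ?T"
  proof
    show "\<Union>\<U>2 \<subseteq> topspace ?T" using openin_subset by (auto simp: \<U>2_def)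
    show "topspace ?T \<subseteq> \<Union>\<U>2"
    proof
      fix p assume "p \<in> topspace ?T"
      then obtain V' where "V' \<in> \<V>" "p \<in> V'" using V(2) by blast
      moreover from this V(1)[of V'] nbhd[of V' p] obtain W K where
        "openin ?T W" "p \<in> W" "compactin ?T K" "W \<subseteq> K" "K \<subseteq> V'" by blast
      ultimately show "p \<in> \<Union>\<U>2" unfolding \<U>2_def by blast
    qed
  qed
  moreover have "\<And>U. U \<in> \<U>2 \<Longrightarrow> openin ?T U" by (simp add: \<U>2_def)
  ultimately obtain \<W> where W: "\<And>V. V \<in> \<W> \<Longrightarrow> openin ?T V" "\<Union>\<W> = topspace ?T"
    "\<And>V. V \<in> \<W> \<Longrightarrow> \<exists>U\<in>\<U>2. V \<subseteq> U" "locally_finite_in ?T \<W>"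
    using paracompact_refinement[of \<U>2] by metis
  have "\<forall>W\<in>\<W>. \<exists>V B. V \<in> \<V> \<and> W \<subseteq> V \<and> finite B \<and> (\<forall>i\<in>B. bump_in V i) \<and> (\<forall>p\<in>W. \<exists>i\<in>B. snd i p > 0)"
  proof
    fix W' assume "W' \<in> \<W>"
    then obtain V' K where VK: "V' \<in> \<V>" "compactin ?T K" "W' \<subseteq> K" "K \<subseteq> V'"
      using W(3)[of W'] unfolding \<U>2_def by blast
    obtain B where B: "finite B" "\<And>i. i \<in> B \<Longrightarrow> bump_in V' i" "\<And>p. p \<in> K \<Longrightarrow> \<exists>i\<in>B. snd i p > 0"
      using bump_compact_cover[OF V(1)[OF VK(1)] VK(2,4)] by metis
    have "W' \<subseteq> V'" using VK by blast
    moreover have "\<forall>p\<in>W'. \<exists>i\<in>B. snd i p > 0" using B(3) VK(3) by blast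
    ultimately show "\<exists>V B. V \<in> \<V> \<and> W' \<subseteq> V \<and> finite B \<and> (\<forall>i\<in>B. bump_in V i) \<and> (\<forall>p\<in>W'. \<exists>i\<in>B. snd i p > 0)"
      using VK(1) B(1,2) by blast
  qed
  from bchoice[OF this] obtain VW where "\<forall>W\<in>\<W>. \<exists>B. VW W \<in> \<V> \<and> W \<subseteq> VW W \<and> finite B \<and>
      (\<forall>i\<in>B. bump_in (VW W) i) \<and> (\<forall>p\<in>W. \<exists>i\<in>B. snd i p > 0)" ..
  from bchoice[OF this] obtain B where B: "\<forall>W\<in>\<W>. VW W \<in> \<V> \<and> W \<subseteq> VW W \<and> finite (B W) \<and>
      (\<forall>i\<in>B W. bump_in (VW W) i) \<and> (\<forall>p\<in>W. \<exists>i\<in>B W. snd i p > 0)" ..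
  note VB = bspec[OF B]
  define I where "I = (\<Union>W\<in>\<W>. B W)"
  show thesis
  proof (rule that[of I])
    fix i assume "i \<in> I"
    then obtain W' where "W' \<in> \<W>" "i \<in> B W'" by (auto simp: I_def)
    then have "bump_in (VW W') i" "VW W' \<subseteq> topspace ?T" using VB[of W'] V(2) by blast+
    then show "bump_in (topspace ?T) i" by (rule bump_in_mono)
  next
    fix p assume "p \<in> topspace ?T"
    then obtain W' where "W' \<in> \<W>" "p \<in> W'" using W(2) by blast
    then obtain i where "i \<in> B W'" "snd i p > 0" using VB[of W'] by blast
    then show "\<exists>i\<in>I. snd i p > 0" using \<open>W' \<in> \<W>\<close> unfolding I_def by blast
  next
    fix p assume "p \<in> topspace ?T"
    then obtain N where N: "openin ?T N" "p \<in> N" "finite {V \<in> \<V>. V \<inter> N \<noteq> {}}"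
      using V(4) unfolding locally_finite_in_def by blast
    define S where "S = (\<Union>V\<in>{V \<in> \<V>. V \<inter> N \<noteq> {}}. {W \<in> \<W>. W \<subseteq> V})"
    have "finite {W \<in> \<W>. W \<subseteq> V'}" if V': "V' \<in> \<V>" for V'
    proof -
      obtain K where K: "compactin ?T K" "V' \<subseteq> K" using Vcomp[OF V'] by blast
      have "{W \<in> \<W>. W \<subseteq> V'} \<subseteq> insert {} {W \<in> \<W>. W \<inter> K \<noteq> {}}" using K(2) by blast
      then show ?thesis using locally_finite_in_compactin[OF W(4) K(1)]
        by (meson finite_insert finite_subset)
    qed
    then have "finite S" unfolding S_def using N(3) by blast
    moreover have "S \<subseteq> \<W>" by (auto simp: S_def)
    ultimately have fin: "finite (\<Union>W\<in>S. B W)" using VB by blast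
    have "{i \<in> I. \<exists>q\<in>N. snd i q > 0} \<subseteq> (\<Union>W\<in>S. B W)"
    proof
      fix i assume "i \<in> {i \<in> I. \<exists>q\<in>N. snd i q > 0}"
      then obtain W' q where iW: "W' \<in> \<W>" "i \<in> B W'" "q \<in> N" "snd i q > 0" by (auto simp: I_def)
      then have "bump_in (VW W') i" using VB by blast
      then have "q \<in> VW W'" using iW(4) unfolding bump_in_def by blast
      then have "W' \<in> S" unfolding S_def using iW VB[of W'] by blast
      then show "i \<in> (\<Union>W\<in>S. B W)" using iW by blast
    qed
    then have "finite {i \<in> I. \<exists>q\<in>N. snd i q > 0}" using fin by (rule finite_subset)
    with N show "\<exists>N. openin ?T N \<and> p \<in> N \<and> finite {i \<in> I. \<exists>q\<in>N. snd i q > 0}" by blast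
  qed
qed

abbreviation transition_deriv :: "('a, 'e) chart \<Rightarrow> ('a, 'e) chart \<Rightarrow> 'a \<Rightarrow> 'e \<Rightarrow> 'e" where
  "transition_deriv c d p \<equiv> frechet_derivative (snd d \<circ> chart_inv c) (at (snd c p))"

lemma transition_has_derivative:
  assumes "c \<in> charts M" "d \<in> charts M" "p \<in> fst c" "p \<in> fst d"
  shows "((snd d \<circ> chart_inv c) has_derivative transition_deriv c d p) (at (snd c p))"
proof -
  have "snd c p \<in> snd c ` (fst c \<inter> fst d)" using assms(3,4) by simp
  then show ?thesis by (rule smooth_on_has_derivative[OF transition_smooth[OF assms(1,2)]])
qed

lemma transition_deriv_linear:
  assumes "c \<in> charts M" "d \<in> charts M" "p \<in> fst c" "p \<in> fst d"
  shows "linear (transition_deriv c d p)"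
  using transition_has_derivative[OF assms] by (rule has_derivative_linear)

text \<open>By this chain rule, pulling back one fixed inner product along \<open>transition_deriv d e p\<close>, for varying
  \<open>d\<close>, obeys the transformation law of metrics.\<close>

lemma transition_deriv_chain:
  assumes c: "c \<in> charts M" "p \<in> fst c" and d: "d \<in> charts M" "p \<in> fst d"
    and e: "e \<in> charts M" "p \<in> fst e"
  shows "transition_deriv c e p a = transition_deriv d e p (transition_deriv c d p a)"
proof -
  have cd: "((snd d \<circ> chart_inv c) has_derivative transition_deriv c d p) (at (snd c p))"
    by (rule transition_has_derivative[OF c(1) d(1) c(2) d(2)])
  have "((snd e \<circ> chart_inv d) has_derivative transition_deriv d e p) (at (snd d p))"
    by (rule transition_has_derivative[OF d(1) e(1) d(2) e(2)])
  then have de: "((snd e \<circ> chart_inv d) has_derivative transition_deriv d e p) (at ((snd d \<circ> chart_inv c) (snd c p)))"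
    using chart_inv_left[OF c] by simp
  have op: "open (snd c ` (fst c \<inter> fst d))" using smooth_on_open[OF transition_smooth[OF c(1) d(1)]] .
  have mem: "snd c p \<in> snd c ` (fst c \<inter> fst d)" using c d by blast
  have "((snd e \<circ> chart_inv c) has_derivative (transition_deriv d e p \<circ> transition_deriv c d p)) (at (snd c p))"
    by (rule has_derivative_transform_within_open[OF diff_chain_at[OF cd de] op mem])
      (use chart_inv_left[OF c(1)] chart_inv_left[OF d(1)] in auto)
  then show ?thesis by (simp add: frechet_derivative_eqI)
qed

lemma transition_deriv_self:
  assumes c: "c \<in> charts M" "p \<in> fst c"
  shows "transition_deriv c c p a = a"
proof -
  have "transition_deriv c c p = frechet_derivative (\<lambda>x. x) (at (snd c p))"
    by (rule frechet_derivative_cong_open[OF chart_open_image[OF c(1)]])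
      (use c chart_inv_right[OF c(1)] in auto)
  then show ?thesis by simp
qed

lemma transition_deriv_nonzero:
  assumes c: "c \<in> charts M" "p \<in> fst c" and d: "d \<in> charts M" "p \<in> fst d" and a: "a \<noteq> 0"
  shows "transition_deriv c d p a \<noteq> 0"
proof
  assume "transition_deriv c d p a = 0"
  then have "transition_deriv c c p a = transition_deriv d c p 0"
    using transition_deriv_chain[OF c d c] by simp
  also have "\<dots> = 0" using transition_deriv_linear[OF d(1) c(1) d(2) c(2)] by (rule linear_0)
  finally show False using transition_deriv_self[OF c] a by simp
qed

text \<open>The Euclidean metric of the chart \<open>fst i\<close>, expressed in the chart \<open>d\<close> and cut off by the bump
  \<open>snd i\<close>. Outside the domain of \<open>fst i\<close> the derivative is meaningless but the bump vanishes.\<close>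

definition bump_metric :: "('a, 'e) chart \<times> ('a \<Rightarrow> real) \<Rightarrow> ('a, 'e) metric_rep" where
  "bump_metric i d p a b =
    snd i p * (transition_deriv d (fst i) p a \<bullet> transition_deriv d (fst i) p b)"

text \<open>In the domain of the chart of the bump this is a product of smooth functions; outside the support
  of the bump it vanishes. These two open sets cover everything since the support is compact, hence
  closed.\<close>

lemma bump_metric_smooth:
  assumes i: "bump_in V i" and d: "d \<in> charts M"
  shows "smooth_on (snd d ` fst d) (\<lambda>x. bump_metric i d (chart_inv d x) a b)"
proof (rule smooth_on_local)
  fix x assume x: "x \<in> snd d ` fst d"
  let ?c = "fst i" and ?b = "snd i"
  have c: "?c \<in> charts M" and b: "smooth_on (snd ?c ` fst ?c) (?b \<circ> chart_inv ?c)" "\<forall>q. ?b q \<ge> 0"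
    using i by (auto simp: bump_in_def)
  obtain K where K: "compactin (mtop M) K" "K \<subseteq> fst ?c" "{q. ?b q > 0} \<subseteq> K"
    using i by (auto simp: bump_in_def)
  show "\<exists>U. x \<in> U \<and> U \<subseteq> snd d ` fst d \<and> smooth_on U (\<lambda>x. bump_metric i d (chart_inv d x) a b)"
  proof (cases "chart_inv d x \<in> K")
    case True
    let ?U = "snd d ` (fst d \<inter> fst ?c)"
    have tr: "smooth_on ?U (snd ?c \<circ> chart_inv d)" by (rule transition_smooth[OF d c])
    have inv: "chart_inv d y \<in> fst d \<inter> fst ?c \<and> snd d (chart_inv d y) = y" if "y \<in> ?U" for y
      using that chart_inv_left[OF d] by auto
    have "smooth_on ?U (\<lambda>y. (?b \<circ> chart_inv ?c) ((snd ?c \<circ> chart_inv d) y))"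
      by (rule smooth_on_compose[OF tr b(1)]) (use inv in auto)
    moreover have "smooth_on ?U (\<lambda>y. frechet_derivative (snd ?c \<circ> chart_inv d) (at y) a \<bullet>
        frechet_derivative (snd ?c \<circ> chart_inv d) (at y) b)"
      by (intro smooth_on_bilinear[OF bounded_bilinear_inner] smooth_on_frechet_derivative tr)
    ultimately have "smooth_on ?U (\<lambda>y. (?b \<circ> chart_inv ?c) ((snd ?c \<circ> chart_inv d) y) *
        (frechet_derivative (snd ?c \<circ> chart_inv d) (at y) a \<bullet>
        frechet_derivative (snd ?c \<circ> chart_inv d) (at y) b))"
      by (rule smooth_on_bilinear[OF bounded_bilinear_mult])
    then have "smooth_on ?U (\<lambda>x. bump_metric i d (chart_inv d x) a b)"
    proof (rule smooth_on_cong)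
      fix y assume y: "y \<in> ?U"
      then have "chart_inv ?c (snd ?c (chart_inv d y)) = chart_inv d y"
        using inv chart_inv_left[OF c] by blast
      then show "(?b \<circ> chart_inv ?c) ((snd ?c \<circ> chart_inv d) y) *
        (frechet_derivative (snd ?c \<circ> chart_inv d) (at y) a \<bullet>
        frechet_derivative (snd ?c \<circ> chart_inv d) (at y) b) = bump_metric i d (chart_inv d y) a b"
        using inv[OF y] by (simp add: bump_metric_def)
    qed
    moreover have "x \<in> ?U"
    proof -
      have "chart_inv d x \<in> fst d \<inter> fst ?c" using True K(2) chart_inv_in[OF d x] by blast
      then have "snd d (chart_inv d x) \<in> ?U" by (rule imageI)
      then show ?thesis by (simp only: chart_inv_right[OF d x])
    qed
    moreover have "?U \<subseteq> snd d ` fst d" by (rule image_mono[OF Int_lower1])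
    ultimately show ?thesis by (intro exI[of _ ?U] conjI)
  next
    case False
    let ?O = "topspace (mtop M) - K"
    let ?U = "snd d ` (?O \<inter> fst d)"
    have "openin (mtop M) ?O" using compactin_closedin[OF K(1)] by blast
    then have op: "open ?U" by (rule chart_open_image_of_openin[OF d])
    have "smooth_on ?U (\<lambda>x. bump_metric i d (chart_inv d x) a b)"
    proof (rule smooth_on_cong[OF smooth_on_const[OF op]])
      fix y assume "y \<in> ?U"
      then have "chart_inv d y \<notin> K" using chart_inv_left[OF d] by auto
      then have "\<not> ?b (chart_inv d y) > 0" using K(3) by blast
      moreover have "?b (chart_inv d y) \<ge> 0" using b(2) by blast
      ultimately have "?b (chart_inv d y) = 0" by linarith
      then show "0 = bump_metric i d (chart_inv d y) a b" by (simp add: bump_metric_def)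
    qed
    moreover have "x \<in> ?U"
    proof -
      have "chart_inv d x \<in> ?O \<inter> fst d" using False chart_inv_in[OF d x] chart_subset[OF d] by blast
      then have "snd d (chart_inv d x) \<in> ?U" by (rule imageI)
      then show ?thesis by (simp only: chart_inv_right[OF d x])
    qed
    moreover have "?U \<subseteq> snd d ` fst d" by (rule image_mono[OF Int_lower2])
    ultimately show ?thesis by (intro exI[of _ ?U] conjI)
  qed
qed

lemma bilinear_bump_metric:
  assumes i: "bump_in V i" "snd i p > 0" and d: "d \<in> charts M" "p \<in> fst d"
  shows "bilinear (bump_metric i d p)"
proof -
  have "fst i \<in> charts M" "p \<in> fst (fst i)" using i by (auto simp: bump_in_def)
  then have lin: "linear (transition_deriv d (fst i) p)"
    using transition_deriv_linear d by blast
  show ?thesis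
    unfolding bilinear_def bump_metric_def
    by (intro conjI allI linearI)
      (simp_all add: linear_add[OF lin] linear_cmul[OF lin] inner_add_left inner_add_right algebra_simps)
qed

text \<open>The sum of the bump metrics of a locally finite family is positive definite because each point has
  a positive summand and transition derivatives are injective.\<close>

theorem riemannian_metric_exists: "\<exists>h. riemannian_metric M h"
proof -
  obtain I where I: "\<And>i. i \<in> I \<Longrightarrow> bump_in (topspace (mtop M)) i"
    "\<And>p. p \<in> topspace (mtop M) \<Longrightarrow> \<exists>i\<in>I. snd i p > 0"
    "\<And>p. p \<in> topspace (mtop M) \<Longrightarrow>
      \<exists>N. openin (mtop M) N \<and> p \<in> N \<and> finite {i \<in> I. \<exists>q\<in>N. snd i q > 0}"
    using locally_finite_bumps by blast
  define A where "A = (\<lambda>p. {i \<in> I. snd i p > 0})"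
  have finA: "finite (A p)" if p: "p \<in> topspace (mtop M)" for p
  proof -
    obtain N where N: "p \<in> N" "finite {i \<in> I. \<exists>q\<in>N. snd i q > 0}" using I(3)[OF p] by blast
    have "A p \<subseteq> {i \<in> I. \<exists>q\<in>N. snd i q > 0}" using N(1) by (auto simp: A_def)
    then show ?thesis using N(2) by (rule finite_subset)
  qed
  define h where "h = (\<lambda>d p a b. \<Sum>i\<in>A p. bump_metric i d p a b)"
  have top: "p \<in> topspace (mtop M)" if "d \<in> charts M" "p \<in> fst d" for d p
    using chart_subset that by blast
  have Ac: "fst i \<in> charts M \<and> p \<in> fst (fst i)" if "i \<in> A p" for i p
  proof -
    have "bump_in (topspace (mtop M)) i" "snd i p > 0" using that I(1) by (auto simp: A_def)
    then show ?thesis by (auto simp: bump_in_def)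
  qed
  have bil: "bilinear (h d p)" if d: "d \<in> charts M" "p \<in> fst d" for d p
  proof -
    have bi: "bilinear (bump_metric i d p)" if "i \<in> A p" for i
      using that by (intro bilinear_bump_metric[OF I(1)] d) (auto simp: A_def)
    show ?thesis
      unfolding bilinear_def h_def
      by (intro conjI allI linearI)
        (simp_all add: bilinear_ladd bilinear_radd bilinear_lmul bilinear_rmul bi sum.distrib
          sum_distrib_left cong: sum.cong)
  qed
  have symm: "h d p a b = h d p b a" for d p a b
    by (simp add: h_def bump_metric_def inner_commute)
  have pos: "h d p a a > 0" if d: "d \<in> charts M" "p \<in> fst d" and a: "a \<noteq> 0" for d p a
  proof -
    obtain i where "i \<in> I" "snd i p > 0" using I(2)[OF top[OF d]] by blast
    then have "i \<in> A p" by (simp add: A_def)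
    show ?thesis
      unfolding h_def
    proof (rule sum_pos[OF finA[OF top[OF d]]])
      show "A p \<noteq> {}" using \<open>i \<in> A p\<close> by blast
      fix j assume j: "j \<in> A p"
      have "transition_deriv d (fst j) p a \<noteq> 0"
        using transition_deriv_nonzero[OF d _ _ a] Ac[OF j] by blast
      then show "bump_metric j d p a a > 0"
        using j by (simp add: bump_metric_def A_def)
    qed
  qed
  have smooth: "smooth_on (snd d ` fst d) (\<lambda>x. h d (chart_inv d x) a b)" if d: "d \<in> charts M" for d a b
  proof (rule smooth_on_local)
    fix x assume x: "x \<in> snd d ` fst d"
    let ?p = "chart_inv d x"
    have p: "?p \<in> fst d" by (rule chart_inv_in[OF d x])
    obtain N where N: "openin (mtop M) N" "?p \<in> N" "finite {i \<in> I. \<exists>q\<in>N. snd i q > 0}"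
      using I(3)[OF top[OF d p]] by blast
    let ?J = "{i \<in> I. \<exists>q\<in>N. snd i q > 0}"
    let ?U = "snd d ` (N \<inter> fst d)"
    have op: "open ?U" by (rule chart_open_image_of_openin[OF d N(1)])
    have U: "?U \<subseteq> snd d ` fst d" by blast
    have "smooth_on ?U (\<lambda>x. \<Sum>i\<in>?J. bump_metric i d (chart_inv d x) a b)"
    proof (rule smooth_on_sum[OF op N(3)])
      fix i assume "i \<in> ?J"
      then have "bump_in (topspace (mtop M)) i" using I(1) by blast
      from smooth_on_subset[OF bump_metric_smooth[OF this d] op U]
      show "smooth_on ?U (\<lambda>x. bump_metric i d (chart_inv d x) a b)" .
    qed
    then have "smooth_on ?U (\<lambda>x. h d (chart_inv d x) a b)"
    proof (rule smooth_on_cong)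
      fix y assume "y \<in> ?U"
      then have q: "chart_inv d y \<in> N" using chart_inv_left[OF d] by auto
      show "(\<Sum>i\<in>?J. bump_metric i d (chart_inv d y) a b) = h d (chart_inv d y) a b"
        unfolding h_def
      proof (rule sum.mono_neutral_right[OF N(3)])
        show "A (chart_inv d y) \<subseteq> ?J" using q by (auto simp: A_def)
        show "\<forall>i\<in>?J - A (chart_inv d y). bump_metric i d (chart_inv d y) a b = 0"
        proof
          fix i assume i: "i \<in> ?J - A (chart_inv d y)"
          then have "\<not> snd i (chart_inv d y) > 0" by (auto simp: A_def)
          moreover have "snd i (chart_inv d y) \<ge> 0" using i I(1) by (auto simp: bump_in_def)
          ultimately show "bump_metric i d (chart_inv d y) a b = 0" by (simp add: bump_metric_def)
        qed
      qed
    qed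
    moreover have "x \<in> ?U"
    proof -
      have "?p \<in> N \<inter> fst d" using N(2) p by blast
      then have "snd d (chart_inv d x) \<in> ?U" by (rule imageI)
      then show ?thesis by (simp only: chart_inv_right[OF d x])
    qed
    ultimately show "\<exists>U. x \<in> U \<and> U \<subseteq> snd d ` fst d \<and> smooth_on U (\<lambda>x. h d (chart_inv d x) a b)"
      using U by (intro exI[of _ ?U] conjI)
  qed
  have trans: "h c p a b = h d p (transition_deriv c d p a) (transition_deriv c d p b)"
    if c: "c \<in> charts M" "p \<in> fst c" and d: "d \<in> charts M" "p \<in> fst d" for c d p a b
    unfolding h_def
  proof (rule sum.cong[OF refl])
    fix i assume "i \<in> A p"
    from Ac[OF this] have "fst i \<in> charts M" "p \<in> fst (fst i)" by simp_all
    from transition_deriv_chain[OF c d this]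
    show "bump_metric i c p a b = bump_metric i d p (transition_deriv c d p a) (transition_deriv c d p b)"
      by (simp add: bump_metric_def)
  qed
  have "riemannian_metric M h"
    unfolding riemannian_metric_def Let_def
  proof (intro conjI ballI allI impI)
    show "bilinear (h c p)" "h c p a b = h c p b a" if "c \<in> charts M" "p \<in> fst c" for c p a b
      using bil[OF that] symm by auto
    show "h c p a a > 0" if "c \<in> charts M" "p \<in> fst c" "a \<noteq> 0" for c p a
      by (rule pos[OF that])
    show "smooth_on (snd c ` fst c) (\<lambda>x. h c (chart_inv c x) a b)" if "c \<in> charts M" for c a b
      by (rule smooth[OF that])
    show "h c p a b = h d p (transition_deriv c d p a) (transition_deriv c d p b)"
      if "c \<in> charts M" "d \<in> charts M" "p \<in> fst c \<inter> fst d" for c d p a b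
      by (rule trans) (use that in auto)
  qed
  then show ?thesis by blast
qed

end

section \<open>Generalized points\<close>

context smooth_mfd
begin

lemma gen_point_rel_iff:
  "(p, q) \<in> gen_point_rel M \<longleftrightarrow> p \<in> cs_nets M \<and> q \<in> cs_nets M \<and> rapidly_close p q"
  using riemannian_metric_exists rdist_negligible_iff_rapidly_close
  unfolding gen_point_rel_def by blast

lemma equiv_gen_point_rel: "equiv (cs_nets M) (gen_point_rel M)"
proof (rule equivI)
  show "gen_point_rel M \<subseteq> cs_nets M \<times> cs_nets M" by (auto simp: gen_point_rel_iff)
  show "refl_on (cs_nets M) (gen_point_rel M)"
    by (rule refl_onI) (simp add: gen_point_rel_iff rapidly_close_refl)
  show "sym (gen_point_rel M)"
  proof (rule symI)
    fix p q assume pq: "(p, q) \<in> gen_point_rel M"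
    then obtain K where "compactin (mtop M) K" "\<forall>\<^sub>F \<epsilon> in at_right 0. p \<epsilon> \<in> K"
      using cs_nets_eventually_compact unfolding gen_point_rel_iff by metis
    with pq show "(q, p) \<in> gen_point_rel M"
      unfolding gen_point_rel_iff using rapidly_close_sym by blast
  qed
  show "trans (gen_point_rel M)"
    unfolding gen_point_rel_iff trans_def using rapidly_close_trans by blast
qed

lemma gen_point_class_eq_iff:
  assumes "p \<in> cs_nets M" "q \<in> cs_nets M"
  shows "gen_point_class M p = gen_point_class M q \<longleftrightarrow> rapidly_close p q"
  unfolding gen_point_class_def
  using eq_equiv_class_iff[OF equiv_gen_point_rel assms] assms by (simp add: gen_point_rel_iff)

end

section \<open>Moderate nets and their point values\<close>

locale smooth_mfd_pair = X: smooth_mfd X + Y: smooth_mfd Y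
  for X :: "('a, 'e::findim_inner) mfd" and Y :: "('b, 'f::findim_inner) mfd"
begin

lemma moderate_nets_smooth:
  assumes "u \<in> moderate_nets X Y" "\<epsilon> \<in> net_index"
  shows "continuous_map (mtop X) (mtop Y) (u \<epsilon>)"
    and "\<And>c d. c \<in> charts X \<Longrightarrow> d \<in> charts Y \<Longrightarrow>
      smooth_on (snd c ` (fst c \<inter> u \<epsilon> -` fst d)) (snd d \<circ> u \<epsilon> \<circ> chart_inv c)"
proof -
  have "u \<epsilon> \<in> smooth_maps X Y" using assms unfolding moderate_nets_def by blast
  then show "continuous_map (mtop X) (mtop Y) (u \<epsilon>)"
    and "\<And>c d. c \<in> charts X \<Longrightarrow> d \<in> charts Y \<Longrightarrow>
      smooth_on (snd c ` (fst c \<inter> u \<epsilon> -` fst d)) (snd d \<circ> u \<epsilon> \<circ> chart_inv c)"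
    unfolding smooth_maps_def by blast+
qed

lemma moderate_nets_cs_nets:
  assumes u: "u \<in> moderate_nets X Y" and p: "p \<in> cs_nets X"
  shows "(\<lambda>\<epsilon>. u \<epsilon> (p \<epsilon>)) \<in> cs_nets Y"
proof -
  obtain K e where K: "compactin (mtop X) K" "e > 0" "\<And>\<epsilon>. \<epsilon> \<in> net_index \<Longrightarrow> \<epsilon> < e \<Longrightarrow> p \<epsilon> \<in> K"
    and top: "\<And>\<epsilon>. \<epsilon> \<in> net_index \<Longrightarrow> p \<epsilon> \<in> topspace (mtop X)"
    using p unfolding cs_nets_def by blast
  have "\<exists>\<epsilon>\<^sub>0>0. \<exists>K'. compactin (mtop Y) K' \<and> (\<forall>\<epsilon>\<in>net_index. \<epsilon> < \<epsilon>\<^sub>0 \<longrightarrow> u \<epsilon> ` K \<subseteq> K')"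
    using u K(1) unfolding moderate_nets_def by blast
  then obtain e' K' where K': "e' > 0" "compactin (mtop Y) K'"
    "\<And>\<epsilon>. \<epsilon> \<in> net_index \<Longrightarrow> \<epsilon> < e' \<Longrightarrow> u \<epsilon> ` K \<subseteq> K'"
    by blast
  have "u \<epsilon> (p \<epsilon>) \<in> topspace (mtop Y)" if "\<epsilon> \<in> net_index" for \<epsilon>
    using moderate_nets_smooth(1)[OF u that] top[OF that] continuous_map_image_subset_topspace by blast
  moreover have "u \<epsilon> (p \<epsilon>) \<in> K'" if "\<epsilon> \<in> net_index" "\<epsilon> < min e e'" for \<epsilon>
  proof -
    have "p \<epsilon> \<in> K" "u \<epsilon> ` K \<subseteq> K'" using that K(3) K'(3) by auto
    then show ?thesis by blast
  qed
  moreover have "min e e' > 0" using K(2) K'(1) by simp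
  ultimately show ?thesis unfolding cs_nets_def using K'(2) by blast
qed

lemma deriv_norm_0: "deriv_norm 0 f x = ennreal (norm (f x))"
  unfolding deriv_norm_def by simp

text \<open>Uniform closeness puts both values into the same chart, where negligibility of the difference
  applies; finitely many charts of \<open>X\<close> suffice since \<open>p\<close> is compactly supported.\<close>

lemma net_equiv0_imp_rapidly_close:
  assumes uv: "net_equiv0 X Y u v" and p: "p \<in> cs_nets X"
  shows "Y.rapidly_close (\<lambda>\<epsilon>. u \<epsilon> (p \<epsilon>)) (\<lambda>\<epsilon>. v \<epsilon> (p \<epsilon>))"
  unfolding Y.rapidly_close_def
proof (intro ballI allI impI)
  fix d :: "('b, 'f) chart" and L' and m :: nat
  assume d: "d \<in> charts Y" and L': "compactin (mtop Y) L' \<and> L' \<subseteq> fst d"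
  obtain K where K: "compactin (mtop X) K" "\<forall>\<^sub>F \<epsilon> in at_right 0. p \<epsilon> \<in> K"
    using X.cs_nets_eventually_compact[OF p] .
  obtain F where F: "finite F"
    "\<And>c L. (c, L) \<in> F \<Longrightarrow> c \<in> charts X \<and> compactin (mtop X) L \<and> L \<subseteq> fst c"
    "K \<subseteq> (\<Union>(c, L)\<in>F. L)"
    using X.compact_chart_cover[OF K(1)] by metis
  obtain \<delta> L'' where L'': "\<delta> > 0" "compactin (mtop Y) L''" "L'' \<subseteq> fst d" "L' \<subseteq> L''"
    "\<And>p q. p \<in> L' \<Longrightarrow> q \<in> fst d \<Longrightarrow> dist (snd d q) (snd d p) \<le> \<delta> \<Longrightarrow> q \<in> L''"
    using Y.chart_thickening[OF d conjunct1[OF L'] conjunct2[OF L']] by metis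
  obtain h where h: "riemannian_metric Y h"
    "((\<lambda>\<epsilon>. SUP p\<in>K. rdist Y h (u \<epsilon> p) (v \<epsilon> p)) \<longlongrightarrow> 0) (at_right 0)"
    using uv K(1) unfolding net_equiv0_def uniformly_close_def by blast
  obtain \<eta> C where C: "\<eta> > 0" "C > 0"
    "\<And>p q r. p \<in> L' \<Longrightarrow> rdist Y h p q < ennreal r \<Longrightarrow> r \<le> \<eta> \<Longrightarrow>
      q \<in> fst d \<and> dist (snd d q) (snd d p) \<le> C * r"
    using Y.chart_dist_le_rdist[OF h(1) d conjunct1[OF L'] conjunct2[OF L']] by metis
  \<comment> \<open>At distance less than \<open>r\<close> from \<open>u \<epsilon> (p \<epsilon>)\<close>, the point \<open>v \<epsilon> (p \<epsilon>)\<close> is forced into \<open>L''\<close>.\<close>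
  define r where "r = min \<eta> (\<delta> / C)"
  have r: "r > 0" "r \<le> \<eta>" "C * r \<le> \<delta>"
    using C L''(1) by (auto simp: r_def min_def field_simps)
  have close: "\<forall>\<^sub>F \<epsilon> in at_right 0. (SUP p\<in>K. rdist Y h (u \<epsilon> p) (v \<epsilon> p)) < ennreal r"
    by (rule order_tendstoD(2)[OF h(2)]) (use r(1) in simp)
  have bound: "\<forall>\<^sub>F \<epsilon> in at_right 0. p \<epsilon> \<in> snd z \<longrightarrow> u \<epsilon> (p \<epsilon>) \<in> L'' \<longrightarrow> v \<epsilon> (p \<epsilon>) \<in> L'' \<longrightarrow>
      dist (snd d (v \<epsilon> (p \<epsilon>))) (snd d (u \<epsilon> (p \<epsilon>))) \<le> \<epsilon> ^ m" if z: "z \<in> F" for z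
  proof -
    obtain c L where cL: "z = (c, L)" by fastforce
    have c: "c \<in> charts X" and L: "compactin (mtop X) L" "L \<subseteq> fst c" using F(2) z cL by auto
    let ?f = "\<lambda>\<epsilon> x. (snd d \<circ> u \<epsilon> \<circ> chart_inv c) x - (snd d \<circ> v \<epsilon> \<circ> chart_inv c) x"
    have "negligible_difference 0 X Y u v" using uv by (simp add: net_equiv0_def)
    then have "ebigo (\<lambda>\<epsilon>. SUP p \<in> L \<inter> u \<epsilon> -` L'' \<inter> v \<epsilon> -` L''. deriv_norm 0 (?f \<epsilon>) (snd c p)) (\<lambda>\<epsilon>. \<epsilon> ^ Suc m)"
      by (rule negligible_difference_def[THEN iffD1, rule_format, OF _ _ c d]) (use L L''(2,3) in auto)
    then obtain B where "\<forall>\<^sub>F \<epsilon> in at_right 0.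
      (SUP p \<in> L \<inter> u \<epsilon> -` L'' \<inter> v \<epsilon> -` L''. deriv_norm 0 (?f \<epsilon>) (snd c p)) \<le> ennreal (B * \<bar>\<epsilon> ^ Suc m\<bar>)"
      unfolding ebigo_def by blast
    then show ?thesis
      using eventually_net_index eventually_power_le_power[of "\<bar>B\<bar>" m]
    proof eventually_elim
      case (elim \<epsilon>)
      show ?case
      proof (intro impI)
        assume "p \<epsilon> \<in> snd z" and uL: "u \<epsilon> (p \<epsilon>) \<in> L''" and vL: "v \<epsilon> (p \<epsilon>) \<in> L''"
        then have pL: "p \<epsilon> \<in> L" by (simp add: cL)
        then have "p \<epsilon> \<in> L \<inter> u \<epsilon> -` L'' \<inter> v \<epsilon> -` L''" using uL vL by simp
        then have "deriv_norm 0 (?f \<epsilon>) (snd c (p \<epsilon>)) \<le> ennreal (B * \<bar>\<epsilon> ^ Suc m\<bar>)"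
          by (rule order_trans[OF SUP_upper elim(1)])
        moreover have "?f \<epsilon> (snd c (p \<epsilon>)) = snd d (u \<epsilon> (p \<epsilon>)) - snd d (v \<epsilon> (p \<epsilon>))"
          using X.chart_inv_left[OF c, of "p \<epsilon>"] pL L(2) by auto
        ultimately have "ennreal (norm (snd d (u \<epsilon> (p \<epsilon>)) - snd d (v \<epsilon> (p \<epsilon>)))) \<le> ennreal (B * \<bar>\<epsilon> ^ Suc m\<bar>)"
          by (simp only: deriv_norm_0)
        also have "\<dots> \<le> ennreal (\<bar>B\<bar> * \<epsilon> ^ Suc m)"
          using elim(2) by (intro ennreal_leI) (simp add: mult_right_mono)
        finally have "norm (snd d (u \<epsilon> (p \<epsilon>)) - snd d (v \<epsilon> (p \<epsilon>))) \<le> \<bar>B\<bar> * \<epsilon> ^ Suc m"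
          by (subst (asm) ennreal_le_iff) (use elim(2) in auto)
        then show "dist (snd d (v \<epsilon> (p \<epsilon>))) (snd d (u \<epsilon> (p \<epsilon>))) \<le> \<epsilon> ^ m"
          using elim(3) by (simp add: dist_norm norm_minus_commute)
      qed
    qed
  qed
  have "\<forall>\<^sub>F \<epsilon> in at_right 0. \<forall>z\<in>F. p \<epsilon> \<in> snd z \<longrightarrow> u \<epsilon> (p \<epsilon>) \<in> L'' \<longrightarrow> v \<epsilon> (p \<epsilon>) \<in> L'' \<longrightarrow>
      dist (snd d (v \<epsilon> (p \<epsilon>))) (snd d (u \<epsilon> (p \<epsilon>))) \<le> \<epsilon> ^ m"
    using F(1) bound by (intro eventually_ball_finite) auto
  then show "\<forall>\<^sub>F \<epsilon> in at_right 0. u \<epsilon> (p \<epsilon>) \<in> L' \<longrightarrow>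
      v \<epsilon> (p \<epsilon>) \<in> fst d \<and> dist (snd d (v \<epsilon> (p \<epsilon>))) (snd d (u \<epsilon> (p \<epsilon>))) \<le> \<epsilon> ^ m"
    using K(2) close
  proof eventually_elim
    case (elim \<epsilon>)
    show ?case
    proof
      assume uL: "u \<epsilon> (p \<epsilon>) \<in> L'"
      have "rdist Y h (u \<epsilon> (p \<epsilon>)) (v \<epsilon> (p \<epsilon>)) < ennreal r"
        using elim(3) SUP_upper[OF elim(2), of "\<lambda>p. rdist Y h (u \<epsilon> p) (v \<epsilon> p)"] by (rule le_less_trans[rotated])
      from C(3)[OF uL this r(2)] have v: "v \<epsilon> (p \<epsilon>) \<in> fst d"
        "dist (snd d (v \<epsilon> (p \<epsilon>))) (snd d (u \<epsilon> (p \<epsilon>))) \<le> \<delta>" using r(3) by auto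
      then have "v \<epsilon> (p \<epsilon>) \<in> L''" by (intro L''(5)[OF uL])
      moreover have "u \<epsilon> (p \<epsilon>) \<in> L''" using uL L''(4) by blast
      moreover obtain c L where "(c, L) \<in> F" "p \<epsilon> \<in> L" using elim(2) F(3) by blast
      ultimately show "v \<epsilon> (p \<epsilon>) \<in> fst d \<and> dist (snd d (v \<epsilon> (p \<epsilon>))) (snd d (u \<epsilon> (p \<epsilon>))) \<le> \<epsilon> ^ m"
        using elim(1) v(1) by (metis snd_conv)
    qed
  qed
qed

text \<open>Choosing a witness of a failing estimate for each \<open>\<epsilon>\<close> for which there is one turns a pointwise
  estimate along all nets of points into a uniform estimate on \<open>K\<close>; no sequences of parameters have
  to be selected.\<close>

lemma cs_net_of_witnesses:
  fixes P :: "real \<Rightarrow> 'a \<Rightarrow> bool"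
  assumes K: "compactin (mtop X) K" "K \<noteq> {}"
  obtains p where "p \<in> cs_nets X" "\<forall>\<epsilon>. (\<exists>q\<in>K. P \<epsilon> q) \<longrightarrow> P \<epsilon> (p \<epsilon>)"
proof -
  have "\<forall>\<epsilon>. \<exists>q. q \<in> K \<and> ((\<exists>q\<in>K. P \<epsilon> q) \<longrightarrow> P \<epsilon> q)" using K(2) by blast
  from choice[OF this] obtain p where p: "\<And>\<epsilon>. p \<epsilon> \<in> K" "\<forall>\<epsilon>. (\<exists>q\<in>K. P \<epsilon> q) \<longrightarrow> P \<epsilon> (p \<epsilon>)"
    by blast
  have "p \<epsilon> \<in> topspace (mtop X)" for \<epsilon> using p(1) compactin_subset_topspace[OF K(1)] by blast
  then have "p \<in> cs_nets X"
    unfolding cs_nets_def using p(1) K(1) zero_less_one by blast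
  then show thesis using p(2) by (rule that)
qed

lemma net_equiv0I:
  assumes close: "\<And>p. p \<in> cs_nets X \<Longrightarrow> Y.rapidly_close (\<lambda>\<epsilon>. u \<epsilon> (p \<epsilon>)) (\<lambda>\<epsilon>. v \<epsilon> (p \<epsilon>))"
    and u: "u \<in> moderate_nets X Y"
  shows "net_equiv0 X Y u v"
  unfolding net_equiv0_def
proof
  obtain h where h: "riemannian_metric Y h" using Y.riemannian_metric_exists by blast
  have "((\<lambda>\<epsilon>. SUP p\<in>K. rdist Y h (u \<epsilon> p) (v \<epsilon> p)) \<longlongrightarrow> 0) (at_right 0)"
    if K: "compactin (mtop X) K" for K
  proof (cases "K = {}")
    case True
    then show ?thesis by (simp add: bot_ennreal)
  next
    case False
    show ?thesis
    proof (rule order_tendstoI)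
      fix a :: ennreal assume "a < 0"
      then show "\<forall>\<^sub>F \<epsilon> in at_right 0. a < (SUP p\<in>K. rdist Y h (u \<epsilon> p) (v \<epsilon> p))" by simp
    next
      fix a :: ennreal assume "0 < a"
      then obtain b where b: "0 < b" "b < a" using dense by blast
      have "\<exists>b'>0. ennreal b' \<le> b"
      proof (cases b)
        case (real r)
        then show ?thesis using b(1) by (intro exI[of _ r]) auto
      qed (auto intro: exI[of _ 1])
      then obtain b' where b': "b' > 0" "ennreal b' \<le> b" by blast
      define P where "P = (\<lambda>\<epsilon> q. \<not> rdist Y h (u \<epsilon> q) (v \<epsilon> q) \<le> b)"
      obtain p where pc: "p \<in> cs_nets X" "\<forall>\<epsilon>. (\<exists>q\<in>K. P \<epsilon> q) \<longrightarrow> P \<epsilon> (p \<epsilon>)"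
        using cs_net_of_witnesses[OF K False, of P] .
      have all: "\<forall>m>0::nat. ebigo (\<lambda>\<epsilon>. rdist Y h (u \<epsilon> (p \<epsilon>)) (v \<epsilon> (p \<epsilon>))) (\<lambda>\<epsilon>. \<epsilon> ^ m)"
        by (rule iffD2[OF Y.rdist_negligible_iff_rapidly_close[OF h moderate_nets_cs_nets[OF u pc(1)]]
              close[OF pc(1)]])
      have "ebigo (\<lambda>\<epsilon>. rdist Y h (u \<epsilon> (p \<epsilon>)) (v \<epsilon> (p \<epsilon>))) (\<lambda>\<epsilon>. \<epsilon> ^ Suc 0)"
        by (rule mp[OF spec[OF all]]) simp
      then obtain B where "\<forall>\<^sub>F \<epsilon> in at_right 0. rdist Y h (u \<epsilon> (p \<epsilon>)) (v \<epsilon> (p \<epsilon>)) \<le> ennreal (B * \<bar>\<epsilon> ^ Suc 0\<bar>)"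
        unfolding ebigo_def by blast
      then show "\<forall>\<^sub>F \<epsilon> in at_right 0. (SUP p\<in>K. rdist Y h (u \<epsilon> p) (v \<epsilon> p)) < a"
        using eventually_net_index eventually_power_less[OF b'(1), of B 0]
      proof eventually_elim
        case (elim \<epsilon>)
        have "ennreal (B * \<bar>\<epsilon> ^ Suc 0\<bar>) \<le> ennreal b'"
          using elim(2,3) by (intro ennreal_leI) auto
        then have "rdist Y h (u \<epsilon> (p \<epsilon>)) (v \<epsilon> (p \<epsilon>)) \<le> b"
          using elim(1) b'(2) by (meson order_trans)
        then have "rdist Y h (u \<epsilon> q) (v \<epsilon> q) \<le> b" if "q \<in> K" for q
          using pc(2) that unfolding P_def by blast
        then have "(SUP p\<in>K. rdist Y h (u \<epsilon> p) (v \<epsilon> p)) \<le> b" by (rule SUP_least)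
        then show ?case using b(2) by (rule le_less_trans)
      qed
    qed
  qed
  with h show "uniformly_close X Y u v" unfolding uniformly_close_def by blast
next
  show "negligible_difference 0 X Y u v"
    unfolding negligible_difference_def
  proof (intro allI impI ballI)
    fix m :: nat and c :: "('a, 'e) chart" and d :: "('b, 'f) chart" and L L'
    assume c: "c \<in> charts X" and d: "d \<in> charts Y"
      and LL: "compactin (mtop X) L \<and> L \<subseteq> fst c \<and> compactin (mtop Y) L' \<and> L' \<subseteq> fst d"
    let ?f = "\<lambda>\<epsilon> x. (snd d \<circ> u \<epsilon> \<circ> chart_inv c) x - (snd d \<circ> v \<epsilon> \<circ> chart_inv c) x"
    have L: "compactin (mtop X) L" "L \<subseteq> fst c" and L': "compactin (mtop Y) L'" "L' \<subseteq> fst d"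
      using LL by auto
    show "ebigo (\<lambda>\<epsilon>. SUP p \<in> L \<inter> u \<epsilon> -` L' \<inter> v \<epsilon> -` L'. deriv_norm 0 (?f \<epsilon>) (snd c p)) (\<lambda>\<epsilon>. \<epsilon> ^ m)"
    proof (cases "L = {}")
      case True
      then show ?thesis by (simp add: ebigo_def bot_ennreal)
    next
      case False
      define P where "P = (\<lambda>\<epsilon> q. u \<epsilon> q \<in> L' \<and> \<not> dist (snd d (v \<epsilon> q)) (snd d (u \<epsilon> q)) \<le> \<epsilon> ^ m)"
      obtain p where pc: "p \<in> cs_nets X" "\<forall>\<epsilon>. (\<exists>q\<in>L. P \<epsilon> q) \<longrightarrow> P \<epsilon> (p \<epsilon>)"
        using cs_net_of_witnesses[OF L(1) False, of P] .
      have "\<forall>\<^sub>F \<epsilon> in at_right 0. u \<epsilon> (p \<epsilon>) \<in> L' \<longrightarrow>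
          v \<epsilon> (p \<epsilon>) \<in> fst d \<and> dist (snd d (v \<epsilon> (p \<epsilon>))) (snd d (u \<epsilon> (p \<epsilon>))) \<le> \<epsilon> ^ m"
        by (rule Y.rapidly_closeD[OF close[OF pc(1)] d L'])
      then have "\<forall>\<^sub>F \<epsilon> in at_right 0. (SUP p \<in> L \<inter> u \<epsilon> -` L' \<inter> v \<epsilon> -` L'. deriv_norm 0 (?f \<epsilon>) (snd c p))
          \<le> ennreal (1 * \<bar>\<epsilon> ^ m\<bar>)"
      proof eventually_elim
        case (elim \<epsilon>)
        have "\<not> P \<epsilon> q" if "q \<in> L" for q
          using pc(2) that elim unfolding P_def by blast
        then have near: "dist (snd d (v \<epsilon> q)) (snd d (u \<epsilon> q)) \<le> \<epsilon> ^ m" if "q \<in> L" "u \<epsilon> q \<in> L'" for q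
          using that unfolding P_def by blast
        show ?case
        proof (rule SUP_least)
          fix q assume q: "q \<in> L \<inter> u \<epsilon> -` L' \<inter> v \<epsilon> -` L'"
          have "?f \<epsilon> (snd c q) = snd d (u \<epsilon> q) - snd d (v \<epsilon> q)"
            using X.chart_inv_left[OF c, of q] q L(2) by auto
          moreover have "norm (snd d (u \<epsilon> q) - snd d (v \<epsilon> q)) \<le> 1 * \<bar>\<epsilon> ^ m\<bar>"
            using near[of q] q by (simp add: dist_norm norm_minus_commute)
          ultimately show "deriv_norm 0 (?f \<epsilon>) (snd c q) \<le> ennreal (1 * \<bar>\<epsilon> ^ m\<bar>)"
            by (simp only: deriv_norm_0 ennreal_leI)
        qed
      qed
      then show ?thesis unfolding ebigo_def by blast
    qed
  qed
qed

lemma norm_frechet_derivative_le_deriv_norm: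
  assumes lin: "linear (frechet_derivative f (at x))" and b: "deriv_norm 1 f x \<le> ennreal b" "0 \<le> b"
  shows "norm (frechet_derivative f (at x) h) \<le> b * norm h"
proof (cases "h = 0")
  case True
  then show ?thesis using linear_0[OF lin] by simp
next
  case False
  define e where "e = h /\<^sub>R norm h"
  have e: "norm e \<le> 1" "h = norm h *\<^sub>R e" using False by (auto simp: e_def)
  have "ennreal (norm (iterated_deriv f [e] x)) \<le> deriv_norm 1 f x"
    unfolding deriv_norm_def by (rule SUP_upper) (use e(1) in simp)
  then have "ennreal (norm (frechet_derivative f (at x) e)) \<le> ennreal b" using b(1) by simp
  then have "norm (frechet_derivative f (at x) e) \<le> b" using b(2) by simp
  then have "norm h * norm (frechet_derivative f (at x) e) \<le> norm h * b" by (intro mult_left_mono) auto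
  moreover have "frechet_derivative f (at x) h = norm h *\<^sub>R frechet_derivative f (at x) e"
    by (subst e(2)) (simp add: linear_cmul[OF lin])
  ultimately show ?thesis by (simp add: mult.commute)
qed

text \<open>Moderate growth of first derivatives makes moderate nets preserve rapid closeness. The bound on
  the derivative along the segment between two points holds in a chart only; the trapping argument
  shows that the image of the segment does not leave it.\<close>

lemma moderate_nets_rapidly_close:
  assumes u: "u \<in> moderate_nets X Y" and p: "p \<in> cs_nets X" and pp: "X.rapidly_close p p'"
  shows "Y.rapidly_close (\<lambda>\<epsilon>. u \<epsilon> (p \<epsilon>)) (\<lambda>\<epsilon>. u \<epsilon> (p' \<epsilon>))"
  unfolding Y.rapidly_close_def
proof (intro ballI allI impI)
  fix d :: "('b, 'f) chart" and L' and m :: nat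
  assume d: "d \<in> charts Y" and L': "compactin (mtop Y) L' \<and> L' \<subseteq> fst d"
  obtain K where K: "compactin (mtop X) K" "\<forall>\<^sub>F \<epsilon> in at_right 0. p \<epsilon> \<in> K"
    using X.cs_nets_eventually_compact[OF p] .
  obtain F where F: "finite F"
    "\<And>c L. (c, L) \<in> F \<Longrightarrow> c \<in> charts X \<and> compactin (mtop X) L \<and> L \<subseteq> fst c"
    "K \<subseteq> (\<Union>(c, L)\<in>F. L)"
    using X.compact_chart_cover[OF K(1)] by metis
  obtain \<eta> N' where N': "\<eta> > 0" "compactin (mtop Y) N'" "N' \<subseteq> fst d"
    "\<And>p x. p \<in> L' \<Longrightarrow> dist x (snd d p) \<le> \<eta> \<Longrightarrow> x \<in> snd d ` N'"
    "\<And>p q. p \<in> L' \<Longrightarrow> q \<in> fst d \<Longrightarrow> dist (snd d q) (snd d p) \<le> \<eta> \<Longrightarrow> q \<in> N'"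
    using Y.chart_thickening[OF d conjunct1[OF L'] conjunct2[OF L']] by metis
  have bound: "\<forall>\<^sub>F \<epsilon> in at_right 0. p \<epsilon> \<in> snd z \<longrightarrow> u \<epsilon> (p \<epsilon>) \<in> L' \<longrightarrow>
      u \<epsilon> (p' \<epsilon>) \<in> fst d \<and> dist (snd d (u \<epsilon> (p' \<epsilon>))) (snd d (u \<epsilon> (p \<epsilon>))) \<le> \<epsilon> ^ m" if z: "z \<in> F" for z
  proof -
    obtain c L where cL: "z = (c, L)" by fastforce
    have c: "c \<in> charts X" and L: "compactin (mtop X) L" "L \<subseteq> fst c" using F(2) z cL by auto
    obtain \<delta> N where N: "\<delta> > 0" "compactin (mtop X) N" "N \<subseteq> fst c"
      "\<And>p x. p \<in> L \<Longrightarrow> dist x (snd c p) \<le> \<delta> \<Longrightarrow> x \<in> snd c ` N"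
      using X.chart_thickening[OF c L] by metis
    let ?f = "\<lambda>\<epsilon>. snd d \<circ> u \<epsilon> \<circ> chart_inv c"
    have "\<forall>k\<ge>1. \<forall>c\<in>charts X. \<forall>d\<in>charts Y. \<forall>L L'.
            compactin (mtop X) L \<and> L \<subseteq> fst c \<and> compactin (mtop Y) L' \<and> L' \<subseteq> fst d \<longrightarrow>
            (\<exists>N\<ge>1::nat. ebigo (\<lambda>\<epsilon>. SUP p \<in> L \<inter> u \<epsilon> -` L'. deriv_norm k (snd d \<circ> u \<epsilon> \<circ> chart_inv c) (snd c p))
                     (\<lambda>\<epsilon>. 1 / \<epsilon> ^ N))"
      using u by (simp add: moderate_nets_def)
    then have "\<exists>M\<ge>1::nat. ebigo (\<lambda>\<epsilon>. SUP p \<in> N \<inter> u \<epsilon> -` N'. deriv_norm 1 (?f \<epsilon>) (snd c p)) (\<lambda>\<epsilon>. 1 / \<epsilon> ^ M)"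
      using c d N(2,3) N'(2,3) by blast
    then obtain M B where B: "\<forall>\<^sub>F \<epsilon> in at_right 0.
      (SUP p \<in> N \<inter> u \<epsilon> -` N'. deriv_norm 1 (?f \<epsilon>) (snd c p)) \<le> ennreal (B * \<bar>1 / \<epsilon> ^ M\<bar>)"
      unfolding ebigo_def by blast
    \<comment> \<open>The exponent compensates the growth \<open>\<epsilon>\<^sup>-\<^sup>M\<close> of the derivative and the constant \<open>B\<close>.\<close>
    show ?thesis
      using B eventually_net_index X.rapidly_closeD[OF pp c L, of "Suc (m + M)"]
        eventually_power_less[OF N(1), of 1 "m + M"] eventually_power_less[OF N'(1), of "\<bar>B\<bar>" m]
        eventually_power_le_power[of "\<bar>B\<bar>" m]
    proof eventually_elim
      case (elim \<epsilon>)
      show ?case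
      proof (intro impI)
        assume "p \<epsilon> \<in> snd z" and uL: "u \<epsilon> (p \<epsilon>) \<in> L'"
        then have pL: "p \<epsilon> \<in> L" by (simp add: cL)
        then have p'c: "p' \<epsilon> \<in> fst c" and v\<epsilon>: "dist (snd c (p' \<epsilon>)) (snd c (p \<epsilon>)) \<le> \<epsilon> ^ Suc (m + M)"
          using elim(3) by auto
        have \<epsilon>: "\<epsilon> > 0" "\<epsilon> \<in> net_index" using elim(2) by auto
        define v where "v = snd c (p' \<epsilon>) - snd c (p \<epsilon>)"
        define l where "l = (\<lambda>t::real. snd c (p \<epsilon>) + t *\<^sub>R v)"
        define \<gamma> where "\<gamma> = u \<epsilon> \<circ> (chart_inv c \<circ> l)"
        define b where "b = \<bar>B\<bar> * (1 / \<epsilon> ^ M)"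
        define r where "r = \<bar>B\<bar> * \<epsilon> ^ Suc m"
        have b0: "b \<ge> 0" using \<epsilon>(1) by (simp add: b_def)
        have v: "norm v \<le> \<epsilon> ^ Suc (m + M)" "norm v \<le> \<delta>"
          using v\<epsilon> elim(4) by (simp_all add: v_def dist_norm)
        have bv: "b * norm v \<le> r"
        proof -
          have "b * norm v \<le> b * \<epsilon> ^ Suc (m + M)" using v(1) b0 by (rule mult_left_mono)
          also have "\<dots> = r" using \<epsilon>(1) by (simp add: b_def r_def power_add)
          finally show ?thesis .
        qed
        have deriv_b: "deriv_norm 1 (?f \<epsilon>) (snd c q) \<le> ennreal b" if "q \<in> N" "u \<epsilon> q \<in> N'" for q
        proof -
          have "deriv_norm 1 (?f \<epsilon>) (snd c q) \<le> ennreal (B * \<bar>1 / \<epsilon> ^ M\<bar>)"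
            by (rule order_trans[OF SUP_upper elim(1)]) (use that in simp)
          also have "\<dots> \<le> ennreal b"
            unfolding b_def using \<epsilon>(1) by (intro ennreal_leI) (simp add: divide_right_mono)
          finally show ?thesis .
        qed
        have lN: "l t \<in> snd c ` N" if "t \<in> {0..1}" for t
        proof -
          have "\<bar>t\<bar> * norm v \<le> 1 * \<delta>" using that v(2) by (intro mult_mono) auto
          then show ?thesis by (intro N(4)[OF pL]) (simp add: l_def dist_norm)
        qed
        have qN: "chart_inv c (l t) \<in> N" "snd c (chart_inv c (l t)) = l t" if t: "t \<in> {0..1}" for t
        proof -
          obtain q where q: "q \<in> N" "l t = snd c q" using lN[OF t] by blast
          then show "chart_inv c (l t) \<in> N" "snd c (chart_inv c (l t)) = l t"
            using X.chart_inv_left[OF c, of q] N(3) by auto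
        qed
        have contl: "continuous_on {0..1} l" unfolding l_def by (intro continuous_intros)
        have l_im: "l t \<in> snd c ` fst c" if "t \<in> {0..1}" for t using lN[OF that] N(3) by blast
        have cont: "continuous_map (top_of_set {0..1}) (mtop Y) \<gamma>"
        proof -
          have "continuous_map (top_of_set {0..1}) (top_of_set (snd c ` fst c)) l"
            using contl l_im by (auto simp: continuous_map_in_subtopology)
          then have "continuous_map (top_of_set {0..1}) (mtop X) (chart_inv c \<circ> l)"
            by (rule continuous_map_compose[OF _ X.chart_inv_continuous[OF c]])
          then show ?thesis unfolding \<gamma>_def
            by (rule continuous_map_compose[OF _ moderate_nets_smooth(1)[OF u \<epsilon>(2)]])
        qed
        have ends: "\<gamma> 0 = u \<epsilon> (p \<epsilon>)" "\<gamma> 1 = u \<epsilon> (p' \<epsilon>)"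
          using X.chart_inv_left[OF c] pL L(2) p'c by (auto simp: \<gamma>_def l_def v_def)
        have f\<gamma>: "?f \<epsilon> (l t) = snd d (\<gamma> t)" for t by (simp add: \<gamma>_def)
        have step: "dist (snd d (\<gamma> t)) (snd d (u \<epsilon> (p \<epsilon>))) \<le> r"
          if t: "t \<in> {0..1}"
            and inA: "\<And>s. s \<in> {0..t} \<Longrightarrow> \<gamma> s \<in> fst d \<and> dist (snd d (\<gamma> s)) (snd d (u \<epsilon> (p \<epsilon>))) < \<eta>" for t
        proof -
          let ?S = "snd c ` (fst c \<inter> u \<epsilon> -` fst d)"
          have smooth: "smooth_on ?S (?f \<epsilon>)" by (rule moderate_nets_smooth(2)[OF u \<epsilon>(2) c d])
          have seg: "l ` {0..t} = closed_segment (l 0) (l t)"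
          proof -
            have "l ` closed_segment 0 t = closed_segment (l 0) (l t)"
              unfolding l_def by (auto simp: closed_segment_def image_iff algebra_simps)
            then show ?thesis using t by (simp add: closed_segment_eq_real_ivl)
          qed
          have "norm (?f \<epsilon> (l t) - ?f \<epsilon> (l 0)) \<le> b * norm (l t - l 0)"
          proof (rule differentiable_bound[of "closed_segment (l 0) (l t)" _ "\<lambda>x. frechet_derivative (?f \<epsilon>) (at x)"])
            fix x assume "x \<in> closed_segment (l 0) (l t)"
            then obtain s where s: "s \<in> {0..t}" "x = l s" unfolding seg[symmetric] by blast
            then have s1: "s \<in> {0..1}" using t by auto
            have \<gamma>s: "u \<epsilon> (chart_inv c (l s)) = \<gamma> s" by (simp add: \<gamma>_def)
            have "chart_inv c (l s) \<in> fst c \<inter> u \<epsilon> -` fst d"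
              using qN(1)[OF s1] N(3) inA[OF s(1)] \<gamma>s by auto
            then have "snd c (chart_inv c (l s)) \<in> ?S" by (rule imageI)
            then have xS: "x \<in> ?S" by (simp only: qN(2)[OF s1] s(2))
            have D: "(?f \<epsilon> has_derivative frechet_derivative (?f \<epsilon>) (at x)) (at x)"
              by (rule smooth_on_has_derivative[OF smooth xS])
            then show "(?f \<epsilon> has_derivative frechet_derivative (?f \<epsilon>) (at x)) (at x within closed_segment (l 0) (l t))"
              by (rule has_derivative_at_withinI)
            have "\<gamma> s \<in> N'" using inA[OF s(1)] N'(5)[OF uL, of "\<gamma> s"] by auto
            then have db: "deriv_norm 1 (?f \<epsilon>) x \<le> ennreal b"
              using deriv_b[OF qN(1)[OF s1]] by (simp only: \<gamma>s qN(2)[OF s1] s(2))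
            show "onorm (frechet_derivative (?f \<epsilon>) (at x)) \<le> b"
              by (rule onorm_bound[OF b0 norm_frechet_derivative_le_deriv_norm[OF has_derivative_linear[OF D] db b0]])
          qed auto
          also have "\<dots> = b * (t * norm v)" using t by (simp add: l_def)
          also have "\<dots> \<le> b * (1 * norm v)" using t b0 by (intro mult_left_mono mult_right_mono) auto
          also have "\<dots> \<le> r" using bv by simp
          finally show ?thesis unfolding f\<gamma> ends(1) by (simp add: dist_norm)
        qed
        have r: "0 \<le> r" "r < \<eta>" "r \<le> \<epsilon> ^ m" using \<epsilon>(1) elim(5,6) by (simp_all add: r_def)
        have im: "cball (snd d (u \<epsilon> (p \<epsilon>))) r \<subseteq> snd d ` fst d"
        proof
          fix y assume "y \<in> cball (snd d (u \<epsilon> (p \<epsilon>))) r"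
          then have "y \<in> snd d ` N'" using r(2) by (intro N'(4)[OF uL]) (simp add: dist_commute)
          then show "y \<in> snd d ` fst d" using N'(3) by blast
        qed
        have ud: "u \<epsilon> (p \<epsilon>) \<in> fst d" using uL L' by blast
        have "\<gamma> 1 \<in> fst d \<and> dist (snd d (\<gamma> 1)) (snd d (u \<epsilon> (p \<epsilon>))) \<le> r"
          by (rule Y.curve_trapped_in_chart_ball[OF d ud r(1,2) im cont ends(1) step])
        then show "u \<epsilon> (p' \<epsilon>) \<in> fst d \<and> dist (snd d (u \<epsilon> (p' \<epsilon>))) (snd d (u \<epsilon> (p \<epsilon>))) \<le> \<epsilon> ^ m"
          using r(3) ends(2) by simp
      qed
    qed
  qed
  have "\<forall>\<^sub>F \<epsilon> in at_right 0. \<forall>z\<in>F. p \<epsilon> \<in> snd z \<longrightarrow> u \<epsilon> (p \<epsilon>) \<in> L' \<longrightarrow>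
      u \<epsilon> (p' \<epsilon>) \<in> fst d \<and> dist (snd d (u \<epsilon> (p' \<epsilon>))) (snd d (u \<epsilon> (p \<epsilon>))) \<le> \<epsilon> ^ m"
    using F(1) bound by (intro eventually_ball_finite) auto
  then show "\<forall>\<^sub>F \<epsilon> in at_right 0. u \<epsilon> (p \<epsilon>) \<in> L' \<longrightarrow>
      u \<epsilon> (p' \<epsilon>) \<in> fst d \<and> dist (snd d (u \<epsilon> (p' \<epsilon>))) (snd d (u \<epsilon> (p \<epsilon>))) \<le> \<epsilon> ^ m"
    using K(2)
  proof eventually_elim
    case (elim \<epsilon>)
    obtain c L where "(c, L) \<in> F" "p \<epsilon> \<in> L" using elim(2) F(3) by blast
    then show ?case using elim(1) by (metis snd_conv)
  qed
qed

lemma iterated_deriv_zero: "iterated_deriv (\<lambda>x. 0) hs = (\<lambda>x. 0)"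
  by (induction hs) simp_all

text \<open>Reflexivity puts a net into its own class: \<open>point_value\<close> is a definite description ranging over
  the members of the classes, so it is only meaningful if these are nonempty.\<close>

lemma net_equiv_refl:
  assumes u: "u \<in> moderate_nets X Y"
  shows "net_equiv X Y u u"
proof -
  have "uniformly_close X Y u u"
    using net_equiv0I[OF Y.rapidly_close_refl u] by (simp add: net_equiv0_def)
  moreover have "negligible_difference k X Y u u" for k
  proof -
    have "deriv_norm k (\<lambda>x. f x - f x) y \<le> 0" for y :: 'e and f :: "'e \<Rightarrow> 'f"
      unfolding deriv_norm_def by (rule SUP_least) (simp add: iterated_deriv_zero)
    then have "(SUP p \<in> A. deriv_norm k (\<lambda>x. f x - f x) (s p)) \<le> 0" for A and f :: "'e \<Rightarrow> 'f" and s :: "'a \<Rightarrow> 'e"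
      by (intro SUP_least)
    then have "(SUP p \<in> A. deriv_norm k (\<lambda>x. f x - f x) (s p)) \<le> ennreal (0 * r)" for A and f :: "'e \<Rightarrow> 'f" and s :: "'a \<Rightarrow> 'e" and r
      by simp
    then show ?thesis unfolding negligible_difference_def ebigo_def
      by (intro allI impI ballI exI[of _ 0] always_eventually)
  qed
  ultimately show ?thesis by (simp add: net_equiv_def)
qed

text \<open>Representatives are changed in two steps, first of the generalized point with \<open>u\<close> fixed, then of
  the generalized function along the new net of points. Each step preserves rapid closeness.\<close>

lemma point_value_eq:
  assumes u: "u \<in> moderate_nets X Y" and p: "p \<in> cs_nets X"
  shows "point_value X Y (gen_fun_class X Y u) (gen_point_class X p) = gen_point_class Y (\<lambda>\<epsilon>. u \<epsilon> (p \<epsilon>))"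
proof -
  let ?U = "gen_fun_class X Y u" and ?P = "gen_point_class X p"
  have "u \<in> ?U" using u net_equiv_refl[OF u] by (simp add: gen_fun_class_def gen_fun_rel_def)
  moreover have "p \<in> ?P" using p X.rapidly_close_refl by (simp add: gen_point_class_def X.gen_point_rel_iff)
  moreover have "gen_point_class Y (\<lambda>\<epsilon>. u \<epsilon> (p \<epsilon>)) = gen_point_class Y (\<lambda>\<epsilon>. u' \<epsilon> (p' \<epsilon>))"
    if u': "u' \<in> ?U" and p': "p' \<in> ?P" for u' p'
  proof -
    have u': "u' \<in> moderate_nets X Y" "net_equiv X Y u u'"
      using u' by (auto simp: gen_fun_class_def gen_fun_rel_def)
    have p': "p' \<in> cs_nets X" "X.rapidly_close p p'"
      using p' by (auto simp: gen_point_class_def X.gen_point_rel_iff)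
    have "net_equiv0 X Y u u'" using u'(2) by (simp add: net_equiv_def net_equiv0_def)
    then have "Y.rapidly_close (\<lambda>\<epsilon>. u \<epsilon> (p' \<epsilon>)) (\<lambda>\<epsilon>. u' \<epsilon> (p' \<epsilon>))"
      by (rule net_equiv0_imp_rapidly_close[OF _ p'(1)])
    with moderate_nets_rapidly_close[OF u p p'(2)]
    have "Y.rapidly_close (\<lambda>\<epsilon>. u \<epsilon> (p \<epsilon>)) (\<lambda>\<epsilon>. u' \<epsilon> (p' \<epsilon>))" by (rule Y.rapidly_close_trans)
    then show ?thesis
      using Y.gen_point_class_eq_iff[OF moderate_nets_cs_nets[OF u p] moderate_nets_cs_nets[OF u'(1) p'(1)]]
      by blast
  qed
  ultimately show ?thesis unfolding point_value_def by (intro the_equality) blast+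
qed

end

theorem proposition2p14:
  fixes X :: "('a, 'e::findim_inner) mfd" and Y :: "('b, 'f::findim_inner) mfd"
    and u v :: "real \<Rightarrow> 'a \<Rightarrow> 'b"
  assumes "smooth_manifold X" and "smooth_manifold Y"
    and "u \<in> moderate_nets X Y" and "U \<in> gen_funs X Y" and "U = gen_fun_class X Y u"
    and "v \<in> moderate_nets X Y" and "V \<in> gen_funs X Y" and "V = gen_fun_class X Y v"
  shows "net_equiv0 X Y u v \<longleftrightarrow>
    (\<forall>P \<in> gen_points X. point_value X Y U P = point_value X Y V P)"
proof -
  interpret smooth_mfd_pair X Y
    by unfold_locales (rule assms)+
  have points: "gen_points X = gen_point_class X ` cs_nets X"
    unfolding gen_points_def gen_point_class_def quotient_def by blast
  have value_eq_iff: "point_value X Y U (gen_point_class X p) = point_value X Y V (gen_point_class X p) \<longleftrightarrow>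
      Y.rapidly_close (\<lambda>\<epsilon>. u \<epsilon> (p \<epsilon>)) (\<lambda>\<epsilon>. v \<epsilon> (p \<epsilon>))" if p: "p \<in> cs_nets X" for p
    unfolding assms(5,8) point_value_eq[OF assms(3) p] point_value_eq[OF assms(6) p]
    by (rule Y.gen_point_class_eq_iff) (intro moderate_nets_cs_nets assms p)+
  have "net_equiv0 X Y u v \<longleftrightarrow> (\<forall>p\<in>cs_nets X. Y.rapidly_close (\<lambda>\<epsilon>. u \<epsilon> (p \<epsilon>)) (\<lambda>\<epsilon>. v \<epsilon> (p \<epsilon>)))"
    using net_equiv0_imp_rapidly_close net_equiv0I[OF _ assms(3)] by blast
  then show ?thesis unfolding points by (simp add: value_eq_iff)
qed

end
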